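(* Let $q\in L_1(0,1)$ and let $N:\mathbb R\to\mathbb R$ be given by $N(u)=\sum_{i=1}^\infty a_iu^i$ for all $u\in\mathbb R$ (real coefficients $a_i$, series convergent for every real $u$). Fix $\overline N\in C^\infty(\mathbb R)$ with $\left|\frac{d^k}{du^k}N(u)\right|\le \frac{d^k}{du^k}\overline N(w)\big|_{w=|u|}$ for all $u\in\mathbb R$, $k=0,1,2,\dots$. Consider the nonlinear eigenvalue transmission problem $$u_1''+[\lambda-q(x)]u_1-N(u_1)=0,\ x\in(0,\tfrac12),\qquad u_2''+[\lambda-q(x)]u_2-N(u_2)=0,\ x\in(\tfrac12,1),$$ $$u_1(0)=u_2(1)=0,\quad u_1'(0)=1,\quad u_2(\tfrac12)-u_1(\tfrac12)=0,\quad u_2'(\tfrac12)-u_1'(\tfrac12)=1.$$ Let $(\lambda_n^{(j)},u_n^{(j)})_{j\ge0}$ be the FD-method sequence described in the context, started from the trial eigenpair $(\lambda_n^{(0)},u_n^{(0)})$, and $\overset{m}{\lambda}_n=\sum_{j=0}^m\lambda_n^{(j)}$, $\overset{m}{u}_n=\sum_{j=0}^m u_n^{(j)}$. Let $R$ be the radius of convergence of the power series $f(z)=\sum_{j\ge0}\overline v_jz^j$ defined in the context. (a) Let $\lambda_n^{(0)}=4\pi^2(\pm\frac23+2n)^2$, $n\in\{0,1,2,\dots\}$, with $u_{n1}^{(0)}(x)=\sin(\sqrt{\lambda_n^{(0)}}x)/\sqrt{\lambda_n^{(0)}}$, $u_{n2}^{(0)}(x)=\sin(\sqrt{\lambda_n^{(0)}}(1-x))/\sqrt{\lambda_n^{(0)}}$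 ($\sqrt{\lambda_n^{(0)}}>0$), and assume $r_n=\frac{2+\sqrt3}{\sqrt3\sqrt{\lambda_n^{(0)}}\,R}<1$. Then the series $\lambda_n=\sum_j\lambda_n^{(j)}$, $u_n=\sum_j u_n^{(j)}$ converge to the corresponding eigensolution $(\lambda_n,u_n)$ of the nonlinear problem, and there exist constants $c>0,\varepsilon>0$ such that, with $C=c/(1-r_n)$, for all $m\ge0$ $$\|u_n-\overset{m}{u}_n\|_\infty\le\frac{3C}{8(m+1)^{1+\varepsilon}\sqrt{\lambda_n^{(0)}}}\,r_n^{m+1},\qquad |\lambda_n-\overset{m}{\lambda}_n|\le\frac{C}{(m+1)^{1+\varepsilon}R}\,r_n^{m}.$$ (b) Let $\lambda_n^{(0)}=4\pi^2n^2$, $n\in\{1,2,\dots\}$, with $u_{n1}^{(0)}(x)=\frac{\sin(2\pi nx)}{2\pi n}$, $u_{n2}^{(0)}(x)=\frac{(-1)^n+1}{2\pi n}\sin(2\pi nx)$, and assume $r_n=\frac1{\pi nR}<1$. Then the series $\lambda_n=\sum_j\lambda_n^{(j)}$, $u_n=\sum_ju_n^{(j)}$ converge to the corresponding eigensolution $(\lambda_n,u_n)$ of the nonlinear problem, and there exist constants $c>0,\varepsilon>0$ such that, with $C=c/(1-r_n)$, for all $m\ge0$ $$|\lambda_n-\overset{m}{\lambda}_n|\le\frac{C}{(m+1)^{1+\varepsilon}R}\,r_n^m,$$ and $\|u_n-\overset{m}{u}_n\|_\infty\le\frac{3C}{8\pi n(m+1)^{1+\varepsilon}}r_n^{m+1}$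 if $n$ is even, while $\|u_n-\overset{m}{u}_n\|_\infty\le\frac{C}{8\pi n(m+1)^{1+\varepsilon}}r_n^{m+1}$ if $n$ is odd.
   Context: Notation: a function $u$ on $[0,1]$ is a pair $(u_1,u_2)$ with $u_1$ on $[0,\frac12]$, $u_2$ on $[\frac12,1]$; $\|u\|_\infty=\max\{\sup_{[0,1/2]}|u_1|,\sup_{[1/2,1]}|u_2|\}$, $\|q\|_{0,1}=\int_0^1|q|\,dx$, and $[f(\frac12)]=f_2(\frac12)-f_1(\frac12)$. Adomian polynomials: for a smooth function $G$ and functions $w_0,\dots,w_j$, $A_0(G;w_0)=G(w_0)$ and for $j\ge1$ $$A_j(G;w_0,\dots,w_j)=\sum_{\substack{\alpha_1+\dots+\alpha_j=j\\ \alpha_1\ge\dots\ge\alpha_j\ge0,\ \alpha_i\in\mathbb Z}} G^{(\alpha_1)}(w_0)\frac{w_1^{\alpha_1-\alpha_2}}{(\alpha_1-\alpha_2)!}\cdots\frac{w_{j-1}^{\alpha_{j-1}-\alpha_j}}{(\alpha_{j-1}-\alpha_j)!}\frac{w_j^{\alpha_j}}{\alpha_j!}.$$ FD-method: the trial eigenpair $(\lambda_n^{(0)},u_n^{(0)})$ is the one given in (a) or (b) (an exact solution of the linear problem with $q\equiv0$, $N\equiv0$). For $j=0,1,2,\dots$, the correction $(\lambda_n^{(j+1)},u_n^{(j+1)})$ is the (unique) real number and pair of functions such that $$u_{ni}^{(j+1)\prime\prime}+\lambda_n^{(0)}u_{ni}^{(j+1)}=F_{ni}^{(j+1)},\ i=1,2,\quad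 u_{n1}^{(j+1)}(0)=u_{n2}^{(j+1)}(1)=0,\ u_{n1}^{(j+1)\prime}(0)=0,\ [u_n^{(j+1)}(\tfrac12)]=0,\ [u_n^{(j+1)\prime}(\tfrac12)]=0,$$ with $F_{ni}^{(j+1)}=-\sum_{p=0}^j\lambda_n^{(j+1-p)}u_{ni}^{(p)}+q\,u_{ni}^{(j)}+A_j(N;u_{ni}^{(0)},\dots,u_{ni}^{(j)})$ (the value $\lambda_n^{(j+1)}$ is fixed by solvability of this overdetermined problem). Majorant series: $\overline v_0=\frac83$, $\overline v_1=(1+\overline v_0)\big(\|q\|_{0,1}\overline v_0+\overline N'(\overline v_0)\overline v_0\big)$, and for $j\ge1$ $$\overline v_{j+1}=\sum_{p=1}^j\overline v_{j+1-p}\overline v_p+(1+\overline v_0)\big(\|q\|_{0,1}\overline v_j+A_j(\overline N;\overline v_0,\dots,\overline v_j)\big);$$ $f(z)=\sum_{j\ge0}\overline v_jz^j$ (it satisfies $f-\overline v_0=(f-\overline v_0)^2+(1+\overline v_0)z[\|q\|_{0,1}f+\overline N(f)+\overline N'(\overline v_0)\overline v_0-\overline N(\overline v_0)]$), and $R>0$ is its radius of convergence. *)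

theory Defs
  imports "HOL-Analysis.Analysis"
begin

text \<open>Index set of the Adomian polynomial A_j: integer tuples
  alpha_1 >= ... >= alpha_j >= 0 with sum j, encoded as functions nat => nat
  that vanish at 0 and above j.\<close>
definition adom_idx :: "nat \<Rightarrow> (nat \<Rightarrow> nat) set" where
  "adom_idx j = {\<alpha>. (\<forall>i. (i = 0 \<or> j < i) \<longrightarrow> \<alpha> i = 0)
                    \<and> (\<forall>i\<in>{1..<j}. \<alpha> (Suc i) \<le> \<alpha> i)
                    \<and> (\<Sum>i\<in>{1..j}. \<alpha> i) = j}"

text \<open>Adomian polynomial A_j(G; w_0,...,w_j) (only w 0 .. w j are used).
  Since alpha (j+1) = 0, the last factor is w_j^alpha_j / alpha_j!.  For j = 0
  the formula gives G(w_0).\<close>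
definition adomian :: "(real \<Rightarrow> real) \<Rightarrow> nat \<Rightarrow> (nat \<Rightarrow> real) \<Rightarrow> real" where
  "adomian G j w = (\<Sum>\<alpha>\<in>adom_idx j. (deriv ^^ \<alpha> 1) G (w 0) *
       (\<Prod>i\<in>{1..j}. w i ^ (\<alpha> i - \<alpha> (Suc i)) / fact (\<alpha> i - \<alpha> (Suc i))))"

text \<open>ode_sol a b mu u du g: u is a (Caratheodory) solution of u'' + mu u = g on [a,b]
  with derivative du: u is differentiable on [a,b] with derivative du, and du is
  absolutely continuous with du' = g - mu u (a.e.), i.e.
  du x - du a = integral over [a,x] of (g - mu u).\<close>
definition ode_sol :: "real \<Rightarrow> real \<Rightarrow> real \<Rightarrow> (real \<Rightarrow> real) \<Rightarrow> (real \<Rightarrow> real)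
                        \<Rightarrow> (real \<Rightarrow> real) \<Rightarrow> bool" where
  "ode_sol a b \<mu> u du g \<longleftrightarrow>
     (\<forall>x\<in>{a..b}. (u has_real_derivative du x) (at x within {a..b})) \<and>
     (\<forall>x\<in>{a..b}. ((\<lambda>t. g t - \<mu> * u t) has_integral (du x - du a)) {a..x})"

definition nl_eigensol :: "(real \<Rightarrow> real) \<Rightarrow> (real \<Rightarrow> real) \<Rightarrow> real
                          \<Rightarrow> (real \<Rightarrow> real) \<Rightarrow> (real \<Rightarrow> real) \<Rightarrow> bool" where
  "nl_eigensol q N L U1 U2 \<longleftrightarrow>
     (\<exists>dU1 dU2. ode_sol 0 (1/2) L U1 dU1 (\<lambda>x. q x * U1 x + N (U1 x)) \<and>
                ode_sol (1/2) 1 L U2 dU2 (\<lambda>x. q x * U2 x + N (U2 x)) \<and>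
                U1 0 = 0 \<and> U2 1 = 0 \<and> dU1 0 = 1 \<and>
                U2 (1/2) - U1 (1/2) = 0 \<and> dU2 (1/2) - dU1 (1/2) = 1)"

definition FD_seq :: "(real \<Rightarrow> real) \<Rightarrow> (real \<Rightarrow> real) \<Rightarrow> (nat \<Rightarrow> real)
                     \<Rightarrow> (nat \<Rightarrow> real \<Rightarrow> real) \<Rightarrow> (nat \<Rightarrow> real \<Rightarrow> real) \<Rightarrow> bool" where
  "FD_seq q N lam u1 u2 \<longleftrightarrow>
    (\<forall>j. \<exists>du1 du2.
       ode_sol 0 (1/2) (lam 0) (u1 (Suc j)) du1
         (\<lambda>x. - (\<Sum>p\<le>j. lam (Suc j - p) * u1 p x) + q x * u1 j x + adomian N j (\<lambda>p. u1 p x)) \<and>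
       ode_sol (1/2) 1 (lam 0) (u2 (Suc j)) du2
         (\<lambda>x. - (\<Sum>p\<le>j. lam (Suc j - p) * u2 p x) + q x * u2 j x + adomian N j (\<lambda>p. u2 p x)) \<and>
       u1 (Suc j) 0 = 0 \<and> u2 (Suc j) 1 = 0 \<and> du1 0 = 0 \<and>
       u2 (Suc j) (1/2) - u1 (Suc j) (1/2) = 0 \<and> du2 (1/2) - du1 (1/2) = 0)"

text \<open>1/R for R the radius of convergence (R > 0 an extended real; 1/infinity = 0).\<close>
definition Rinv :: "(nat \<Rightarrow> real) \<Rightarrow> real" where
  "Rinv v = real_of_ereal (inverse (conv_radius v))"

end

theory Submission
  imports Defs
begin

text \<open>Write \<open>\<omega>\<^sup>2\<close> for the trial eigenvalue. Variation of parameters gives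
  \<open>\<omega> u(x) = \<integral>\<^sub>0\<^sup>x sin (\<omega> (x - t)) F(t) dt\<close> for a correction with right-hand side \<open>F\<close>, and the
  condition \<open>u(1) = 0\<close> determines \<open>\<lambda>\<^sup>(\<^sup>j\<^sup>+\<^sup>1\<^sup>)\<close>. Bounding the sine by 1 is enough to dominate the
  corrections inductively by multiples of \<open>\<kappa>\<^sup>j vb\<^sub>j\<close>, where \<open>\<kappa> R\<^sup>-\<^sup>1\<close> is the rate \<open>r\<^sub>n\<close>.

  The factor \<open>(m + 1)\<^sup>-\<^sup>1\<^sup>-\<^sup>\<epsilon>\<close> comes from \<open>vb\<^sub>n R\<^sup>n = O(n\<^sup>-\<^sup>3\<^sup>/\<^sup>2)\<close>: the series \<open>y = f - vb\<^sub>0\<close> solves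
  \<open>y = y\<^sup>2 + z H(y)\<close> with \<open>H\<close> entire with nonnegative coefficients, that is \<open>y = z \<psi>(y)\<close> with
  \<open>\<psi>(w) = H(w) / (1 - w)\<close>. By Lagrange inversion \<open>vb\<^sub>n = [w\<^sup>n\<^sup>-\<^sup>1] \<psi>(w)\<^sup>n / n\<close>, and after rescaling this
  coefficient is a point probability of a sum of \<open>n\<close> independent variables, hence \<open>O(n\<^sup>-\<^sup>1\<^sup>/\<^sup>2)\<close>.\<close>

section \<open>Adomian polynomials\<close>

text \<open>The bounds contain powers of \<open>r\<close> itself, not of a slightly larger number,
  so convergence of the majorant series inside its disc is not enough: the coefficients must be
  controlled at the boundary. This is done without locating or classifying the singularity of
  \<open>f\<close>; the one-sided inequality between \<open>R\<close> and the maximum of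
  \<open>t (1 - t) / H(t)\<close> points in the right direction. The constant \<open>c\<close> may
  depend on everything except \<open>m\<close>, so prefactors like \<open>3 / (8 \<omega>)\<close>
  can be absorbed and only the rate has to be right. Both families of trial eigenpairs are then
  instances of one locale. They differ in the sup bounds of the trial function and in
  \<open>G\<close>, the reciprocal of the size of its pairing with
  \<open>sin (\<omega> (1 - t))\<close>. Since \<open>q\<close> is only integrable, derivatives of
  the corrections are merely absolutely continuous. Hence right-hand sides are measured in the L1
  norm, integration by parts needs its own proof, and the limit in the equation is taken by
  dominated convergence.\<close>

text \<open>Partitions of \<open>j\<close> with largest part \<open>k\<close> and at most
  \<open>m\<close> parts, indexed from 0. The largest part is a parameter of its own because it
  becomes the order of the derivative; starting at 0 lets \<open>case_nat\<close> attach a new first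
  row.\<close>

definition ferrers :: "nat \<Rightarrow> nat \<Rightarrow> nat \<Rightarrow> (nat \<Rightarrow> nat) set" where
  "ferrers m k j = {\<alpha>. \<alpha> 0 = k \<and> (\<forall>i. \<alpha> (Suc i) \<le> \<alpha> i) \<and> (\<forall>i\<ge>m. \<alpha> i = 0) \<and> (\<Sum>i<m. \<alpha> i) = j}"

lemma ferrers_zero: "ferrers m 0 j = (if j = 0 then {\<lambda>_. 0} else {})"
proof -
  have *: "\<alpha> i = 0" if "\<alpha> 0 = 0" "\<forall>i. \<alpha> (Suc i) \<le> \<alpha> i" for \<alpha> :: "nat \<Rightarrow> nat" and i
    using that by (induction i) (auto, metis le_zero_eq)
  have "ferrers m 0 j \<subseteq> (if j = 0 then {\<lambda>_. 0} else {})"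
    using * by (force simp: ferrers_def fun_eq_iff)
  then show ?thesis by (auto simp: ferrers_def split: if_splits)
qed

lemma ferrers_empty:
  assumes "j < k"
  shows "ferrers (Suc m) k j = {}"
proof -
  have False if "\<alpha> \<in> ferrers (Suc m) k j" for \<alpha>
  proof -
    have "\<alpha> 0 \<le> (\<Sum>i<Suc m. \<alpha> i)" by (rule member_le_sum) auto
    with that assms show False unfolding ferrers_def by simp
  qed
  then show ?thesis by blast
qed

text \<open>Removing the largest part leaves a partition of \<open>j - k\<close> whose largest part
  \<open>l\<close> is at most \<open>k\<close>. This recursion yields both finiteness and the
  generating function.\<close>

lemma ferrers_Suc:
  assumes "k \<le> j"
  shows "ferrers (Suc m) k j = (\<Union>l\<le>k. case_nat k ` ferrers m l (j - k))"
proof (intro set_eqI iffI)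
  fix \<alpha> assume "\<alpha> \<in> ferrers (Suc m) k j"
  then have a: "\<alpha> 0 = k" "\<And>i. \<alpha> (Suc i) \<le> \<alpha> i" "\<And>i. i \<ge> Suc m \<Longrightarrow> \<alpha> i = 0" "(\<Sum>i<Suc m. \<alpha> i) = j"
    by (auto simp: ferrers_def)
  define \<beta> where "\<beta> i = \<alpha> (Suc i)" for i
  have "\<beta> \<in> ferrers m (\<beta> 0) (j - k)"
  proof -
    have "(\<Sum>i<m. \<beta> i) = j - k"
      using a(4) unfolding sum.lessThan_Suc_shift a(1) \<beta>_def by simp
    moreover have "\<forall>i. \<beta> (Suc i) \<le> \<beta> i" "\<forall>i\<ge>m. \<beta> i = 0"
      unfolding \<beta>_def by (blast intro: a(2)) (simp add: a(3))
    ultimately show ?thesis unfolding ferrers_def by blast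
  qed
  moreover have "\<beta> 0 \<le> k" using a(1) a(2)[of 0] by (simp add: \<beta>_def)
  moreover have "\<alpha> = case_nat k \<beta>" using a(1) by (auto simp: fun_eq_iff \<beta>_def split: nat.split)
  ultimately show "\<alpha> \<in> (\<Union>l\<le>k. case_nat k ` ferrers m l (j - k))" by auto
next
  fix \<alpha> assume "\<alpha> \<in> (\<Union>l\<le>k. case_nat k ` ferrers m l (j - k))"
  then obtain l \<beta> where b: "l \<le> k" "\<beta> \<in> ferrers m l (j - k)" "\<alpha> = case_nat k \<beta>" by auto
  then have c: "\<beta> 0 = l" "\<And>i. \<beta> (Suc i) \<le> \<beta> i" "\<And>i. i \<ge> m \<Longrightarrow> \<beta> i = 0" "(\<Sum>i<m. \<beta> i) = j - k"
    unfolding ferrers_def by blast+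
  have "\<alpha> (Suc i) \<le> \<alpha> i" for i using b c(1) c(2)[of "i - 1"] by (cases i) auto
  moreover have "\<alpha> i = 0" if "i \<ge> Suc m" for i using that c(3)[of "i - 1"] b(3) by (cases i) auto
  moreover have "(\<Sum>i<Suc m. \<alpha> i) = j" unfolding sum.lessThan_Suc_shift using b(3) c(4) assms by simp
  ultimately show "\<alpha> \<in> ferrers (Suc m) k j" unfolding ferrers_def using b(3) by simp
qed

lemma case_nat_inj: "case_nat a \<beta> = case_nat a \<gamma> \<longleftrightarrow> \<beta> = \<gamma>"
proof
  assume h: "case_nat a \<beta> = case_nat a \<gamma>"
  show "\<beta> = \<gamma>" using fun_cong[OF h, of "Suc _"] by (simp add: fun_eq_iff)
qed simp

lemma finite_ferrers: "finite (ferrers m k j)"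
proof (induction m arbitrary: k j)
  case 0
  have "ferrers 0 k j \<subseteq> {\<lambda>_. 0}" by (auto simp: ferrers_def)
  then show ?case using finite_subset by blast
next
  case (Suc m)
  show ?case
  proof (cases "k \<le> j")
    case True then show ?thesis using Suc by (simp add: ferrers_Suc)
  next
    case False
    then have "ferrers (Suc m) k j = {}" by (simp add: ferrers_empty)
    then show ?thesis by simp
  qed
qed

text \<open>Peeling off the first row of the Ferrers diagram corresponds to splitting
  \<open>X W = X (w\<^sub>0 + X W')\<close> and expanding the power by the binomial theorem.\<close>
lemma fps_power_ferrers:
  fixes w :: "nat \<Rightarrow> real"
  assumes "j \<le> m"
  shows "(\<Sum>\<alpha>\<in>ferrers m k j. \<Prod>i<m. w i ^ (\<alpha> i - \<alpha> (Suc i)) / fact (\<alpha> i - \<alpha> (Suc i)))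
           = fps_nth ((fps_X * Abs_fps w) ^ k) j / fact k"
  using assms
proof (induction m arbitrary: w k j)
  case 0
  have e: "ferrers 0 k 0 = (if k = 0 then {\<lambda>_. 0} else {})" by (auto simp: ferrers_def)
  show ?case using 0 by (auto simp: e fps_power_zeroth power_0_left)
next
  case (Suc m)
  let ?P = "\<lambda>m w \<alpha>. \<Prod>i<m. w i ^ (\<alpha> i - \<alpha> (Suc i)) / fact (\<alpha> i - \<alpha> (Suc i)) :: real"
  consider "k = 0" | "k > j" | "0 < k" "k \<le> j" by linarith
  then show ?case
  proof cases
    case 1 then show ?thesis by (simp add: ferrers_zero)
  next
    case 2
    then have "ferrers (Suc m) k j = {}" by (simp add: ferrers_empty)
    with 2 show ?thesis by (simp add: power_mult_distrib fps_X_power_mult_nth)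
  next
    case 3
    define w' where "w' i = w (Suc i)" for i
    \<comment> \<open>That \<open>m\<close> rows are enough survives the peeling because
      \<open>k > 0\<close>.\<close>
    have jk: "j - k \<le> m" using 3 Suc.prems by linarith
    have split: "Abs_fps w = fps_X * Abs_fps w' + fps_const (w 0)"
      by (rule fps_ext) (auto simp: w'_def split: nat.split)
    \<comment> \<open>The factor of index 0 has exponent \<open>k - l\<close>, the drop from the
      first row to the second; the other factors belong to \<open>\<beta>\<close> with shifted
      weights.\<close>
    have P_Suc: "?P (Suc m) w (case_nat k \<beta>) = w 0 ^ (k - l) / fact (k - l) * ?P m w' \<beta>"
      if "\<beta> \<in> ferrers m l (j - k)" for \<beta> l
      using that by (simp add: prod.lessThan_Suc_shift w'_def ferrers_def del: prod.lessThan_Suc)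
    have "(\<Sum>\<alpha>\<in>ferrers (Suc m) k j. ?P (Suc m) w \<alpha>)
        = (\<Sum>l\<le>k. \<Sum>\<alpha>\<in>case_nat k ` ferrers m l (j - k). ?P (Suc m) w \<alpha>)"
      unfolding ferrers_Suc[OF 3(2)]
      by (rule sum.UNION_disjoint) (auto simp: finite_ferrers case_nat_inj, auto simp: ferrers_def)
    also have "\<dots> = (\<Sum>l\<le>k. \<Sum>\<beta>\<in>ferrers m l (j - k). ?P (Suc m) w (case_nat k \<beta>))"
      by (intro sum.cong refl sum.reindex_cong[OF _ refl]) (auto simp: inj_on_def case_nat_inj)
    also have "\<dots> = (\<Sum>l\<le>k. \<Sum>\<beta>\<in>ferrers m l (j - k). w 0 ^ (k - l) / fact (k - l) * ?P m w' \<beta>)"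
      using P_Suc by (intro sum.cong refl)
    also have "\<dots> = (\<Sum>l\<le>k. w 0 ^ (k - l) / fact (k - l) * (fps_nth ((fps_X * Abs_fps w') ^ l) (j - k) / fact l))"
      by (simp only: Suc.IH[OF jk] sum_distrib_left[symmetric])
    also have "\<dots> = (\<Sum>l\<le>k. real (k choose l) * w 0 ^ (k - l) * fps_nth ((fps_X * Abs_fps w') ^ l) (j - k)) / fact k"
      unfolding sum_divide_distrib by (intro sum.cong refl) (simp add: binomial_fact field_simps)
    also have "(\<Sum>l\<le>k. real (k choose l) * w 0 ^ (k - l) * fps_nth ((fps_X * Abs_fps w') ^ l) (j - k))
        = fps_nth ((fps_X * Abs_fps w' + fps_const (w 0)) ^ k) (j - k)"
      by (simp add: binomial_ring fps_sum_nth fps_const_power fps_of_nat[symmetric] mult_ac del: fps_of_nat)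
    also have "\<dots> = fps_nth ((fps_X * Abs_fps w) ^ k) j"
      using 3 by (simp add: split[symmetric] power_mult_distrib fps_X_power_mult_nth)
    finally show ?thesis .
  qed
qed

text \<open>The increment of the formal argument: \<open>w 0\<close> is the expansion point and is
  taken out, which also provides the zero constant term that composition requires.\<close>

definition tail_fps :: "(nat \<Rightarrow> real) \<Rightarrow> real fps" where
  "tail_fps w = Abs_fps (\<lambda>i. if i = 0 then 0 else w i)"

lemma tail_fps_nth: "fps_nth (tail_fps w) i = (if i = 0 then 0 else w i)"
  by (simp add: tail_fps_def)

text \<open>A shift by one position turns the index tuples into partitions of \<open>j\<close>. They
  are sorted by the largest part, since this is the derivative order \<open>\<alpha> 1\<close> in
  the Adomian polynomial.\<close>

lemma adom_idx_ferrers: "adom_idx j = (\<Union>k\<le>j. case_nat 0 ` ferrers j k j)"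
proof (intro set_eqI iffI)
  fix \<alpha> assume "\<alpha> \<in> adom_idx j"
  then have a: "\<alpha> 0 = 0" "\<And>i. i > j \<Longrightarrow> \<alpha> i = 0" "\<And>i. i \<in> {1..<j} \<Longrightarrow> \<alpha> (Suc i) \<le> \<alpha> i"
      "(\<Sum>i\<in>{1..j}. \<alpha> i) = j"
    by (auto simp: adom_idx_def)
  define \<beta> where "\<beta> i = \<alpha> (Suc i)" for i
  have "(\<Sum>i\<in>{1..j}. \<alpha> i) = (\<Sum>i<j. \<beta> i)"
    by (rule sum.reindex_cong[of Suc]) (auto simp: \<beta>_def image_Suc_lessThan)
  with a(4) have s: "(\<Sum>i<j. \<beta> i) = j" by simp
  have "\<alpha> (Suc (Suc i)) \<le> \<alpha> (Suc i)" for i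
    using a(2)[of "Suc (Suc i)"] a(3)[of "Suc i"] by (cases "Suc (Suc i) \<le> j") auto
  then have "\<beta> \<in> ferrers j (\<beta> 0) j" unfolding ferrers_def using a(2) s by (simp add: \<beta>_def)
  moreover have "\<beta> 0 \<le> j"
  proof (cases "j = 0")
    case True then show ?thesis using a(2)[of 1] by (simp add: \<beta>_def)
  next
    case False
    then have "\<beta> 0 \<le> (\<Sum>i<j. \<beta> i)" by (intro member_le_sum) auto
    with s show ?thesis by simp
  qed
  moreover have "\<alpha> = case_nat 0 \<beta>" using a(1) by (auto simp: fun_eq_iff \<beta>_def split: nat.split)
  ultimately show "\<alpha> \<in> (\<Union>k\<le>j. case_nat 0 ` ferrers j k j)" by auto
next
  fix \<alpha> assume "\<alpha> \<in> (\<Union>k\<le>j. case_nat 0 ` ferrers j k j)"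
  then obtain k \<beta> where b: "\<beta> \<in> ferrers j k j" "\<alpha> = case_nat 0 \<beta>" by auto
  then have c: "\<And>i. \<beta> (Suc i) \<le> \<beta> i" "\<And>i. i \<ge> j \<Longrightarrow> \<beta> i = 0" "(\<Sum>i<j. \<beta> i) = j"
    unfolding ferrers_def by blast+
  have "(\<Sum>i\<in>{1..j}. \<alpha> i) = (\<Sum>i<j. \<beta> i)"
    by (rule sum.reindex_cong[of Suc]) (auto simp: b(2) image_Suc_lessThan)
  moreover have "\<alpha> i = 0" if "i = 0 \<or> j < i" for i using that c(2)[of "i - 1"] b(2) by (cases i) auto
  moreover have "\<alpha> (Suc i) \<le> \<alpha> i" if "i \<in> {1..<j}" for i using that c(1)[of "i - 1"] b(2) by (cases i) auto
  ultimately show "\<alpha> \<in> adom_idx j" unfolding adom_idx_def using c(3) by simp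
qed

text \<open>The Adomian polynomials are the coefficients of the formal Taylor expansion of
  \<open>G (w\<^sub>0 + w\<^sub>1 z + w\<^sub>2 z\<^sup>2 + \<dots>)\<close>.\<close>
theorem adomian_eq:
  "adomian G j w = (\<Sum>k\<le>j. (deriv ^^ k) G (w 0) / fact k * fps_nth (tail_fps w ^ k) j)"
proof -
  define w' where "w' i = w (Suc i)" for i
  let ?Q = "\<lambda>\<alpha>. (deriv ^^ \<alpha> 1) G (w 0) * (\<Prod>i\<in>{1..j}. w i ^ (\<alpha> i - \<alpha> (Suc i)) / fact (\<alpha> i - \<alpha> (Suc i)))"
  have t: "tail_fps w = fps_X * Abs_fps w'"
    by (rule fps_ext) (auto simp: tail_fps_def w'_def)
  have Q: "?Q (case_nat 0 \<beta>) = (deriv ^^ k) G (w 0) *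
             (\<Prod>i<j. w' i ^ (\<beta> i - \<beta> (Suc i)) / fact (\<beta> i - \<beta> (Suc i)))"
    if "\<beta> \<in> ferrers j k j" for \<beta> k
  proof -
    have "(\<Prod>i\<in>{1..j}. w i ^ (case_nat 0 \<beta> i - case_nat 0 \<beta> (Suc i)) / fact (case_nat 0 \<beta> i - case_nat 0 \<beta> (Suc i)))
        = (\<Prod>i<j. w' i ^ (\<beta> i - \<beta> (Suc i)) / fact (\<beta> i - \<beta> (Suc i)))"
      by (rule prod.reindex_cong[of Suc]) (auto simp: w'_def image_Suc_lessThan)
    then show ?thesis using that by (simp add: ferrers_def)
  qed
  have "adomian G j w = (\<Sum>k\<le>j. \<Sum>\<alpha>\<in>case_nat 0 ` ferrers j k j. ?Q \<alpha>)"
    unfolding adomian_def adom_idx_ferrers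
    by (rule sum.UNION_disjoint) (auto simp: finite_ferrers case_nat_inj, auto simp: ferrers_def)
  also have "\<dots> = (\<Sum>k\<le>j. \<Sum>\<beta>\<in>ferrers j k j. ?Q (case_nat 0 \<beta>))"
    by (intro sum.cong refl sum.reindex_cong[OF _ refl]) (auto simp: inj_on_def case_nat_inj)
  also have "\<dots> = (\<Sum>k\<le>j. \<Sum>\<beta>\<in>ferrers j k j. (deriv ^^ k) G (w 0) *
             (\<Prod>i<j. w' i ^ (\<beta> i - \<beta> (Suc i)) / fact (\<beta> i - \<beta> (Suc i))))"
    using Q by (intro sum.cong refl)
  also have "\<dots> = (\<Sum>k\<le>j. (deriv ^^ k) G (w 0) / fact k * fps_nth (tail_fps w ^ k) j)"
    unfolding sum_distrib_left[symmetric] fps_power_ferrers[OF order_refl] t by simp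
  finally show ?thesis .
qed

section \<open>Lagrange inversion and coefficient asymptotics\<close>

text \<open>The induction works because \<open>[z\<^sup>n] y\<^sup>k = [z\<^sup>n\<^sup>-\<^sup>k] \<psi>(y)\<^sup>k\<close> only involves powers of \<open>y\<close>
  at the smaller index \<open>n - k\<close>.\<close>
lemma lagrange_inversion:
  fixes y \<psi> :: "'a::field_char_0 fps"
  assumes y: "y = fps_X * (\<psi> oo y)" and "0 < n" "k \<le> n"
  shows "of_nat n * fps_nth (y ^ k) n = of_nat k * fps_nth (\<psi> ^ n) (n - k)"
  using assms(2,3)
proof (induction n arbitrary: k rule: less_induct)
  case (less n)
  have y0: "fps_nth y 0 = 0" by (subst y) simp
  have "fps_nth (y ^ k) n = fps_nth (fps_X ^ k * (\<psi> ^ k oo y)) n"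
    by (subst y) (simp add: power_mult_distrib fps_compose_power[OF y0])
  then have yk: "fps_nth (y ^ k) n = fps_nth (\<psi> ^ k oo y) (n - k)"
    using less.prems by (simp add: fps_X_power_mult_nth)
  consider "k = 0" | "k = n" | "0 < k" "k < n" using less.prems by linarith
  then show ?case
  proof cases
    case 1 then show ?thesis using less.prems by simp
  next
    case 2 then show ?thesis using yk by simp
  next
    case 3
    \<comment> \<open>Both \<open>X (\<psi>^k)' \<psi>^(n-k) = k Z\<close> and
      \<open>X (\<psi>^n)' = n Z\<close>, so passing through \<open>Z\<close> exchanges the weights
      \<open>k\<close> and \<open>n\<close>. The induction hypothesis applies at
      \<open>n - k\<close> because \<open>k > 0\<close>, and the factor \<open>n - k\<close> cancels
      at the end because \<open>k < n\<close>.\<close>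
    define Z where "Z = fps_X * fps_deriv \<psi> * \<psi> ^ (n - 1)"
    have "of_nat (n - k) * fps_nth (y ^ k) n
        = (\<Sum>i=0..n - k. fps_nth (\<psi> ^ k) i * (of_nat (n - k) * fps_nth (y ^ i) (n - k)))"
      by (simp add: yk fps_compose_nth sum_distrib_left mult_ac)
    also have "\<dots> = (\<Sum>i=0..n - k. fps_nth (\<psi> ^ k) i * (of_nat i * fps_nth (\<psi> ^ (n - k)) (n - k - i)))"
      using 3 less.IH[of "n - k"] by (intro sum.cong refl) (simp del: of_nat_diff)
    also have "\<dots> = (\<Sum>i=0..n - k. fps_nth (fps_X * fps_deriv (\<psi> ^ k)) i * fps_nth (\<psi> ^ (n - k)) (n - k - i))"
      by (intro sum.cong refl) (auto simp: mult_ac)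
    also have "\<dots> = fps_nth (fps_X * fps_deriv (\<psi> ^ k) * \<psi> ^ (n - k)) (n - k)"
      by (simp add: fps_mult_nth)
    also have "fps_X * fps_deriv (\<psi> ^ k) * \<psi> ^ (n - k)
        = fps_const (of_nat k) * (fps_X * fps_deriv \<psi> * \<psi> ^ (k - 1 + (n - k)))"
      by (simp add: fps_deriv_power power_add mult_ac)
    also have "k - 1 + (n - k) = n - 1" using 3 by simp
    also have "fps_X * fps_deriv \<psi> * \<psi> ^ (n - 1) = Z" by (simp add: Z_def)
    finally have "of_nat n * (of_nat (n - k) * fps_nth (y ^ k) n)
        = of_nat k * fps_nth (fps_const (of_nat n) * Z) (n - k)"
      by simp
    also have "fps_const (of_nat n) * Z = fps_X * fps_deriv (\<psi> ^ n)"
      by (simp add: fps_deriv_power mult_ac Z_def)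
    also have "fps_nth \<dots> (n - k) = of_nat (n - k) * fps_nth (\<psi> ^ n) (n - k)"
      by (cases "n - k") (simp_all del: of_nat_diff of_nat_Suc)
    finally show ?thesis using 3 by (simp add: mult_ac del: of_nat_diff)
  qed
qed

section \<open>Bounds for binomial coefficients and a binomial mean\<close>

text \<open>The factor \<open>2 m + 1\<close> makes the induction close: one step multiplies the
  left side by \<open>4 (2m+1) (2m+3) / (m+1)^2\<close>, which is below 16 because
  \<open>(2m+1) (2m+3) = 4 (m+1)^2 - 1\<close>.\<close>

lemma central_binomial_upper: "real ((2 * m) choose m) ^ 2 * (2 * real m + 1) \<le> 16 ^ m"
proof (induction m)
  case (Suc m)
  define b where "b = real ((2 * m) choose m)"
  have "real ((2 * Suc m) choose Suc m) = b * (2 * (2 * real m + 1)) / (real m + 1)"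
  proof -
    define c where "c = real ((2 * Suc m) choose Suc m)"
    have "b = fact (2 * m) / (fact m * fact m)"
      using binomial_fact[of m "2 * m", where 'a = real] by (simp add: b_def mult_2)
    moreover have "c = fact (2 * Suc m) / (fact (Suc m) * fact (Suc m))"
      using binomial_fact[of "Suc m" "2 * Suc m", where 'a = real] by (simp add: c_def)
    moreover have f2: "fact (2 * Suc m) = 2 * (real m + 1) * ((2 * real m + 1) * fact (2 * m))"
      by (simp add: algebra_simps)
    moreover have f1: "fact (Suc m) = (real m + 1) * fact m" by simp
    moreover have "2 * M * (k * F) / ((M * f) * (M * f)) = F / (f * f) * (2 * k) / M"
      if "M \<noteq> 0" "f \<noteq> 0" for M k F f :: real
      using that by (simp add: field_simps)
    from this[of "real m + 1" "fact m"]
    have "2 * (real m + 1) * ((2 * real m + 1) * fact (2 * m)) / ((real m + 1) * fact m * ((real m + 1) * fact m))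
        = fact (2 * m) / (fact m * fact m) * (2 * (2 * real m + 1)) / (real m + 1)"
      by (simp del: of_nat_Suc)
    ultimately have "c = b * (2 * (2 * real m + 1)) / (real m + 1)"
      by metis
    then show ?thesis by (simp only: c_def)
  qed
  then have "real ((2 * Suc m) choose Suc m) ^ 2 * (2 * real m + 3)
      = b ^ 2 * (2 * real m + 1) * (4 * (2 * real m + 1) * (2 * real m + 3) / (real m + 1) ^ 2)"
    by (simp only: power2_eq_square) (simp add: field_simps)
  also have "\<dots> \<le> 16 ^ m * 16"
  proof (rule mult_mono)
    show "4 * (2 * real m + 1) * (2 * real m + 3) / (real m + 1)\<^sup>2 \<le> 16"
      by (simp add: divide_simps) (simp add: power2_eq_square algebra_simps)
  qed (use Suc in \<open>auto simp: b_def\<close>)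
  finally show ?case by (simp only: of_nat_Suc power_Suc2 distrib_left)
qed simp

text \<open>The middle coefficient is the largest of its row, and in an odd row it is half of the
  next central coefficient, so the even case decides both parities.\<close>

lemma binomial_upper_sqrt: "real (n choose k) \<le> 2 ^ n / sqrt (real n + 1)"
proof -
  have even: "real ((2 * m) choose m) \<le> 2 ^ (2 * m) / sqrt (real (2 * m) + 1)" for m
  proof -
    have "real ((2 * m) choose m) * sqrt (2 * real m + 1)
        = sqrt (real ((2 * m) choose m) ^ 2 * (2 * real m + 1))"
      by (simp add: real_sqrt_mult)
    also have "\<dots> \<le> sqrt (16 ^ m)" using central_binomial_upper by (rule real_sqrt_le_mono)
    also have "\<dots> = 4 ^ m" by (simp add: real_sqrt_power)
    finally show ?thesis by (simp add: pos_le_divide_eq power_mult del: power_mult_numeral)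
  qed
  have "real (n choose k) \<le> real (n choose (n div 2))"
    using binomial_maximum by simp
  also have "\<dots> \<le> 2 ^ n / sqrt (real n + 1)"
  proof (cases "even n")
    case True
    then obtain m where "n = 2 * m" by blast
    with even[of m] show ?thesis by simp
  next
    case False
    then obtain m where n: "n = 2 * m + 1" using oddE by blast
    have "(2 * Suc m) choose Suc m = 2 * ((2 * m + 1) choose m)"
      using binomial_symmetric[of m "Suc (2 * m)"] by simp
    then have "real (n choose (n div 2)) = real ((2 * Suc m) choose Suc m) / 2"
      unfolding n by simp
    also have "\<dots> \<le> 2 ^ (2 * Suc m) / sqrt (real (2 * Suc m) + 1) / 2"
      by (intro divide_right_mono even) simp
    also have "\<dots> = 2 ^ n / sqrt (real (2 * Suc m) + 1)" by (simp add: n)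
    also have "\<dots> \<le> 2 ^ n / sqrt (real n + 1)"
      by (intro divide_left_mono) (auto simp: n)
    finally show ?thesis .
  qed
  finally show ?thesis .
qed

text \<open>The left side is the mean of \<open>1 / (K + 1)\<close> for a binomial variable
  \<open>K\<close>. Absorbing \<open>k + 1\<close> into the binomial coefficient turns it into row
  \<open>n + 1\<close> of the binomial theorem with the term of index 0 missing.\<close>

lemma binomial_mean_inverse:
  fixes x :: real
  assumes "0 < x" "x \<le> 1"
  shows "(\<Sum>k\<le>n. real (n choose k) * x ^ k * (1 - x) ^ (n - k) / (real k + 1)) \<le> 1 / ((real n + 1) * x)"
proof -
  have c: "real (n choose k) / (real k + 1) = real (Suc n choose Suc k) / (real n + 1)" for k
    using Suc_times_binomial_eq[of n k] by (simp add: field_simps flip: of_nat_mult of_nat_Suc)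
  have "(real n + 1) * x * (\<Sum>k\<le>n. real (n choose k) * x ^ k * (1 - x) ^ (n - k) / (real k + 1))
      = (\<Sum>k\<le>n. (real n + 1) * (real (n choose k) / (real k + 1)) * x ^ Suc k * (1 - x) ^ (n - k))"
    by (simp add: sum_distrib_left mult_ac)
  also have "\<dots> = (\<Sum>k\<le>n. real (Suc n choose Suc k) * x ^ Suc k * (1 - x) ^ (Suc n - Suc k))"
    unfolding c by (intro sum.cong refl) simp
  also have "\<dots> \<le> (\<Sum>k\<le>Suc n. real (Suc n choose k) * x ^ k * (1 - x) ^ (Suc n - k))"
    unfolding sum.atMost_Suc_shift[of _ n] using assms by simp
  also have "\<dots> = (x + (1 - x)) ^ Suc n" by (subst binomial_ring) simp
  finally have "(\<Sum>k\<le>n. real (n choose k) * x ^ k * (1 - x) ^ (n - k) / (real k + 1)) * ((real n + 1) * x) \<le> 1"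
    by (simp add: mult_ac)
  then show ?thesis using assms by (subst pos_le_divide_eq) auto
qed

section \<open>Evaluating formal power series at 1\<close>

lemma fps_mult_abs_summable:
  fixes f g :: "real fps"
  assumes f: "summable (\<lambda>i. \<bar>fps_nth f i\<bar>)" and g: "summable (\<lambda>i. \<bar>fps_nth g i\<bar>)"
  shows "summable (\<lambda>i. \<bar>fps_nth (f * g) i\<bar>)"
    and "(\<Sum>i. \<bar>fps_nth (f * g) i\<bar>) \<le> (\<Sum>i. \<bar>fps_nth f i\<bar>) * (\<Sum>i. \<bar>fps_nth g i\<bar>)"
    and "(\<Sum>i. fps_nth (f * g) i) = (\<Sum>i. fps_nth f i) * (\<Sum>i. fps_nth g i)"
proof -
  have s: "(\<lambda>k. \<Sum>i\<le>k. \<bar>fps_nth f i\<bar> * \<bar>fps_nth g (k - i)\<bar>) sums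
      ((\<Sum>i. \<bar>fps_nth f i\<bar>) * (\<Sum>i. \<bar>fps_nth g i\<bar>))"
    using Cauchy_product_sums[of "\<lambda>i. \<bar>fps_nth f i\<bar>" "\<lambda>i. \<bar>fps_nth g i\<bar>"] f g by simp
  have le: "\<bar>fps_nth (f * g) k\<bar> \<le> (\<Sum>i\<le>k. \<bar>fps_nth f i\<bar> * \<bar>fps_nth g (k - i)\<bar>)" for k
    unfolding fps_mult_nth atLeast0AtMost by (rule order.trans[OF sum_abs]) (simp add: abs_mult)
  show *: "summable (\<lambda>i. \<bar>fps_nth (f * g) i\<bar>)"
    by (rule summable_comparison_test[OF _ sums_summable[OF s]]) (use le in auto)
  show "(\<Sum>i. \<bar>fps_nth (f * g) i\<bar>) \<le> (\<Sum>i. \<bar>fps_nth f i\<bar>) * (\<Sum>i. \<bar>fps_nth g i\<bar>)"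
    using suminf_le[OF le * sums_summable[OF s]] sums_unique[OF s] by simp
  show "(\<Sum>i. fps_nth (f * g) i) = (\<Sum>i. fps_nth f i) * (\<Sum>i. fps_nth g i)"
    using Cauchy_product[of "fps_nth f" "fps_nth g"] f g
    by (simp add: fps_mult_nth atLeast0AtMost)
qed

lemma fps_one_sums: "(\<lambda>i. \<bar>fps_nth (1 :: real fps) i\<bar>) sums 1" "fps_nth (1 :: real fps) sums 1"
proof -
  have e: "fps_nth (1 :: real fps) = (\<lambda>i. if i = 0 then 1 else 0)" by auto
  show "fps_nth (1 :: real fps) sums 1" unfolding e using sums_single[of 0 "\<lambda>_. 1::real"] by simp
  then show "(\<lambda>i. \<bar>fps_nth (1 :: real fps) i\<bar>) sums 1"
    by (rule sums_cong[THEN iffD1, rotated]) simp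
qed

lemma fps_power_abs_summable:
  fixes f :: "real fps"
  assumes f: "summable (\<lambda>i. \<bar>fps_nth f i\<bar>)"
  shows "summable (\<lambda>i. \<bar>fps_nth (f ^ k) i\<bar>)
    \<and> (\<Sum>i. \<bar>fps_nth (f ^ k) i\<bar>) \<le> (\<Sum>i. \<bar>fps_nth f i\<bar>) ^ k
    \<and> (\<Sum>i. fps_nth (f ^ k) i) = (\<Sum>i. fps_nth f i) ^ k"
proof (induction k)
  case 0
  show ?case using fps_one_sums[THEN sums_unique] fps_one_sums[THEN sums_summable] by simp
next
  case (Suc k)
  note IH = conjunct1[OF Suc] conjunct1[OF conjunct2[OF Suc]] conjunct2[OF conjunct2[OF Suc]]
  note m = fps_mult_abs_summable[OF f IH(1)]
  have "(\<Sum>i. \<bar>fps_nth f i\<bar>) * (\<Sum>i. \<bar>fps_nth (f ^ k) i\<bar>) \<le> (\<Sum>i. \<bar>fps_nth f i\<bar>) * (\<Sum>i. \<bar>fps_nth f i\<bar>) ^ k"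
    by (intro mult_left_mono IH(2) suminf_nonneg f) auto
  with m(2) have "(\<Sum>i. \<bar>fps_nth (f ^ Suc k) i\<bar>) \<le> (\<Sum>i. \<bar>fps_nth f i\<bar>) ^ Suc k" by simp
  with m(1,3) IH(3) show ?case by simp
qed

text \<open>The double family of terms \<open>c_k [X^j] y^k\<close> is absolutely summable by the
  assumption on \<open>c\<close>, so the two orders of summation agree. Since \<open>y\<close> has
  no constant term, only \<open>k \<le> j\<close> contributes for fixed \<open>j\<close>, and these
  finite sums are the coefficients of the composition.\<close>

lemma fps_compose_sums:
  fixes c y :: "real fps"
  assumes y: "summable (\<lambda>i. \<bar>fps_nth y i\<bar>)" and y0: "fps_nth y 0 = 0"
    and c: "summable (\<lambda>k. \<bar>fps_nth c k\<bar> * (\<Sum>i. \<bar>fps_nth y i\<bar>) ^ k)"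
  shows "summable (\<lambda>j. \<bar>fps_nth (c oo y) j\<bar>)"
    and "(\<Sum>j. fps_nth (c oo y) j) = (\<Sum>k. fps_nth c k * (\<Sum>i. fps_nth y i) ^ k)"
proof -
  define f where "f k j = fps_nth c k * fps_nth (y ^ k) j" for k j
  note p = fps_power_abs_summable[OF y]
  have col: "(f k has_sum fps_nth c k * (\<Sum>i. fps_nth y i) ^ k) UNIV" for k
  proof -
    have "summable (\<lambda>j. norm (f k j))"
      using p[of k] by (simp add: f_def abs_mult)
    moreover have "f k sums (fps_nth c k * (\<Sum>i. fps_nth y i) ^ k)"
      unfolding f_def using p[of k] summable_rabs_cancel
      by (metis sums_mult summable_sums)
    ultimately show ?thesis by (rule norm_summable_imp_has_sum)
  qed
  have coln: "((\<lambda>j. norm (f k j)) has_sum \<bar>fps_nth c k\<bar> * (\<Sum>i. \<bar>fps_nth (y ^ k) i\<bar>)) UNIV" for k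
  proof -
    have "(\<lambda>j. norm (f k j)) sums (\<bar>fps_nth c k\<bar> * (\<Sum>i. \<bar>fps_nth (y ^ k) i\<bar>))"
      unfolding f_def using p[of k] by (simp add: abs_mult sums_mult summable_sums)
    then show ?thesis
      by (intro norm_summable_imp_has_sum) (auto dest: sums_summable)
  qed
  have rows: "summable (\<lambda>k. \<bar>fps_nth c k\<bar> * (\<Sum>i. \<bar>fps_nth (y ^ k) i\<bar>))"
    by (rule summable_comparison_test[OF _ c])
       (use p in \<open>auto intro!: exI[of _ 0] mult_left_mono simp: abs_mult suminf_nonneg\<close>)
  define g where "g = (\<lambda>(k, j). f k j)"
  have "(\<lambda>p. norm (g p)) summable_on UNIV \<times> UNIV"
  proof (subst Infinite_Sum.abs_summable_on_Sigma_iff, intro conjI ballI)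
    fix k show "(\<lambda>j. norm (g (k, j))) summable_on UNIV"
      using coln[of k] by (auto simp: summable_on_def g_def)
    have e: "(\<Sum>\<^sub>\<infinity>j\<in>UNIV. norm (g (k, j))) = \<bar>fps_nth c k\<bar> * (\<Sum>i. \<bar>fps_nth (y ^ k) i\<bar>)" for k
      unfolding g_def using infsumI[OF coln[of k]] by simp
    have "summable (\<lambda>k. norm (\<bar>fps_nth c k\<bar> * (\<Sum>i. \<bar>fps_nth (y ^ k) i\<bar>)))"
      using rows p by (simp add: abs_mult suminf_nonneg)
    then show "(\<lambda>k. norm (\<Sum>\<^sub>\<infinity>j\<in>UNIV. norm (g (k, j)))) summable_on UNIV"
      unfolding e by (intro norm_summable_imp_summable_on) simp
  qed
  then have S: "(\<lambda>(k, j). f k j) summable_on UNIV \<times> UNIV"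
    unfolding g_def by (rule Infinite_Sum.abs_summable_summable)
  then have S': "(\<lambda>(j, k). f k j) summable_on UNIV \<times> UNIV"
    by (subst (asm) summable_on_swap) (simp add: case_prod_unfold)
  have row: "(\<Sum>\<^sub>\<infinity>k\<in>UNIV. f k j) = fps_nth (c oo y) j" for j
  proof -
    have "(\<Sum>\<^sub>\<infinity>k\<in>UNIV. f k j) = (\<Sum>\<^sub>\<infinity>k\<in>{0..j}. f k j)"
      using startsby_zero_power_prefix[OF y0] by (intro infsum_cong_neutral) (auto simp: f_def)
    then show ?thesis by (simp add: fps_compose_nth f_def)
  qed
  have "(\<lambda>j. fps_nth (c oo y) j) summable_on UNIV"
    using summable_on_Sigma_banach[OF S'] by (simp add: row)
  moreover have "(\<Sum>\<^sub>\<infinity>j\<in>UNIV. fps_nth (c oo y) j) = (\<Sum>\<^sub>\<infinity>k\<in>UNIV. fps_nth c k * (\<Sum>i. fps_nth y i) ^ k)"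
    using infsum_swap_banach[OF S] by (simp add: row infsumI[OF col])
  ultimately have hs: "((\<lambda>j. fps_nth (c oo y) j) has_sum (\<Sum>\<^sub>\<infinity>k\<in>UNIV. fps_nth c k * (\<Sum>i. fps_nth y i) ^ k)) UNIV"
    by (metis has_sum_infsum)
  have "(\<lambda>k. fps_nth c k * (\<Sum>i. fps_nth y i) ^ k) summable_on UNIV"
    using summable_on_Sigma_banach[OF S] by (simp add: infsumI[OF col])
  then have "(\<Sum>\<^sub>\<infinity>k\<in>UNIV. fps_nth c k * (\<Sum>i. fps_nth y i) ^ k) = (\<Sum>k. fps_nth c k * (\<Sum>i. fps_nth y i) ^ k)"
    by (metis has_sum_infsum has_sum_imp_sums sums_unique)
  with hs show "(\<Sum>j. fps_nth (c oo y) j) = (\<Sum>k. fps_nth c k * (\<Sum>i. fps_nth y i) ^ k)"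
    by (metis has_sum_imp_sums sums_unique)
  have "(\<lambda>j. norm (fps_nth (c oo y) j)) summable_on UNIV"
    using \<open>(\<lambda>j. fps_nth (c oo y) j) summable_on UNIV\<close> by (subst (asm) summable_on_iff_abs_summable_on_real)
  then show "summable (\<lambda>j. \<bar>fps_nth (c oo y) j\<bar>)"
    by (simp add: summable_on_UNIV_nonneg_real_iff)
qed


lemma fps_nth_nonneg_mult:
  fixes f g :: "real fps"
  assumes "\<And>i. 0 \<le> fps_nth f i" "\<And>i. 0 \<le> fps_nth g i"
  shows "0 \<le> fps_nth (f * g) i"
  using assms by (simp add: fps_mult_nth sum_nonneg)

lemma fps_nth_nonneg_power:
  fixes f :: "real fps"
  assumes "\<And>i. 0 \<le> fps_nth f i"
  shows "0 \<le> fps_nth (f ^ k) i"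
  using assms by (induction k arbitrary: i) (auto simp: fps_nth_nonneg_mult)

text \<open>A local limit bound for sums of \<open>n\<close> independent variables with generating function \<open>P\<close>:
  splitting off the part \<open>\<beta> (1 + X)\<close> leaves a mixture of symmetric binomial distributions.\<close>
lemma power_coeff_bound:
  fixes P :: "real fps"
  assumes nn: "\<And>i. 0 \<le> fps_nth P i" and P1: "fps_nth P sums 1"
    and p0: "0 < fps_nth P 0" and p1: "0 < fps_nth P 1"
  shows "\<exists>C\<ge>0. \<forall>n\<ge>1. \<forall>m. fps_nth (P ^ n) m \<le> C / sqrt (real n)"
proof -
  \<comment> \<open>The largest multiple of \<open>1 + X\<close> that can be subtracted from
    \<open>P\<close> with all coefficients staying nonnegative.\<close>
  define \<beta> where "\<beta> = min (fps_nth P 0) (fps_nth P 1)"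
  have \<beta>: "0 < \<beta>" "\<beta> \<le> fps_nth P 0" "\<beta> \<le> fps_nth P 1" using p0 p1 by (auto simp: \<beta>_def)
  have two: "2 * \<beta> \<le> 1"
  proof -
    have "(\<Sum>i<2. fps_nth P i) \<le> 1"
      using sum_le_suminf[OF sums_summable[OF P1], of "{..<2}"] nn sums_unique[OF P1] by simp
    with \<beta> show ?thesis by (simp add: numeral_2_eq_2)
  qed
  define B :: "real fps" where "B = fps_const \<beta> * (1 + fps_X)"
  define Q where "Q = P - B"
  have Bn: "fps_nth B i = (if i \<le> 1 then \<beta> else 0)" for i
    by (auto simp: B_def algebra_simps)
  have Qnn: "0 \<le> fps_nth Q i" for i
    using nn[of i] \<beta> by (cases "i = 0"; cases "i = 1") (auto simp: Q_def Bn)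
  have Bs: "fps_nth B sums (2 * \<beta>)"
    using sums_finite[of "{..<2}" "fps_nth B"] by (simp add: Bn numeral_2_eq_2)
  have Qs: "fps_nth Q sums (1 - 2 * \<beta>)"
  proof -
    have "(\<lambda>i. fps_nth P i - fps_nth B i) sums (1 - 2 * \<beta>)" using P1 Bs by (rule sums_diff)
    moreover have "fps_nth Q = (\<lambda>i. fps_nth P i - fps_nth B i)" by (simp add: Q_def fun_eq_iff)
    ultimately show ?thesis by simp
  qed
  have Qa: "summable (\<lambda>i. \<bar>fps_nth Q i\<bar>)" using Qs Qnn by (simp add: sums_iff)
  have Qp: "(\<Sum>i\<le>m. fps_nth (Q ^ l) i) \<le> (1 - 2 * \<beta>) ^ l" for l m
  proof -
    note q = fps_power_abs_summable[OF Qa, of l]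
    have "(\<Sum>i\<le>m. fps_nth (Q ^ l) i) \<le> (\<Sum>i. fps_nth (Q ^ l) i)"
      using q fps_nth_nonneg_power[OF Qnn] by (intro sum_le_suminf) (auto intro: summable_rabs_cancel)
    then show ?thesis using q sums_unique[OF Qs] by simp
  qed
  have Bpow: "fps_nth (B ^ k) i = \<beta> ^ k * real (k choose i)" for k i
    by (simp add: B_def power_mult_distrib fps_const_power flip: fps_binomial_of_nat)
       (simp add: binomial_gbinomial)
  \<comment> \<open>Convolution with \<open>Q^l\<close> cannot raise the largest coefficient of
    \<open>B^k\<close> by more than the total mass of \<open>Q^l\<close>.\<close>
  have coeff: "fps_nth (B ^ k * Q ^ l) m \<le> (2 * \<beta>) ^ k / sqrt (real k + 1) * (1 - 2 * \<beta>) ^ l" for k l m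
  proof -
    have "fps_nth (B ^ k * Q ^ l) m = (\<Sum>i\<le>m. \<beta> ^ k * real (k choose i) * fps_nth (Q ^ l) (m - i))"
      by (simp add: fps_mult_nth atLeast0AtMost Bpow)
    also have "\<dots> \<le> (\<Sum>i\<le>m. \<beta> ^ k * (2 ^ k / sqrt (real k + 1)) * fps_nth (Q ^ l) (m - i))"
      using \<beta> Qnn by (intro sum_mono mult_right_mono mult_left_mono binomial_upper_sqrt fps_nth_nonneg_power) auto
    also have "\<dots> = (2 * \<beta>) ^ k / sqrt (real k + 1) * (\<Sum>i\<le>m. fps_nth (Q ^ l) (m - i))"
      unfolding sum_distrib_left by (intro sum.cong refl) (simp add: power_mult_distrib)
    also have "(\<Sum>i\<le>m. fps_nth (Q ^ l) (m - i)) = (\<Sum>i\<le>m. fps_nth (Q ^ l) i)"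
      by (rule sum.reindex_bij_witness[of _ "\<lambda>i. m - i" "\<lambda>i. m - i"]) auto
    also have "(2 * \<beta>) ^ k / sqrt (real k + 1) * \<dots> \<le> (2 * \<beta>) ^ k / sqrt (real k + 1) * (1 - 2 * \<beta>) ^ l"
      using \<beta> by (intro mult_left_mono Qp) auto
    finally show ?thesis .
  qed
  have "fps_nth (P ^ n) m \<le> ((1 / (2 * \<beta>) + 1) / 2) / sqrt (real n)" if n: "n \<ge> 1" for n m
  proof -
    let ?w = "\<lambda>k. real (n choose k) * (2 * \<beta>) ^ k * (1 - 2 * \<beta>) ^ (n - k)"
    \<comment> \<open>The number of factors taken from \<open>B\<close> is binomial with success
      probability \<open>2 \<beta>\<close>, hence typically of order \<open>n\<close>. This
      inequality reduces the mean of \<open>1 / sqrt (k + 1)\<close> to that of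
      \<open>1 / (k + 1)\<close>, balanced at the scale \<open>sqrt n\<close>.\<close>
    have amgm: "1 / sqrt (real k + 1) \<le> (sqrt (real n) / (real k + 1) + 1 / sqrt (real n)) / 2" for k
    proof -
      have "0 \<le> (sqrt (sqrt n) / sqrt (real k + 1) - 1 / sqrt (sqrt n))\<^sup>2" by simp
      also have "\<dots> = sqrt (real n) / (real k + 1) + 1 / sqrt (real n) - 2 * (1 / sqrt (real k + 1))"
        using n by (simp add: power2_diff power_divide)
      finally show ?thesis by simp
    qed
    have "P = B + Q" by (simp add: Q_def)
    then have "fps_nth (P ^ n) m = (\<Sum>k\<le>n. real (n choose k) * fps_nth (B ^ k * Q ^ (n - k)) m)"
      by (simp add: binomial_ring fps_sum_nth mult.assoc flip: fps_of_nat)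
    also have "\<dots> \<le> (\<Sum>k\<le>n. real (n choose k) * ((2 * \<beta>) ^ k / sqrt (real k + 1) * (1 - 2 * \<beta>) ^ (n - k)))"
      by (intro sum_mono mult_left_mono coeff) auto
    also have "\<dots> = (\<Sum>k\<le>n. ?w k * (1 / sqrt (real k + 1)))"
      by (intro sum.cong refl) simp
    also have "\<dots> \<le> (\<Sum>k\<le>n. ?w k * ((sqrt (real n) / (real k + 1) + 1 / sqrt (real n)) / 2))"
      using \<beta> two by (intro sum_mono mult_left_mono amgm) auto
    also have "\<dots> = sqrt (real n) / 2 * (\<Sum>k\<le>n. ?w k / (real k + 1)) + 1 / (2 * sqrt (real n)) * (\<Sum>k\<le>n. ?w k)"
      unfolding sum_distrib_left sum.distrib[symmetric]
      by (intro sum.cong refl) (simp add: distrib_left add_divide_distrib mult_ac)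
    also have "(\<Sum>k\<le>n. ?w k) = (2 * \<beta> + (1 - 2 * \<beta>)) ^ n" by (subst binomial_ring) simp
    also have "sqrt (real n) / 2 * (\<Sum>k\<le>n. ?w k / (real k + 1)) \<le> sqrt (real n) / 2 * (1 / ((real n + 1) * (2 * \<beta>)))"
      using \<beta> two by (intro mult_left_mono binomial_mean_inverse) auto
    also have "\<dots> \<le> sqrt (real n) / 2 * (1 / (real n * (2 * \<beta>)))"
      using \<beta> n by (intro mult_left_mono divide_left_mono mult_right_mono mult_pos_pos) auto
    also have "\<dots> = 1 / (2 * sqrt (real n)) * (1 / (2 * \<beta>))"
    proof -
      have "sqrt (real n) / 2 * (1 / (real n * (2 * \<beta>))) = sqrt (real n) / real n * (1 / (2 * (2 * \<beta>)))"
        by simp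
      then show ?thesis by (simp add: sqrt_divide_self_eq inverse_eq_divide)
    qed
    finally show ?thesis by (simp add: add_divide_distrib mult_ac)
  qed
  moreover have "0 \<le> (1 / (2 * \<beta>) + 1) / 2" using \<beta> by simp
  ultimately show ?thesis by blast
qed

text \<open>Any \<open>y\<close> solving \<open>y = y\<^sup>2 + X H(y)\<close> solves \<open>y = X \<psi>(y)\<close> with \<open>\<psi> = H / (1 - X)\<close>, so Lagrange
  inversion and the local limit bound give the square-root type decay \<open>n\<^sup>-\<^sup>3\<^sup>/\<^sup>2\<close> at the point
  where \<open>t (1 - t) / H(t)\<close> is maximal; this maximum is at least the radius of convergence.\<close>
theorem quadratic_majorant_growth:
  fixes y H :: "real fps"
  assumes eq: "y = y * y + fps_X * (H oo y)" and y0: "fps_nth y 0 = 0"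
    and Hnn: "\<And>i. 0 \<le> fps_nth H i" and H0: "0 < fps_nth H 0"
    and Hsum: "\<And>t. 0 \<le> t \<Longrightarrow> summable (\<lambda>i. fps_nth H i * t ^ i)"
    and R: "0 < conv_radius (fps_nth y)"
  shows "\<exists>C\<ge>0. \<forall>n\<ge>1. fps_nth y n
           \<le> C * real_of_ereal (inverse (conv_radius (fps_nth y))) ^ n / (real n * sqrt (real n))"
proof -
  define geo :: "real fps" where "geo = Abs_fps (\<lambda>_. 1)"
  define \<psi> where "\<psi> = H * geo"
  have geo: "geo * (1 - fps_X) = 1"
    by (rule fps_ext) (simp add: geo_def algebra_simps)
  have \<psi>: "\<psi> * (1 - fps_X) = H" by (simp add: \<psi>_def mult.assoc geo)
  have "(\<psi> oo y) * (1 - y) = H oo y"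
    unfolding \<psi>[symmetric] by (simp add: fps_compose_mult_distrib[OF y0] fps_compose_sub_distrib y0)
  then have "fps_X * (\<psi> oo y) * (1 - y) = fps_X * (H oo y)" by (simp add: mult.assoc)
  also have "\<dots> = y * (1 - y)" using eq by (simp add: algebra_simps)
  finally have "fps_X * (\<psi> oo y) * (1 - y) = y * (1 - y)" .
  moreover have "1 - y \<noteq> 0"
  proof
    assume "1 - y = 0"
    then have "fps_nth (1 - y) 0 = 0" by simp
    with y0 show False by simp
  qed
  ultimately have y\<psi>: "y = fps_X * (\<psi> oo y)" by (metis mult_right_cancel)
  have geonn: "0 \<le> fps_nth geo i" for i by (simp add: geo_def)
  have \<psi>nn: "0 \<le> fps_nth \<psi> i" for i
    unfolding \<psi>_def using Hnn geonn by (rule fps_nth_nonneg_mult)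
  have yn: "fps_nth y n = fps_nth (\<psi> ^ n) (n - 1) / real n" if "1 \<le> n" for n
    using lagrange_inversion[OF y\<psi>, of n 1] that by (simp add: field_simps)
  have ynn: "0 \<le> fps_nth y n" for n
    using yn[of n] y0 fps_nth_nonneg_power[OF \<psi>nn, of n "n - 1"] by (cases "n = 0") auto

  define Hs where "Hs t = (\<Sum>i. fps_nth H i * t ^ i)" for t
  \<comment> \<open>The equation \<open>y = y^2 + z H(y)\<close> solved for \<open>z\<close> reads
    \<open>z = \<phi>(y)\<close>.\<close>
  define \<phi> where "\<phi> t = t * (1 - t) / Hs t" for t
  have Hspos: "0 < Hs t" if "0 \<le> t" for t
  proof -
    have "(\<Sum>i<1. fps_nth H i * t ^ i) \<le> Hs t"
      unfolding Hs_def using Hsum Hnn that by (intro sum_le_suminf) auto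
    with H0 show ?thesis by simp
  qed
  have contH: "continuous_on {0..1} Hs"
  proof -
    have "isCont (\<lambda>x. \<Sum>n. fps_nth H n * x ^ n) x" if "x \<in> {0..1}" for x
      using isCont_powser[OF Hsum[of 2], of x] that by simp
    then show ?thesis unfolding Hs_def by (intro continuous_at_imp_continuous_on) auto
  qed
  have "continuous_on {0..1} \<phi>"
    unfolding \<phi>_def using Hspos by (intro continuous_intros contH) force
  then obtain \<tau> where \<tau>: "\<tau> \<in> {0..1}" and max: "\<And>t. t \<in> {0..1} \<Longrightarrow> \<phi> t \<le> \<phi> \<tau>"
    using continuous_attains_sup[of "{0..1::real}" \<phi>] by auto
  have "0 < \<phi> (1/2)" using Hspos[of "1/2"] by (simp add: \<phi>_def)
  with max[of "1/2"] have \<phi>pos: "0 < \<phi> \<tau>" by simp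
  then have "\<tau> \<noteq> 0" "\<tau> \<noteq> 1" by (auto simp: \<phi>_def)
  with \<tau> have \<tau>01: "0 < \<tau>" "\<tau> < 1" by auto

  \<comment> \<open>Inside the disc \<open>S = y(z)\<close> is finite and satisfies
    \<open>S (1 - S) = z H(S) > 0\<close>. Hence \<open>S\<close> lies in the unit interval, and
    \<open>z = \<phi>(S)\<close> is at most the maximum of \<open>\<phi>\<close>.\<close>
  have z_le: "z \<le> \<phi> \<tau>" if z: "0 < z" "ereal z < conv_radius (fps_nth y)" for z
  proof -
    define Z where "Z = fps_const z * fps_X"
    define Y where "Y = y oo Z"
    have Z0: "fps_nth Z 0 = 0" by (simp add: Z_def)
    have Yn: "fps_nth Y n = fps_nth y n * z ^ n" for n
      unfolding Y_def Z_def fps_nth_compose_linear by (rule mult.commute)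
    have Y0: "fps_nth Y 0 = 0" by (simp add: Yn y0)
    have Ya: "summable (\<lambda>i. \<bar>fps_nth Y i\<bar>)"
    proof -
      have "summable (\<lambda>i. fps_nth y i * z ^ i)"
        using z by (intro summable_in_conv_radius) auto
      then show ?thesis using ynn z by (simp add: Yn)
    qed
    define S where "S = (\<Sum>i. fps_nth Y i)"
    have Snn: "0 \<le> S" unfolding S_def
      by (rule suminf_nonneg[OF summable_rabs_cancel[OF Ya]]) (use ynn z in \<open>simp add: Yn\<close>)
    have Sabs: "(\<Sum>i. \<bar>fps_nth Y i\<bar>) = S" using ynn z by (simp add: S_def Yn)
    have Z1: "summable (\<lambda>i. \<bar>fps_nth Z i\<bar>)" "(\<Sum>i. fps_nth Z i) = z"
    proof -
      have e: "fps_nth Z = (\<lambda>i. if i = 1 then z else 0)" by (auto simp: Z_def fun_eq_iff)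
      show "summable (\<lambda>i. \<bar>fps_nth Z i\<bar>)" unfolding e by (rule summable_finite[of "{1}"]) auto
      show "(\<Sum>i. fps_nth Z i) = z" unfolding e using sums_single[of 1 "\<lambda>_. z"] by (simp add: sums_iff)
    qed
    have "(y * y + fps_X * (H oo y)) oo Z = Y * Y + Z * ((H oo y) oo Z)"
      by (simp add: fps_compose_add_distrib fps_compose_mult_distrib[OF Z0] Y_def Z0)
    also have "(H oo y) oo Z = H oo Y"
      unfolding Y_def by (rule fps_compose_assoc[OF Z0 y0, symmetric])
    finally have Yeq: "Y = Y * Y + Z * (H oo Y)" using eq by (simp add: Y_def)
    have c: "summable (\<lambda>k. \<bar>fps_nth H k\<bar> * (\<Sum>i. \<bar>fps_nth Y i\<bar>) ^ k)"
      using Hsum[OF Snn] Hnn by (simp add: Sabs)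
    note HY = fps_compose_sums[OF Ya Y0 c]
    note m1 = fps_mult_abs_summable[OF Ya Ya] and m2 = fps_mult_abs_summable[OF Z1(1) HY(1)]
    have "S = (\<Sum>i. fps_nth (Y * Y + Z * (H oo Y)) i)" using Yeq by (simp add: S_def)
    also have "\<dots> = (\<Sum>i. fps_nth (Y * Y) i + fps_nth (Z * (H oo Y)) i)"
      by (intro suminf_cong) simp
    also have "\<dots> = (\<Sum>i. fps_nth (Y * Y) i) + (\<Sum>i. fps_nth (Z * (H oo Y)) i)"
      by (rule suminf_add[OF summable_rabs_cancel[OF m1(1)] summable_rabs_cancel[OF m2(1)], symmetric])
    also have "\<dots> = S * S + z * Hs S"
      using m1(3) m2(3) HY(2) Z1(2) by (simp add: S_def Hs_def)
    finally have e: "S * (1 - S) = z * Hs S" by (simp add: algebra_simps)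
    have "0 < S * (1 - S)" unfolding e using z Hspos[OF Snn] by simp
    then have S01: "S \<in> {0..1}" using Snn by (auto simp: zero_less_mult_iff)
    have "z = \<phi> S" using e Hspos[OF Snn] by (simp add: \<phi>_def)
    with max[OF S01] show ?thesis by simp
  qed
  have R_le: "conv_radius (fps_nth y) \<le> ereal (\<phi> \<tau>)"
  proof (rule ccontr)
    assume "\<not> ?thesis"
    then have "ereal (\<phi> \<tau>) < conv_radius (fps_nth y)" by simp
    then obtain z where "\<phi> \<tau> < z" "ereal z < conv_radius (fps_nth y)"
      using ereal_dense2[of "ereal (\<phi> \<tau>)"] by auto
    with z_le[of z] \<phi>pos show False by simp
  qed
  then obtain r where r: "conv_radius (fps_nth y) = ereal r" "0 < r" "r \<le> \<phi> \<tau>"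
    using R by (cases "conv_radius (fps_nth y)") auto

  \<comment> \<open>\<open>\<Psi>\<close> is the value of \<open>\<psi>\<close> at
    \<open>\<tau>\<close>, finite because \<open>\<tau> < 1\<close>. Replacing \<open>X\<close> by
    \<open>\<tau> X\<close> and dividing by \<open>\<Psi>\<close> turns \<open>\<psi>\<close> into
    the probability generating function \<open>P\<close>.\<close>
  define \<Psi> where "\<Psi> = Hs \<tau> / (1 - \<tau>)"
  have \<Psi>: "0 < \<Psi>" using Hspos[of \<tau>] \<tau>01 by (simp add: \<Psi>_def)
  define T where "T = fps_const \<tau> * fps_X"
  have Tn: "fps_nth (F oo T) i = fps_nth F i * \<tau> ^ i" for F i
    unfolding T_def fps_nth_compose_linear by (rule mult.commute)
  define P where "P = fps_const (1 / \<Psi>) * (\<psi> oo T)"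
  have Pn: "fps_nth P i = fps_nth \<psi> i * \<tau> ^ i / \<Psi>" for i
    by (simp add: P_def Tn)
  have Psums: "fps_nth P sums 1"
  proof -
    have f: "summable (\<lambda>i. \<bar>fps_nth (H oo T) i\<bar>)" "(\<Sum>i. fps_nth (H oo T) i) = Hs \<tau>"
      using Hsum[of \<tau>] Hnn \<tau>01 by (auto simp: Tn Hs_def abs_mult)
    have g: "summable (\<lambda>i. \<bar>fps_nth (geo oo T) i\<bar>)" "(\<Sum>i. fps_nth (geo oo T) i) = 1 / (1 - \<tau>)"
      using \<tau>01 by (auto simp: Tn geo_def power_abs suminf_geometric summable_geometric)
    have "\<psi> oo T = (H oo T) * (geo oo T)"
      unfolding \<psi>_def by (rule fps_compose_mult_distrib) (simp add: T_def)
    then have "fps_nth (\<psi> oo T) sums \<Psi>"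
      using fps_mult_abs_summable(3)[OF f(1) g(1)] f(2) g(2)
        summable_rabs_cancel[OF fps_mult_abs_summable(1)[OF f(1) g(1)]]
      by (simp add: \<Psi>_def sums_iff)
    then have "(\<lambda>i. 1 / \<Psi> * fps_nth (\<psi> oo T) i) sums (1 / \<Psi> * \<Psi>)" by (rule sums_mult)
    moreover have "fps_nth P = (\<lambda>i. 1 / \<Psi> * fps_nth (\<psi> oo T) i)" by (simp add: P_def fun_eq_iff)
    ultimately show ?thesis using \<Psi> by simp
  qed
  have "\<exists>C\<ge>0. \<forall>n\<ge>1. \<forall>m. fps_nth (P ^ n) m \<le> C / sqrt (real n)"
  proof (rule power_coeff_bound[OF _ Psums])
    show "0 \<le> fps_nth P i" for i using \<psi>nn \<tau>01 \<Psi> by (simp add: Pn)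
    \<comment> \<open>The factor \<open>1 / (1 - X)\<close> carries the positive constant term of
      \<open>H\<close> into the linear coefficient, so the first two coefficients of
      \<open>P\<close> are positive even if \<open>H\<close> is constant.\<close>
    have "fps_nth \<psi> 0 = fps_nth H 0" "fps_nth \<psi> 1 = fps_nth H 0 + fps_nth H 1"
      by (auto simp: \<psi>_def geo_def fps_mult_nth)
    then show "0 < fps_nth P 0" "0 < fps_nth P 1"
      using H0 Hnn[of 1] \<Psi> \<tau>01 by (auto simp: Pn)
  qed
  then obtain C where C: "0 \<le> C" "\<And>n m. n \<ge> 1 \<Longrightarrow> fps_nth (P ^ n) m \<le> C / sqrt (real n)" by blast
  have Ppow: "fps_nth (P ^ n) m = fps_nth (\<psi> ^ n) m * \<tau> ^ m / \<Psi> ^ n" for n m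
  proof -
    have "P ^ n = fps_const ((1 / \<Psi>) ^ n) * (\<psi> ^ n oo T)"
      by (simp add: P_def power_mult_distrib fps_const_power fps_compose_power T_def)
    then show ?thesis by (simp add: Tn power_divide)
  qed
  have "fps_nth y n \<le> \<tau> * C * real_of_ereal (inverse (conv_radius (fps_nth y))) ^ n / (real n * sqrt (real n))"
    if n: "1 \<le> n" for n
  proof -
    have h: "fps_nth (\<psi> ^ n) (n - 1) * \<tau> ^ (n - 1) / \<Psi> ^ n \<le> C / sqrt (real n)"
      using C(2)[OF n, of "n - 1"] by (simp add: Ppow)
    have "fps_nth (\<psi> ^ n) (n - 1) \<le> (C / sqrt (real n)) * (\<Psi> ^ n / \<tau> ^ (n - 1))"
    proof -
      have "a \<le> c * (p / t)" if "a * t / p \<le> c" "0 < t" "0 < p" for a c p t :: real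
        using that by (simp add: field_simps)
      from this[OF h] show ?thesis using \<tau>01 \<Psi> by simp
    qed
    \<comment> \<open>At the maximizer \<open>\<Psi> / \<tau> = 1 / \<phi>(\<tau>)\<close>, and
      \<open>r \<le> \<phi>(\<tau>)\<close> then replaces this base by the larger
      \<open>1 / r\<close>.\<close>
    also have "\<Psi> ^ n / \<tau> ^ (n - 1) = \<tau> * (1 / \<phi> \<tau>) ^ n"
    proof -
      have "1 / \<phi> \<tau> = \<Psi> / \<tau>" using \<tau>01 by (simp add: \<phi>_def \<Psi>_def)
      then show ?thesis using n \<tau>01 by (cases n) (auto simp: power_divide)
    qed
    also have "(C / sqrt (real n)) * (\<tau> * (1 / \<phi> \<tau>) ^ n) \<le> (C / sqrt (real n)) * (\<tau> * (1 / r) ^ n)"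
      using C(1) \<tau>01 r by (intro mult_left_mono power_mono divide_left_mono mult_pos_pos \<phi>pos) auto
    finally have "fps_nth y n \<le> (C / sqrt (real n)) * (\<tau> * (1 / r) ^ n) / real n"
      unfolding yn[OF n] by (intro divide_right_mono) auto
    then show ?thesis using r by (simp add: inverse_eq_divide mult_ac)
  qed
  then show ?thesis using C(1) \<tau>01 by (intro exI[of _ "\<tau> * C"]) auto
qed

section \<open>The majorant series\<close>

lemma has_real_derivative_deriv_funpow:
  assumes "\<forall>k x. (deriv ^^ k) f differentiable (at x)"
  shows "((deriv ^^ k) f has_real_derivative (deriv ^^ Suc k) f x) (at x)"
  using assms by (simp add: DERIV_deriv_iff_real_differentiable)

text \<open>Formal differentiation does not shrink the radius of convergence, so every iterated
  derivative is again an everywhere convergent power series.\<close>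

lemma entire_series_smooth:
  fixes c :: "nat \<Rightarrow> real"
  assumes "\<forall>u. (\<lambda>i. c i * u ^ i) sums f u"
  shows "\<forall>k x. (deriv ^^ k) f differentiable (at x)"
proof -
  define F where "F = Abs_fps c"
  have rad: "fps_conv_radius F = \<infinity>"
    unfolding fps_conv_radius_def F_def using assms
    by (intro conv_radius_inftyI'') (auto simp: sums_iff)
  have rad_d: "fps_conv_radius ((fps_deriv ^^ k) F) = \<infinity>" for k
  proof (induction k)
    case (Suc k)
    have "fps_conv_radius ((fps_deriv ^^ k) F) \<le> fps_conv_radius (fps_deriv ((fps_deriv ^^ k) F))"
      by (rule fps_conv_radius_deriv)
    with Suc show ?case by simp
  qed (simp add: rad)
  have D: "(eval_fps ((fps_deriv ^^ k) F) has_real_derivative eval_fps ((fps_deriv ^^ Suc k) F) x) (at x)" for k x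
    using has_field_derivative_eval_fps[of x "(fps_deriv ^^ k) F" UNIV] by (simp add: rad_d)
  have e: "(deriv ^^ k) f = eval_fps ((fps_deriv ^^ k) F)" for k
  proof (induction k)
    case 0
    show ?case using assms by (auto simp: fun_eq_iff eval_fps_def F_def sums_iff)
  next
    case (Suc k)
    have "deriv (eval_fps ((fps_deriv ^^ k) F)) x = eval_fps ((fps_deriv ^^ Suc k) F) x" for x
      by (rule DERIV_imp_deriv[OF D])
    then show ?case unfolding funpow.simps o_apply Suc.IH by (intro ext)
  qed
  show ?thesis unfolding e using D real_differentiable_def by blast
qed

locale majorized =
  fixes N Nbar :: "real \<Rightarrow> real"
  assumes N_smooth: "\<forall>k x. (deriv ^^ k) N differentiable (at x)"
    and Nbar_smooth: "\<forall>k x. (deriv ^^ k) Nbar differentiable (at x)"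
    and N_maj: "\<forall>u k. \<bar>(deriv ^^ k) N u\<bar> \<le> (deriv ^^ k) Nbar \<bar>u\<bar>"
begin

lemmas N_DERIV = has_real_derivative_deriv_funpow[OF N_smooth]
lemmas Nbar_DERIV = has_real_derivative_deriv_funpow[OF Nbar_smooth]

lemma Nbar_nonneg: "0 \<le> w \<Longrightarrow> 0 \<le> (deriv ^^ k) Nbar w"
  using N_maj[rule_format, of k w] by simp

lemma Nbar_mono:
  assumes "0 \<le> v" "v \<le> w"
  shows "(deriv ^^ k) Nbar v \<le> (deriv ^^ k) Nbar w"
proof (rule DERIV_nonneg_imp_nondecreasing[OF assms(2)])
  fix x assume "v \<le> x"
  then show "\<exists>y. ((deriv ^^ k) Nbar has_real_derivative y) (at x) \<and> 0 \<le> y"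
    using Nbar_DERIV[of k x] Nbar_nonneg[of x "Suc k"] assms by (intro exI conjI) auto
qed

lemma N_bound:
  assumes "\<bar>u\<bar> \<le> w"
  shows "\<bar>(deriv ^^ k) N u\<bar> \<le> (deriv ^^ k) Nbar w"
  using N_maj[rule_format, of k u] Nbar_mono[of "\<bar>u\<bar>" w k] assms by simp

text \<open>Bernstein's argument: on the half-line all derivatives of \<open>Nbar\<close> are
  nonnegative, hence so are the Taylor terms and the Lagrange remainder, and the partial sums stay
  below \<open>Nbar (w + y)\<close>.\<close>

lemma Nbar_Taylor_summable:
  assumes "0 \<le> w" "0 \<le> y"
  shows "summable (\<lambda>k. (deriv ^^ k) Nbar w / fact k * y ^ k)"
proof (cases "y = 0")
  case True
  show ?thesis by (rule summable_finite[of "{0}"]) (auto simp: True)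
next
  case False
  with assms have y: "0 < y" by simp
  show ?thesis
  proof (rule bounded_imp_summable[where B = "Nbar (w + y)"])
    show "0 \<le> (deriv ^^ k) Nbar w / fact k * y ^ k" for k
      using Nbar_nonneg[of w k] assms by simp
    fix n
    obtain t where t: "w < t" "t < w + y" and
      eq: "Nbar (w + y) = (\<Sum>m<Suc n. (deriv ^^ m) Nbar w / fact m * (w + y - w) ^ m)
          + (deriv ^^ Suc n) Nbar t / fact (Suc n) * (w + y - w) ^ Suc n"
      using Taylor_up[of "Suc n" "\<lambda>k. (deriv ^^ k) Nbar" Nbar w "w + y" w] Nbar_DERIV y by auto
    have "0 \<le> (deriv ^^ Suc n) Nbar t / fact (Suc n) * (w + y - w) ^ Suc n"
      using Nbar_nonneg[of t "Suc n"] t assms by (intro mult_nonneg_nonneg divide_nonneg_nonneg) auto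
    with eq show "(\<Sum>k\<le>n. (deriv ^^ k) Nbar w / fact k * y ^ k) \<le> Nbar (w + y)"
      by (simp add: lessThan_Suc_atMost)
  qed
qed

text \<open>The Lagrange remainder is dominated by a term of the Taylor series of
  \<open>Nbar\<close> at \<open>M = \<bar>u\<bar> + \<bar>h\<bar>\<close>, a bound for every
  intermediate point. That series converges, so its terms tend to 0.\<close>

lemma N_Taylor_sums: "(\<lambda>k. (deriv ^^ k) N u / fact k * h ^ k) sums N (u + h)"
proof (cases "h = 0")
  case True
  then show ?thesis
    using sums_single[of 0 "\<lambda>k. (deriv ^^ k) N u / fact k"] 
    by (simp add: power_0_left mult_delta_right if_distrib cong: if_cong)
next
  case False
  define M where "M = \<bar>u\<bar> + \<bar>h\<bar>"
  define rem where "rem n = (deriv ^^ n) Nbar M / fact n * \<bar>h\<bar> ^ n" for n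
  have rem0: "rem \<longlonglongrightarrow> 0"
    unfolding rem_def using summable_LIMSEQ_zero[OF Nbar_Taylor_summable[of M "\<bar>h\<bar>"]] by (simp add: M_def)
  have "\<bar>(\<Sum>k<n. (deriv ^^ k) N u / fact k * h ^ k) - N (u + h)\<bar> \<le> rem n" if n: "0 < n" for n
  proof -
    obtain t where t: "\<bar>t\<bar> \<le> M" and
      eq: "N (u + h) = (\<Sum>m<n. (deriv ^^ m) N u / fact m * (u + h - u) ^ m)
          + (deriv ^^ n) N t / fact n * (u + h - u) ^ n"
    proof -
      have "\<exists>t. (if u + h < u then u + h < t \<and> t < u else u < t \<and> t < u + h) \<and>
        N (u + h) = (\<Sum>m<n. (deriv ^^ m) N u / fact m * (u + h - u) ^ m)
          + (deriv ^^ n) N t / fact n * (u + h - u) ^ n"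
        by (rule Taylor[where a = "min u (u + h)" and b = "max u (u + h)"]) (use n N_DERIV False in auto)
      then obtain t where "if u + h < u then u + h < t \<and> t < u else u < t \<and> t < u + h"
        "N (u + h) = (\<Sum>m<n. (deriv ^^ m) N u / fact m * (u + h - u) ^ m)
          + (deriv ^^ n) N t / fact n * (u + h - u) ^ n" by blast
      moreover from this have "\<bar>t\<bar> \<le> M" by (auto simp: M_def split: if_splits)
      ultimately show ?thesis using that by blast
    qed
    have "\<bar>(\<Sum>k<n. (deriv ^^ k) N u / fact k * h ^ k) - N (u + h)\<bar> = \<bar>(deriv ^^ n) N t\<bar> / fact n * \<bar>h\<bar> ^ n"
      unfolding eq by (simp add: abs_mult power_abs)
    also have "\<dots> \<le> rem n"
      unfolding rem_def by (intro mult_right_mono divide_right_mono N_bound t) auto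
    finally show ?thesis .
  qed
  then have "eventually (\<lambda>n. \<bar>(\<Sum>k<n. (deriv ^^ k) N u / fact k * h ^ k) - N (u + h)\<bar> \<le> rem n) sequentially"
    by (intro eventually_sequentiallyI[of 1]) auto
  then have "(\<lambda>n. (\<Sum>k<n. (deriv ^^ k) N u / fact k * h ^ k) - N (u + h)) \<longlonglongrightarrow> 0"
    by (intro Lim_null_comparison[OF _ rem0]) auto
  then show ?thesis unfolding sums_def by (rule LIM_zero_cancel)
qed

text \<open>Evaluated at 1, the composition behind the Adomian polynomials becomes the Taylor series
  of \<open>N\<close> at \<open>w 0\<close> with the rest of the series as increment. The majorant
  provides the absolute convergence however large the sum of the absolute values is.\<close>

lemma adomian_sums:
  assumes w: "summable (\<lambda>j. \<bar>w j\<bar>)"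
  shows "(\<lambda>j. adomian N j w) sums N (\<Sum>j. w j)"
proof -
  define c where "c = Abs_fps (\<lambda>k. (deriv ^^ k) N (w 0) / fact k)"
  have ts: "summable (\<lambda>j. \<bar>fps_nth (tail_fps w) j\<bar>)"
    by (rule summable_comparison_test[OF _ w]) (auto simp: tail_fps_nth)
  have "(\<Sum>j. fps_nth (tail_fps w) j) = (\<Sum>j. fps_nth (tail_fps w) (Suc j)) + fps_nth (tail_fps w) 0"
    using suminf_split_head[OF summable_rabs_cancel[OF ts]] by simp
  also have "\<dots> = (\<Sum>j. w (Suc j))" by (simp add: tail_fps_nth)
  also have "\<dots> = (\<Sum>j. w j) - w 0" by (rule suminf_split_head[OF summable_rabs_cancel[OF w]])
  finally have tsum: "(\<Sum>j. fps_nth (tail_fps w) j) = (\<Sum>j. w j) - w 0" .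
  have "summable (\<lambda>k. \<bar>fps_nth c k\<bar> * (\<Sum>j. \<bar>fps_nth (tail_fps w) j\<bar>) ^ k)"
  proof (rule summable_comparison_test[OF _ Nbar_Taylor_summable])
    have "0 \<le> (\<Sum>j. \<bar>fps_nth (tail_fps w) j\<bar>)" by (intro suminf_nonneg ts) auto
    then show "\<exists>K. \<forall>n\<ge>K. norm (\<bar>fps_nth c n\<bar> * (\<Sum>j. \<bar>fps_nth (tail_fps w) j\<bar>) ^ n)
          \<le> (deriv ^^ n) Nbar \<bar>w 0\<bar> / fact n * (\<Sum>j. \<bar>fps_nth (tail_fps w) j\<bar>) ^ n"
      using N_bound[of "w 0" "\<bar>w 0\<bar>"]
      by (auto simp: c_def abs_mult intro!: mult_right_mono divide_right_mono)
  qed (auto intro!: suminf_nonneg ts)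
  note fc = fps_compose_sums[OF ts _ this]
  have a: "fps_nth (c oo tail_fps w) = (\<lambda>j. adomian N j w)"
    by (auto simp: fun_eq_iff adomian_eq fps_compose_nth c_def atLeast0AtMost)
  have "(\<lambda>j. adomian N j w) sums (\<Sum>j. adomian N j w)"
    using summable_rabs_cancel[OF fc(1)] by (simp add: a tail_fps_nth summable_sums)
  also have "(\<Sum>j. adomian N j w) = (\<Sum>k. (deriv ^^ k) N (w 0) / fact k * ((\<Sum>j. w j) - w 0) ^ k)"
    using fc(2) unfolding a tsum by (simp add: tail_fps_nth c_def)
  also have "\<dots> = N (\<Sum>j. w j)"
    using N_Taylor_sums[of "w 0" "(\<Sum>j. w j) - w 0"] by (simp add: sums_iff)
  finally show ?thesis .
qed

lemma fps_power_abs_le: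
  fixes f g :: "real fps"
  assumes "\<And>i. \<bar>fps_nth f i\<bar> \<le> fps_nth g i"
  shows "\<bar>fps_nth (f ^ k) j\<bar> \<le> fps_nth (g ^ k) j"
proof (induction k arbitrary: j)
  case (Suc k)
  have "\<bar>fps_nth (f ^ Suc k) j\<bar> \<le> (\<Sum>i=0..j. \<bar>fps_nth f i\<bar> * \<bar>fps_nth (f ^ k) (j - i)\<bar>)"
    unfolding power_Suc fps_mult_nth by (rule order.trans[OF sum_abs]) (simp add: abs_mult)
  also have "\<dots> \<le> (\<Sum>i=0..j. fps_nth g i * fps_nth (g ^ k) (j - i))"
    by (intro sum_mono mult_mono assms Suc.IH) (auto intro: order.trans[OF abs_ge_zero assms])
  finally show ?case by (simp add: fps_mult_nth)
qed simp

text \<open>Every monomial of the polynomial has weight \<open>j\<close> in the indices, so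
  \<open>\<kappa>^j\<close> factors out. Its degree \<open>k\<close> in the \<open>w i\<close> with
  \<open>i \<ge> 1\<close> is at least 1, so \<open>B^k \<le> B\<close> leaves one factor
  \<open>B\<close>; the argument \<open>w 0\<close> enters only through the monotone derivatives of
  \<open>Nbar\<close>.\<close>

lemma adomian_scaled_bound:
  assumes w0: "\<bar>w 0\<bar> \<le> v 0" and w: "\<And>i. 1 \<le> i \<Longrightarrow> i \<le> j \<Longrightarrow> \<bar>w i\<bar> \<le> B * \<kappa> ^ i * v i"
    and B: "0 \<le> B" "B \<le> 1" and "0 \<le> \<kappa>" and v: "\<And>i. i \<le> j \<Longrightarrow> 0 \<le> v i" and j: "1 \<le> j"
  shows "\<bar>adomian N j w\<bar> \<le> B * \<kappa> ^ j * adomian Nbar j v"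
proof -
  \<comment> \<open>The hypotheses reach only up to \<open>j\<close>. Cutting the sequences off
    there does not change the polynomial and makes the coefficientwise comparison valid for all
    indices.\<close>
  define w' v' where "w' i = (if i \<le> j then w i else 0)" and "v' i = (if i \<le> j then v i else 0)" for i
  have cut: "adomian G j x = adomian G j (\<lambda>i. if i \<le> j then x i else 0)" for G x
    unfolding adomian_def by (auto intro!: sum.cong prod.cong)
  define g where "g = fps_const B * (tail_fps v' oo (fps_const \<kappa> * fps_X))"
  have gk: "fps_nth (g ^ k) j = B ^ k * (\<kappa> ^ j * fps_nth (tail_fps v' ^ k) j)" for k
  proof -
    have "g ^ k = fps_const (B ^ k) * (tail_fps v' ^ k oo (fps_const \<kappa> * fps_X))"
      by (simp add: g_def power_mult_distrib fps_const_power fps_compose_power)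
    then show ?thesis by (simp only: fps_mult_left_const_nth fps_nth_compose_linear)
  qed
  have tnn: "0 \<le> fps_nth (tail_fps v') i" for i using v by (auto simp: tail_fps_nth v'_def)
  have le: "\<bar>fps_nth (tail_fps w') i\<bar> \<le> fps_nth g i" for i
    using w[of i] unfolding g_def fps_mult_left_const_nth fps_nth_compose_linear
    by (auto simp: tail_fps_nth w'_def v'_def)
  have "\<bar>adomian N j w'\<bar> \<le> (\<Sum>k\<le>j. \<bar>(deriv ^^ k) N (w' 0) / fact k * fps_nth (tail_fps w' ^ k) j\<bar>)"
    unfolding adomian_eq by (rule sum_abs)
  also have "\<dots> \<le> (\<Sum>k\<le>j. B * \<kappa> ^ j * ((deriv ^^ k) Nbar (v' 0) / fact k * fps_nth (tail_fps v' ^ k) j))"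
  proof (rule sum_mono)
    fix k
    show "\<bar>(deriv ^^ k) N (w' 0) / fact k * fps_nth (tail_fps w' ^ k) j\<bar>
      \<le> B * \<kappa> ^ j * ((deriv ^^ k) Nbar (v' 0) / fact k * fps_nth (tail_fps v' ^ k) j)"
    proof (cases "k = 0")
      case True then show ?thesis using j by simp
    next
      case False
      have "\<bar>(deriv ^^ k) N (w' 0)\<bar> \<le> (deriv ^^ k) Nbar (v' 0)"
        using w0 by (intro N_bound) (simp add: w'_def v'_def)
      moreover have "\<bar>fps_nth (tail_fps w' ^ k) j\<bar> \<le> B * (\<kappa> ^ j * fps_nth (tail_fps v' ^ k) j)"
      proof -
        have "\<bar>fps_nth (tail_fps w' ^ k) j\<bar> \<le> B ^ k * (\<kappa> ^ j * fps_nth (tail_fps v' ^ k) j)"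
          using fps_power_abs_le[OF le, of k j] by (simp only: gk)
        also have "\<dots> \<le> B * (\<kappa> ^ j * fps_nth (tail_fps v' ^ k) j)"
          using False B power_decreasing[of 1 k B] \<open>0 \<le> \<kappa>\<close> fps_nth_nonneg_power[OF tnn]
          by (intro mult_right_mono mult_nonneg_nonneg) auto
        finally show ?thesis .
      qed
      ultimately have "\<bar>(deriv ^^ k) N (w' 0)\<bar> / fact k * \<bar>fps_nth (tail_fps w' ^ k) j\<bar>
          \<le> (deriv ^^ k) Nbar (v' 0) / fact k * (B * (\<kappa> ^ j * fps_nth (tail_fps v' ^ k) j))"
        using Nbar_nonneg[of "v' 0" k] v[of 0]
        by (intro mult_mono divide_right_mono) (auto simp: v'_def)
      then show ?thesis by (simp add: abs_mult mult_ac)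
    qed
  qed
  also have "\<dots> = B * \<kappa> ^ j * adomian Nbar j v'"
    unfolding adomian_eq sum_distrib_left ..
  finally show ?thesis using cut[of N w] cut[of Nbar v] by (simp add: w'_def[abs_def] v'_def[abs_def])
qed

end

section \<open>Growth of the majorant coefficients\<close>

locale majorant_sequence = majorized +
  fixes vb :: "nat \<Rightarrow> real" and Q :: real
  assumes Q: "0 \<le> Q"
    and vb0: "vb 0 = 8/3"
    and vb1: "vb 1 = (1 + vb 0) * (Q * vb 0 + deriv Nbar (vb 0) * vb 0)"
    and vbSuc: "\<forall>j\<ge>1. vb (Suc j) = (\<Sum>p=1..j. vb (Suc j - p) * vb p)
                 + (1 + vb 0) * (Q * vb j + adomian Nbar j vb)"
begin

lemma vb_nonneg: "0 \<le> vb j"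
proof (induction j rule: less_induct)
  case (less j)
  consider "j = 0" | "j = 1" | i where "j = Suc i" "1 \<le> i" by (cases j) (auto simp: Suc_le_eq)
  then show ?case
  proof cases
    case 1 then show ?thesis by (simp add: vb0)
  next
    case 2 then show ?thesis using Nbar_nonneg[of "8/3" 1] Q by (simp add: vb1[unfolded One_nat_def] vb0)
  next
    case 3
    have "0 \<le> adomian Nbar i vb"
      unfolding adomian_def using Nbar_nonneg[of "vb 0"] less 3
      by (intro sum_nonneg mult_nonneg_nonneg prod_nonneg) (auto simp: vb0)
    moreover have "0 \<le> (\<Sum>p=1..i. vb (Suc i - p) * vb p)"
      using less 3 by (intro sum_nonneg mult_nonneg_nonneg) auto
    ultimately show ?thesis using less[of i] 3 Q by (simp add: vbSuc vb0)
  qed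
qed

text \<open>The constant term of the \<open>H\<close> used here is \<open>vb 1\<close>, and the
  growth theorem needs it positive. If \<open>vb 1 = 0\<close>, then \<open>Q\<close> and
  \<open>deriv Nbar (vb 0)\<close> vanish and so do all later coefficients.\<close>

lemma vb_growth:
  assumes R: "0 < conv_radius vb"
  shows "\<exists>C\<ge>0. \<forall>n\<ge>1. vb n \<le> C * Rinv vb ^ n / (real n * sqrt (real n))"
proof (cases "vb 1 = 0")
  case True
  have Nb: "0 \<le> deriv Nbar (vb 0)" using Nbar_nonneg[of "vb 0" 1] by (simp add: vb0)
  with True Q have Q0: "Q = 0" by (simp add: vb1[unfolded One_nat_def] vb0 add_nonneg_eq_0_iff)
  have "vb n = 0" if "1 \<le> n" for n
    using that
  proof (induction n rule: less_induct)
    case (less n)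
    show ?case
    proof (cases "n = 1")
      case True then show ?thesis using \<open>vb 1 = 0\<close> by simp
    next
      case False
      then obtain j where j: "n = Suc j" "1 \<le> j" using less.prems by (cases n) auto
      have vj: "vb i = 0" if "1 \<le> i" "i \<le> j" for i using less.IH[of i] that j by simp
      have "\<bar>adomian Nbar j vb\<bar> = 0"
      proof -
        have "(\<Prod>i\<in>{1..j}. vb i ^ (\<alpha> i - \<alpha> (Suc i)) / fact (\<alpha> i - \<alpha> (Suc i))) = 0" if "\<alpha> \<in> adom_idx j" for \<alpha>
        proof (rule ccontr)
          \<comment> \<open>With \<open>vb 1, ..., vb j\<close> all zero, a nonzero product forces
            every exponent to vanish. Then \<open>\<alpha>\<close> is constant up to index
            \<open>j + 1\<close>, where it is 0, contradicting the sum
            \<open>j \<ge> 1\<close>.\<close>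
          assume nz: "\<not> ?thesis"
          have mon: "\<alpha> i \<le> \<alpha> (Suc i)" if "i \<in> {1..j}" for i
            using nz vj that by (force simp: prod_zero_iff)
          have "\<alpha> i = 0" if "i \<ge> 1" for i
            using that
          proof (induction "Suc j - i" arbitrary: i)
            case 0
            then show ?case using \<open>\<alpha> \<in> adom_idx j\<close> by (auto simp: adom_idx_def)
          next
            case (Suc d)
            then have "\<alpha> (Suc i) = 0" "i \<in> {1..j}" by auto
            with mon[of i] show ?case by simp
          qed
          then show False using \<open>\<alpha> \<in> adom_idx j\<close> j by (auto simp: adom_idx_def)
        qed
        then have "adomian Nbar j vb = (\<Sum>\<alpha>\<in>adom_idx j. 0)"
          unfolding adomian_def by (intro sum.cong refl) (simp only: mult_zero_right)
        then show ?thesis by simp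
      qed
      moreover have "(\<Sum>p=1..j. vb (Suc j - p) * vb p) = 0" using vj by (intro sum.neutral) auto
      ultimately show ?thesis using j Q0 by (simp add: vbSuc)
    qed
  qed
  then show ?thesis by (intro exI[of _ 0]) simp
next
  case False
  define y where "y = tail_fps vb"
  \<comment> \<open>With \<open>f = vb 0 + y\<close> and \<open>Nbar\<close> read as its Taylor
    series at \<open>vb 0\<close>, this is
    \<open>(1 + vb 0) (Q f + Nbar(f) + Nbar'(vb 0) vb 0 - Nbar(vb 0))\<close>. Its constant term
    accounts for the special rule for \<open>vb 1\<close>.\<close>
  define H where "H = Abs_fps (\<lambda>k. if k = 0 then vb 1
      else (1 + vb 0) * ((if k = 1 then Q else 0) + (deriv ^^ k) Nbar (vb 0) / fact k))"
  have rad: "conv_radius (fps_nth y) = conv_radius vb"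
    by (intro conv_radius_cong eventually_sequentiallyI[of 1]) (auto simp: y_def tail_fps_nth)
  have Nn: "0 \<le> (deriv ^^ k) Nbar (vb 0) / fact k" for k
    using Nbar_nonneg[of "vb 0" k] by (simp add: vb0)
  have comp: "fps_nth (H oo y) j = (1 + vb 0) * (Q * vb j + adomian Nbar j vb)" if j: "1 \<le> j" for j
  proof -
    have "fps_nth (H oo y) j = (\<Sum>k\<le>j. fps_nth H k * fps_nth (y ^ k) j)"
      by (simp add: fps_compose_nth atLeast0AtMost)
    also have "\<dots> = (\<Sum>k\<le>j. (1 + vb 0) * ((if k = 1 then Q * vb j else 0)
          + (deriv ^^ k) Nbar (vb 0) / fact k * fps_nth (tail_fps vb ^ k) j))"
      using j by (intro sum.cong refl) (auto simp: H_def y_def tail_fps_nth algebra_simps)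
    also have "\<dots> = (1 + vb 0) * (Q * vb j + adomian Nbar j vb)"
      using j by (simp add: adomian_eq sum.distrib flip: sum_distrib_left)
    finally show ?thesis .
  qed
  have "\<exists>C\<ge>0. \<forall>n\<ge>1. fps_nth y n
           \<le> C * real_of_ereal (inverse (conv_radius (fps_nth y))) ^ n / (real n * sqrt (real n))"
  proof (rule quadratic_majorant_growth)
    show "y = y * y + fps_X * (H oo y)"
    proof (rule fps_ext)
      fix n
      consider "n = 0" | "n = 1" | j where "n = Suc j" "1 \<le> j" by (cases n) (auto simp: Suc_le_eq)
      then show "fps_nth y n = fps_nth (y * y + fps_X * (H oo y)) n"
      proof cases
        case 1 then show ?thesis by (simp add: y_def tail_fps_nth)
      next
        case 2
        then show ?thesis by (simp add: y_def tail_fps_nth fps_mult_nth_1 H_def)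
      next
        case 3
        have "fps_nth (y * y) (Suc j) = (\<Sum>p=0..Suc j. fps_nth y p * fps_nth y (Suc j - p))"
          by (rule fps_mult_nth)
        also have "\<dots> = (\<Sum>p=1..j. fps_nth y p * fps_nth y (Suc j - p))"
          by (rule sum.mono_neutral_right) (auto simp: y_def tail_fps_nth)
        also have "\<dots> = (\<Sum>p=1..j. vb (Suc j - p) * vb p)"
          by (intro sum.cong refl) (auto simp: y_def tail_fps_nth)
        finally show ?thesis using 3 by (simp add: comp vbSuc) (simp add: y_def tail_fps_nth vbSuc)
      qed
    qed
    show "fps_nth y 0 = 0" by (simp add: y_def tail_fps_nth)
    show "0 \<le> fps_nth H i" for i
      using Nn[of i] vb_nonneg[of 1] vb_nonneg[of 0] Q by (auto simp: H_def)
    show "0 < fps_nth H 0" using False vb_nonneg[of 1] by (simp add: H_def)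
    show "0 < conv_radius (fps_nth y)" using R by (simp add: rad)
    show "summable (\<lambda>i. fps_nth H i * t ^ i)" if "0 \<le> t" for t
    proof -
      have "summable (\<lambda>k. (1 + vb 0) * ((deriv ^^ k) Nbar (vb 0) / fact k * t ^ k))"
        using that by (intro summable_mult Nbar_Taylor_summable) (auto simp: vb0)
      moreover have "eventually (\<lambda>k. fps_nth H k * t ^ k = (1 + vb 0) * ((deriv ^^ k) Nbar (vb 0) / fact k * t ^ k)) sequentially"
        by (intro eventually_sequentiallyI[of 2]) (auto simp: H_def)
      ultimately show ?thesis by (subst summable_cong)
    qed
  qed
  then show ?thesis unfolding rad Rinv_def by (simp add: y_def tail_fps_nth)
qed

end

section \<open>Variation of parameters\<close>

lemma has_integral_abs_le:
  fixes f g :: "real \<Rightarrow> real"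
  assumes "(f has_integral i) S" "(g has_integral j) S" "\<And>x. x \<in> S \<Longrightarrow> \<bar>f x\<bar> \<le> g x"
  shows "\<bar>i\<bar> \<le> j"
  using has_integral_norm_bound_integral_component[OF assms(1,2), of 1] assms(3) by simp

lemma absolutely_integrable_continuous_mult:
  fixes W h :: "real \<Rightarrow> real"
  assumes "continuous_on {a..b} W" "h absolutely_integrable_on {a..b}"
  shows "(\<lambda>t. W t * h t) absolutely_integrable_on {a..b}"
proof (rule absolutely_integrable_bounded_measurable_product_real[OF _ _ _ assms(2)])
  show "W \<in> borel_measurable (lebesgue_on {a..b})"
    by (intro continuous_imp_measurable_on_sets_lebesgue assms) auto
  show "bounded (W ` {a..b})"
    by (intro compact_imp_bounded compact_continuous_image assms) auto
qed auto

text \<open>\<open>F\<close> need not be differentiable everywhere, so the product rule is replaced by an estimate of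
  the increments of the difference of both sides, which are \<open>o(y - x)\<close>.\<close>
lemma integration_by_parts_indefinite:
  fixes h F W W' :: "real \<Rightarrow> real"
  assumes ab: "a \<le> b" and h: "h absolutely_integrable_on {a..b}"
    and F: "\<And>x. x \<in> {a..b} \<Longrightarrow> (h has_integral (F x - F a)) {a..x}"
    and W: "\<And>x. x \<in> {a..b} \<Longrightarrow> (W has_real_derivative W' x) (at x within {a..b})"
    and W': "continuous_on {a..b} W'"
  shows "((\<lambda>t. W t * h t + W' t * F t) has_integral (W b * F b - W a * F a)) {a..b}"
proof -
  have hi: "h integrable_on {a..b}" and hn: "(\<lambda>t. \<bar>h t\<bar>) integrable_on {a..b}"
    using h by (auto simp: absolutely_integrable_on_def)
  have Wc: "continuous_on {a..b} W"
    using W by (intro DERIV_continuous_on) auto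
  have Fe: "F x = F a + integral {a..x} h" if "x \<in> {a..b}" for x
    using integral_unique[OF F[OF that]] by simp
  have Fc: "continuous_on {a..b} F"
    using continuous_on_add[OF continuous_on_const indefinite_integral_continuous_1[OF hi], of "F a"]
    by (rule continuous_on_eq) (rule Fe[symmetric])
  \<comment> \<open>\<open>\<Phi>\<close> dominates the increments of \<open>F\<close>. It is
    continuous, which makes the increment bound below of order \<open>o(y - x)\<close>.\<close>
  define \<Phi> where "\<Phi> x = integral {a..x} (\<lambda>t. \<bar>h t\<bar>)" for x
  have \<Phi>c: "continuous_on {a..b} \<Phi>"
    unfolding \<Phi>_def by (rule indefinite_integral_continuous_1[OF hn])
  define g where "g t = W t * h t + W' t * F t" for t
  have gi: "g integrable_on {a..b}"
    unfolding g_def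
    by (intro integrable_add set_lebesgue_integral_eq_integral(1) absolutely_integrable_continuous_mult
        integrable_continuous_real continuous_intros h Wc W' Fc)
  have "bounded (W' ` {a..b})"
    by (intro compact_imp_bounded compact_continuous_image W') auto
  then obtain C where C: "\<And>t. t \<in> {a..b} \<Longrightarrow> \<bar>W' t\<bar> \<le> C"
    unfolding bounded_iff real_norm_def by blast
  have C0: "0 \<le> C" using C[of a] ab by auto
  have lip: "\<bar>W s - W t\<bar> \<le> C * \<bar>s - t\<bar>" if "s \<in> {a..b}" "t \<in> {a..b}" for s t
    using field_differentiable_bound[of "{a..b}" W W' C s t] W C that by (auto simp: convex_real_interval)
  define E where "E x = integral {a..x} g - W x * F x" for x
  have inc: "\<bar>E y - E x\<bar> \<le> 2 * C * \<bar>y - x\<bar> * \<bar>\<Phi> y - \<Phi> x\<bar>" if xy: "a \<le> x" "x \<le> y" "y \<le> b" for x y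
  proof -
    have sub: "{x..y} \<subseteq> {a..b}" using xy by auto
    have comb: "integral {a..y} f - integral {a..x} f = integral {x..y} f" if "f integrable_on {a..b}" for f :: "real \<Rightarrow> real"
      using Henstock_Kurzweil_Integration.integral_combine[of a x y f] xy integrable_on_subinterval[OF that, of a y] by simp
    have Fxy: "F y - F x = integral {x..y} h" using comb[OF hi] Fe[of x] Fe[of y] xy by simp
    have Pxy: "\<Phi> y - \<Phi> x = integral {x..y} (\<lambda>t. \<bar>h t\<bar>)" using comb[OF hn] by (simp add: \<Phi>_def)
    have hi': "h integrable_on {x..y}" and hn': "(\<lambda>t. \<bar>h t\<bar>) integrable_on {x..y}" and gi': "g integrable_on {x..y}"
      using integrable_on_subinterval[OF hi sub] integrable_on_subinterval[OF hn sub]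
        integrable_on_subinterval[OF gi sub] by auto
    have W'i: "(W' has_integral (W y - W x)) {x..y}"
      using xy W has_field_derivative_subset[OF W sub]
      by (intro fundamental_theorem_of_calculus)
        (auto simp: has_real_derivative_iff_has_vector_derivative[symmetric])
    \<comment> \<open>The increment of \<open>W F\<close> splits as
      \<open>W y (F y - F x) + (W y - W x) F x\<close>. Subtracting the integrals of these two parts
      leaves an integrand in which each term contains a small difference, of \<open>W\<close> or of
      \<open>F\<close>.\<close>
    have "((\<lambda>t. g t - W y * h t - W' t * F x) has_integral (integral {x..y} g - W y * (F y - F x) - (W y - W x) * F x)) {x..y}"
      unfolding Fxy
      by (intro has_integral_diff has_integral_mult_right has_integral_mult_left integrable_integral gi' hi' W'i)
    also have "integral {x..y} g - W y * (F y - F x) - (W y - W x) * F x = E y - E x"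
      using comb[OF gi] by (simp add: E_def algebra_simps)
    also have "(\<lambda>t. g t - W y * h t - W' t * F x) = (\<lambda>t. (W t - W y) * h t + W' t * (F t - F x))"
      by (auto simp: g_def algebra_simps)
    finally have E: "((\<lambda>t. (W t - W y) * h t + W' t * (F t - F x)) has_integral (E y - E x)) {x..y}" .
    have "\<bar>E y - E x\<bar> \<le> C * (y - x) * (\<Phi> y - \<Phi> x) + (y - x) * (C * (\<Phi> y - \<Phi> x))"
    proof (rule has_integral_abs_le[OF E])
      have "((\<lambda>t. C * (\<Phi> y - \<Phi> x)) has_integral ((y - x) * (C * (\<Phi> y - \<Phi> x)))) {x..y}"
        using has_integral_const_real[of "C * (\<Phi> y - \<Phi> x)" x y] xy by simp
      then show "((\<lambda>t. C * (y - x) * \<bar>h t\<bar> + C * (\<Phi> y - \<Phi> x)) has_integral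
          (C * (y - x) * (\<Phi> y - \<Phi> x) + (y - x) * (C * (\<Phi> y - \<Phi> x)))) {x..y}"
        unfolding Pxy by (intro has_integral_add has_integral_mult_right integrable_integral hn')
      fix t assume t: "t \<in> {x..y}"
      have "\<bar>W t - W y\<bar> \<le> C * (y - x)"
        using lip[of t y] t xy C0 by (intro order.trans[OF lip[of t y]] mult_left_mono) auto
      moreover have "\<bar>F t - F x\<bar> \<le> \<Phi> y - \<Phi> x"
      proof -
        have "\<bar>F t - F x\<bar> = \<bar>integral {x..t} h\<bar>"
          using Henstock_Kurzweil_Integration.integral_combine[of a x t h] xy t Fe[of x] Fe[of t]
            integrable_on_subinterval[OF hi, of a t] by simp
        also have "\<dots> \<le> integral {x..t} (\<lambda>t. \<bar>h t\<bar>)"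
          using integral_norm_bound_integral[of h "{x..t}" "\<lambda>t. \<bar>h t\<bar>"] t xy
            integrable_on_subinterval[OF hi, of x t] integrable_on_subinterval[OF hn, of x t] by simp
        also have "\<dots> \<le> integral {x..y} (\<lambda>t. \<bar>h t\<bar>)"
          using t xy by (intro integral_subset_le integrable_on_subinterval[OF hn]) auto
        finally show ?thesis by (simp add: Pxy)
      qed
      ultimately have "\<bar>(W t - W y) * h t\<bar> \<le> C * (y - x) * \<bar>h t\<bar>" "\<bar>W' t * (F t - F x)\<bar> \<le> C * (\<Phi> y - \<Phi> x)"
        using C[of t] t xy C0 by (auto simp: abs_mult intro!: mult_right_mono mult_mono)
      then show "\<bar>(W t - W y) * h t + W' t * (F t - F x)\<bar> \<le> C * (y - x) * \<bar>h t\<bar> + C * (\<Phi> y - \<Phi> x)"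
        by linarith
    qed
    also have "\<dots> = 2 * C * (y - x) * (\<Phi> y - \<Phi> x)" by simp
    also have "\<dots> \<le> 2 * C * \<bar>y - x\<bar> * \<bar>\<Phi> y - \<Phi> x\<bar>"
      using C0 xy by (auto intro!: mult_left_mono)
    finally show ?thesis .
  qed
  have inc': "\<bar>E y - E x\<bar> \<le> 2 * C * \<bar>y - x\<bar> * \<bar>\<Phi> y - \<Phi> x\<bar>" if "x \<in> {a..b}" "y \<in> {a..b}" for x y
    using inc[of x y] inc[of y x] that by (cases "x \<le> y") (auto simp: abs_minus_commute)
  have "(E has_real_derivative 0) (at x within {a..b})" if x: "x \<in> {a..b}" for x
  proof -
    have "((\<lambda>y. 2 * C * \<bar>\<Phi> y - \<Phi> x\<bar>) \<longlongrightarrow> 2 * C * \<bar>\<Phi> x - \<Phi> x\<bar>) (at x within {a..b})"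
      using \<Phi>c x by (intro tendsto_intros) (auto simp: continuous_on_def)
    then have lim: "((\<lambda>y. 2 * C * \<bar>\<Phi> y - \<Phi> x\<bar>) \<longlongrightarrow> 0) (at x within {a..b})" by simp
    have "eventually (\<lambda>y. norm ((E y - E x) / (y - x)) \<le> 2 * C * \<bar>\<Phi> y - \<Phi> x\<bar>) (at x within {a..b})"
      unfolding eventually_at_filter
    proof (intro always_eventually allI impI)
      fix y assume "y \<noteq> x" "y \<in> {a..b}"
      then show "norm ((E y - E x) / (y - x)) \<le> 2 * C * \<bar>\<Phi> y - \<Phi> x\<bar>"
        using inc'[OF x, of y] by (simp add: abs_divide pos_divide_le_eq mult_ac)
    qed
    then show ?thesis
      unfolding has_field_derivative_iff by (rule Lim_null_comparison[OF _ lim])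
  qed
  then obtain c where c: "\<And>x. x \<in> {a..b} \<Longrightarrow> E x = c"
    using has_field_derivative_zero_constant[of "{a..b}" E] by auto
  have "integral {a..b} g = W b * F b - W a * F a"
    using c[of a] c[of b] ab by (simp add: E_def)
  then show ?thesis using integrable_integral[OF gi] by (simp add: g_def[abs_def])
qed

section \<open>Bounds for the linear correction problem\<close>

lemma ode_sol_subinterval:
  assumes "ode_sol a b \<mu> u du g" "x \<in> {a..b}"
  shows "ode_sol a x \<mu> u du g"
proof -
  have "{a..x} \<subseteq> {a..b}" using assms(2) by auto
  then show ?thesis
    using assms(1) has_field_derivative_subset unfolding ode_sol_def by blast
qed

text \<open>The weight is applied to \<open>du\<close> by parts and its derivative to
  \<open>u\<close> by the fundamental theorem; the terms with \<open>\<omega>^2 u\<close> cancel.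
  The centre \<open>c\<close> is left free: \<open>c = x\<close> isolates
  \<open>\<omega> u(x)\<close>, \<open>c = x + pi / (2 \<omega>)\<close> isolates
  \<open>du x\<close>, and \<open>c = 1\<close> reads off the boundary value at 1.\<close>

lemma variation_of_parameters:
  fixes u du g :: "real \<Rightarrow> real"
  assumes sol: "ode_sol a b (\<omega>\<^sup>2) u du g" and g: "g absolutely_integrable_on {a..b}" and x: "x \<in> {a..b}"
  shows "((\<lambda>t. sin (\<omega> * (c - t)) * g t) has_integral
     (sin (\<omega> * (c - x)) * du x + \<omega> * cos (\<omega> * (c - x)) * u x
      - (sin (\<omega> * (c - a)) * du a + \<omega> * cos (\<omega> * (c - a)) * u a))) {a..x}"
proof -
  have ax: "a \<le> x" using x by simp
  have gx: "g absolutely_integrable_on {a..x}"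
    using x by (intro absolutely_integrable_on_subinterval[OF g]) auto
  note s = ode_sol_subinterval[OF sol x, unfolded ode_sol_def]
  have uD: "\<And>t. t \<in> {a..x} \<Longrightarrow> (u has_real_derivative du t) (at t within {a..x})" using s by blast
  have uc: "continuous_on {a..x} u" using uD by (intro DERIV_continuous_on) auto
  have h: "(\<lambda>t. g t - \<omega>\<^sup>2 * u t) absolutely_integrable_on {a..x}"
    by (intro set_integral_diff(1) gx absolutely_integrable_continuous_real continuous_intros uc)
  have 1: "((\<lambda>t. sin (\<omega> * (c - t)) * (g t - \<omega>\<^sup>2 * u t) + - (\<omega> * cos (\<omega> * (c - t))) * du t) has_integral
      (sin (\<omega> * (c - x)) * du x - sin (\<omega> * (c - a)) * du a)) {a..x}"
    using s by (intro integration_by_parts_indefinite ax h) (auto intro!: derivative_eq_intros continuous_intros)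
  have 2: "((\<lambda>t. \<omega>\<^sup>2 * sin (\<omega> * (c - t)) * u t + \<omega> * cos (\<omega> * (c - t)) * du t) has_integral
      (\<omega> * cos (\<omega> * (c - x)) * u x - \<omega> * cos (\<omega> * (c - a)) * u a)) {a..x}"
  proof (rule fundamental_theorem_of_calculus[OF ax])
    fix t assume t: "t \<in> {a..x}"
    show "((\<lambda>t. \<omega> * cos (\<omega> * (c - t)) * u t) has_vector_derivative
        \<omega>\<^sup>2 * sin (\<omega> * (c - t)) * u t + \<omega> * cos (\<omega> * (c - t)) * du t) (at t within {a..x})"
      unfolding has_real_derivative_iff_has_vector_derivative[symmetric]
      by (rule derivative_eq_intros uD[OF t] refl | simp add: power2_eq_square algebra_simps)+
  qed
  show ?thesis
    using has_integral_add[OF 1 2] by (simp add: algebra_simps)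
qed

lemma sin_weighted_integral_bound:
  fixes g :: "real \<Rightarrow> real"
  assumes I: "((\<lambda>t. sin (\<omega> * (c - t)) * g t) has_integral I) {a..x}"
    and g: "g absolutely_integrable_on {a..b}" and x: "x \<in> {a..b}"
  shows "\<bar>I\<bar> \<le> integral {a..b} (\<lambda>t. \<bar>g t\<bar>)"
proof -
  have gn: "(\<lambda>t. \<bar>g t\<bar>) integrable_on {a..b}" using g by (simp add: absolutely_integrable_on_def)
  then have gx: "(\<lambda>t. \<bar>g t\<bar>) integrable_on {a..x}"
    using x by (intro integrable_on_subinterval[OF gn]) auto
  have "\<bar>I\<bar> \<le> integral {a..x} (\<lambda>t. \<bar>g t\<bar>)"
    by (rule has_integral_abs_le[OF I integrable_integral[OF gx]])
       (auto simp: abs_mult intro: mult_left_le_one_le)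
  also have "\<dots> \<le> integral {a..b} (\<lambda>t. \<bar>g t\<bar>)"
    using x by (intro integral_subset_le gx gn) auto
  finally show ?thesis .
qed

text \<open>Here \<open>l\<close> is the new eigenvalue correction, \<open>e1, e2\<close> the trial
  function and \<open>f1, f2\<close> the known part of the right-hand side. Pairing with
  \<open>sin (\<omega> (1 - t))\<close> removes all boundary terms and expresses \<open>l\<close>
  through \<open>f1, f2\<close>. The solution is then controlled by the L1 norm of
  \<open>f - l e\<close>, where \<open>e\<close> contributes at most \<open>(s1 + s2) / 2\<close>
  since each half has length 1/2.\<close>

lemma correction_bound:
  fixes f1 f2 e1 e2 v1 v2 dv1 dv2 :: "real \<Rightarrow> real"
  assumes \<omega>: "0 < \<omega>"
    and sol1: "ode_sol 0 (1/2) (\<omega>\<^sup>2) v1 dv1 (\<lambda>x. f1 x - l * e1 x)"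
    and sol2: "ode_sol (1/2) 1 (\<omega>\<^sup>2) v2 dv2 (\<lambda>x. f2 x - l * e2 x)"
    and bc: "v1 0 = 0" "v2 1 = 0" "dv1 0 = 0" "v2 (1/2) = v1 (1/2)" "dv2 (1/2) = dv1 (1/2)"
    and f1: "f1 absolutely_integrable_on {0..1/2}" and f2: "f2 absolutely_integrable_on {1/2..1}"
    and e1: "continuous_on {0..1/2} e1" and e2: "continuous_on {1/2..1} e2"
    and s1: "\<And>x. x \<in> {0..1/2} \<Longrightarrow> \<bar>e1 x\<bar> \<le> s1" and s2: "\<And>x. x \<in> {1/2..1} \<Longrightarrow> \<bar>e2 x\<bar> \<le> s2"
    and M: "integral {0..1/2} (\<lambda>x. \<bar>f1 x\<bar>) + integral {1/2..1} (\<lambda>x. \<bar>f2 x\<bar>) \<le> M"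
    and G: "0 \<le> G" "1 \<le> G * \<bar>integral {0..1/2} (\<lambda>t. sin (\<omega> * (1 - t)) * e1 t)
                          + integral {1/2..1} (\<lambda>t. sin (\<omega> * (1 - t)) * e2 t)\<bar>"
  shows "\<bar>l\<bar> \<le> G * M"
    and "x \<in> {0..1/2} \<Longrightarrow> \<bar>v1 x\<bar> \<le> (G * ((s1 + s2) / 2) + 1) * M / \<omega>"
    and "x \<in> {0..1/2} \<Longrightarrow> \<bar>dv1 x\<bar> \<le> (G * ((s1 + s2) / 2) + 1) * M"
    and "x \<in> {1/2..1} \<Longrightarrow> \<bar>v2 x\<bar> \<le> (G * ((s1 + s2) / 2) + 1) * M / \<omega>"
    and "x \<in> {1/2..1} \<Longrightarrow> \<bar>dv2 x\<bar> \<le> (G * ((s1 + s2) / 2) + 1) * M"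
proof -
  define g1 g2 where "g1 x = f1 x - l * e1 x" and "g2 x = f2 x - l * e2 x" for x
  define T where "T = integral {0..1/2} (\<lambda>x. \<bar>g1 x\<bar>) + integral {1/2..1} (\<lambda>x. \<bar>g2 x\<bar>)"
  let ?I1 = "integral {0..1/2} (\<lambda>t. sin (\<omega> * (1 - t)) * e1 t)"
  let ?I2 = "integral {1/2..1} (\<lambda>t. sin (\<omega> * (1 - t)) * e2 t)"
  have ea1: "(\<lambda>x. l * e1 x) absolutely_integrable_on {0..1/2}"
    and ea2: "(\<lambda>x. l * e2 x) absolutely_integrable_on {1/2..1}"
    by (intro absolutely_integrable_continuous_real continuous_intros e1 e2)+
  have g1: "g1 absolutely_integrable_on {0..1/2}" unfolding g1_def by (rule set_integral_diff(1)[OF f1 ea1])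
  have g2: "g2 absolutely_integrable_on {1/2..1}" unfolding g2_def by (rule set_integral_diff(1)[OF f2 ea2])
  note sol1 = sol1[folded g1_def] and sol2 = sol2[folded g2_def]
  have V1: "((\<lambda>t. sin (\<omega> * (c - t)) * g1 t) has_integral
     (sin (\<omega> * (c - x)) * dv1 x + \<omega> * cos (\<omega> * (c - x)) * v1 x)) {0..x}" if "x \<in> {0..1/2}" for x c
    using variation_of_parameters[OF sol1 g1 that, of c] bc by simp
  have B1: "\<bar>sin (\<omega> * (c - x)) * dv1 x + \<omega> * cos (\<omega> * (c - x)) * v1 x\<bar> \<le> integral {0..1/2} (\<lambda>x. \<bar>g1 x\<bar>)"
    if "x \<in> {0..1/2}" for x c
    by (rule sin_weighted_integral_bound[OF V1[OF that] g1 that])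
  have V2: "((\<lambda>t. sin (\<omega> * (c - t)) * g2 t) has_integral
     (sin (\<omega> * (c - x)) * dv2 x + \<omega> * cos (\<omega> * (c - x)) * v2 x
      - (sin (\<omega> * (c - 1/2)) * dv1 (1/2) + \<omega> * cos (\<omega> * (c - 1/2)) * v1 (1/2)))) {1/2..x}"
    if "x \<in> {1/2..1}" for x c
    using variation_of_parameters[OF sol2 g2 that, of c] bc by simp
  \<comment> \<open>Value and derivative match at 1/2, so the boundary term of the second half there
    is the one already bounded on the first half.\<close>
  have B2: "\<bar>sin (\<omega> * (c - x)) * dv2 x + \<omega> * cos (\<omega> * (c - x)) * v2 x\<bar> \<le> T" if "x \<in> {1/2..1}" for x c
    using B1[of "1/2" c] sin_weighted_integral_bound[OF V2[OF that, of c] g2 that] unfolding T_def by auto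
  have g2nn: "0 \<le> integral {1/2..1} (\<lambda>x. \<bar>g2 x\<bar>)"
    using g2 by (intro integral_nonneg) (auto simp: absolutely_integrable_on_def)
  then have B1': "\<bar>sin (\<omega> * (c - x)) * dv1 x + \<omega> * cos (\<omega> * (c - x)) * v1 x\<bar> \<le> T" if "x \<in> {0..1/2}" for x c
    using B1[OF that, of c] unfolding T_def by linarith

  have wi: "(\<lambda>t. sin (\<omega> * (1 - t)) * f t) integrable_on {a..b}" if "f absolutely_integrable_on {a..b}" for f :: "real \<Rightarrow> real" and a b
    by (intro set_lebesgue_integral_eq_integral(1) absolutely_integrable_continuous_mult continuous_intros that)
  have wb: "\<bar>integral {a..b} (\<lambda>t. sin (\<omega> * (1 - t)) * f t)\<bar> \<le> integral {a..b} (\<lambda>x. \<bar>f x\<bar>)"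
    if "f absolutely_integrable_on {a..b}" "a \<le> b" for f :: "real \<Rightarrow> real" and a b
    using sin_weighted_integral_bound[OF integrable_integral[OF wi[OF that(1)]] that(1)] that(2) by simp
  have ec1: "e1 absolutely_integrable_on {0..1/2}" and ec2: "e2 absolutely_integrable_on {1/2..1}"
    by (intro absolutely_integrable_continuous_real e1 e2)+
  have sp: "integral {a..b} (\<lambda>t. sin (\<omega> * (1 - t)) * (f t - l * e t)) =
      integral {a..b} (\<lambda>t. sin (\<omega> * (1 - t)) * f t) - l * integral {a..b} (\<lambda>t. sin (\<omega> * (1 - t)) * e t)"
    if "f absolutely_integrable_on {a..b}" "e absolutely_integrable_on {a..b}" for f e :: "real \<Rightarrow> real" and a b
  proof -
    have "((\<lambda>t. sin (\<omega> * (1 - t)) * f t - l * (sin (\<omega> * (1 - t)) * e t)) has_integral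
       (integral {a..b} (\<lambda>t. sin (\<omega> * (1 - t)) * f t) - l * integral {a..b} (\<lambda>t. sin (\<omega> * (1 - t)) * e t))) {a..b}"
      by (intro has_integral_diff has_integral_mult_right integrable_integral wi that)
    then show ?thesis by (intro integral_unique) (simp add: algebra_simps)
  qed
  \<comment> \<open>Solvability: at \<open>c = x = 1\<close> the sine vanishes and so does
    \<open>v2 1\<close>, hence the total pairing is 0.\<close>
  have "integral {0..1/2} (\<lambda>t. sin (\<omega> * (1 - t)) * g1 t) + integral {1/2..1} (\<lambda>t. sin (\<omega> * (1 - t)) * g2 t) = 0"
    using integral_unique[OF V1[of "1/2" 1]] integral_unique[OF V2[of 1 1]] bc by simp
  then have "l * (?I1 + ?I2) = integral {0..1/2} (\<lambda>t. sin (\<omega> * (1 - t)) * f1 t)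
       + integral {1/2..1} (\<lambda>t. sin (\<omega> * (1 - t)) * f2 t)"
    unfolding g1_def g2_def sp[OF f1 ec1] sp[OF f2 ec2] by (simp add: algebra_simps)
  then have "\<bar>l\<bar> * \<bar>?I1 + ?I2\<bar> \<le> M"
    using wb[OF f1] wb[OF f2] M unfolding abs_mult[symmetric] by simp
  then have "G * (\<bar>l\<bar> * \<bar>?I1 + ?I2\<bar>) \<le> G * M" using G(1) by (rule mult_left_mono)
  moreover have "\<bar>l\<bar> * 1 \<le> \<bar>l\<bar> * (G * \<bar>?I1 + ?I2\<bar>)" by (intro mult_left_mono G(2)) auto
  ultimately show l: "\<bar>l\<bar> \<le> G * M" by (simp add: mult_ac)

  have ib: "integral {a..b} (\<lambda>x. \<bar>f x - l * e x\<bar>) \<le> integral {a..b} (\<lambda>x. \<bar>f x\<bar>) + \<bar>l\<bar> * s * (b - a)"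
    if "f absolutely_integrable_on {a..b}" "e absolutely_integrable_on {a..b}" "(\<lambda>x. f x - l * e x) absolutely_integrable_on {a..b}"
      "\<And>x. x \<in> {a..b} \<Longrightarrow> \<bar>e x\<bar> \<le> s" "a \<le> b"
    for f e :: "real \<Rightarrow> real" and a b s
  proof (rule has_integral_le)
    show "((\<lambda>x. \<bar>f x - l * e x\<bar>) has_integral integral {a..b} (\<lambda>x. \<bar>f x - l * e x\<bar>)) {a..b}"
      using that(3) by (intro integrable_integral) (simp add: absolutely_integrable_on_def)
    have "((\<lambda>x. \<bar>f x\<bar> + \<bar>l\<bar> * s) has_integral (integral {a..b} (\<lambda>x. \<bar>f x\<bar>) + (b - a) * (\<bar>l\<bar> * s))) {a..b}"
      using that(1,5) has_integral_const_real[of "\<bar>l\<bar> * s" a b]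
      by (intro has_integral_add integrable_integral) (auto simp: absolutely_integrable_on_def)
    then show "((\<lambda>x. \<bar>f x\<bar> + \<bar>l\<bar> * s) has_integral (integral {a..b} (\<lambda>x. \<bar>f x\<bar>) + \<bar>l\<bar> * s * (b - a))) {a..b}"
      by (simp add: mult_ac)
    fix x assume "x \<in> {a..b}"
    then have "\<bar>l\<bar> * \<bar>e x\<bar> \<le> \<bar>l\<bar> * s" by (intro mult_left_mono that) auto
    then show "\<bar>f x - l * e x\<bar> \<le> \<bar>f x\<bar> + \<bar>l\<bar> * s"
      using abs_triangle_ineq4[of "f x" "l * e x"] by (simp add: abs_mult)
  qed
  have "T \<le> M + \<bar>l\<bar> * ((s1 + s2) / 2)"
    using ib[OF f1 ec1 g1[unfolded g1_def] s1] ib[OF f2 ec2 g2[unfolded g2_def] s2] M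
    unfolding T_def g1_def g2_def by (simp add: algebra_simps add_divide_distrib)
  also have "\<dots> \<le> M + G * M * ((s1 + s2) / 2)"
    using l s1[of 0] s2[of 1] by (intro add_left_mono mult_right_mono) auto
  finally have T: "T \<le> (G * ((s1 + s2) / 2) + 1) * M" by (simp add: algebra_simps)
  have c: "\<omega> * (x + pi / (2 * \<omega>) - x) = pi / 2" for x using \<omega> by simp
  show "\<bar>v1 x\<bar> \<le> (G * ((s1 + s2) / 2) + 1) * M / \<omega>" "\<bar>dv1 x\<bar> \<le> (G * ((s1 + s2) / 2) + 1) * M" if "x \<in> {0..1/2}"
    using B1'[OF that, of x] B1'[OF that, of "x + pi / (2 * \<omega>)"] T \<omega> unfolding c
    by (auto simp: abs_mult pos_le_divide_eq mult.commute)
  show "\<bar>v2 x\<bar> \<le> (G * ((s1 + s2) / 2) + 1) * M / \<omega>" "\<bar>dv2 x\<bar> \<le> (G * ((s1 + s2) / 2) + 1) * M" if "x \<in> {1/2..1}"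
    using B2[OF that, of x] B2[OF that, of "x + pi / (2 * \<omega>)"] T \<omega> unfolding c
    by (auto simp: abs_mult pos_le_divide_eq mult.commute)
qed

section \<open>Convergence of the FD-method\<close>

text \<open>Throughout the tail the algebraic factor is at most its value at \<open>m + 1\<close>;
  pulling it out leaves a geometric series. This is where the exponent
  \<open>\<epsilon> = 1/2\<close> arises.\<close>

lemma tail_bound:
  fixes x :: "nat \<Rightarrow> real"
  assumes x: "\<And>n. 1 \<le> n \<Longrightarrow> \<bar>x n\<bar> \<le> a * r ^ n / (real n * sqrt (real n))"
    and a: "0 \<le> a" and r: "0 \<le> r" "r < 1"
  shows "summable (\<lambda>n. \<bar>x n\<bar>)"
    and "\<bar>(\<Sum>n. x n) - (\<Sum>n\<le>m. x n)\<bar> \<le> a / (1 - r) / real (m + 1) powr (1 + 1/2) * r ^ (m + 1)"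
proof -
  have mono: "\<bar>x n\<bar> \<le> a * r ^ n / (real m * sqrt (real m))" if "1 \<le> m" "m \<le> n" for m n
  proof -
    have "a * r ^ n / (real n * sqrt (real n)) \<le> a * r ^ n / (real m * sqrt (real m))"
      using that a r by (intro divide_left_mono mult_mono mult_pos_pos mult_nonneg_nonneg) auto
    with x[of n] that show ?thesis by simp
  qed
  have geo: "summable (\<lambda>n. a * r ^ n)" using r by (intro summable_mult summable_geometric) auto
  show s: "summable (\<lambda>n. \<bar>x n\<bar>)"
    using mono[of 1] by (intro summable_comparison_test[OF _ geo]) (auto intro!: exI[of _ 1])
  let ?w = "real (m + 1) * sqrt (real (m + 1))"
  have "(\<Sum>n. x n) - (\<Sum>n\<le>m. x n) = (\<Sum>n. x (n + Suc m))"
    using suminf_minus_initial_segment[OF summable_rabs_cancel[OF s], of "Suc m"]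
    by (simp add: lessThan_Suc_atMost)
  also have "\<bar>\<dots>\<bar> \<le> (\<Sum>n. \<bar>x (n + Suc m)\<bar>)"
    using s by (intro summable_rabs) (subst summable_iff_shift)
  also have "\<dots> \<le> (\<Sum>n. a * r ^ (m + 1) / ?w * r ^ n)"
  proof (rule suminf_le)
    show "\<bar>x (n + Suc m)\<bar> \<le> a * r ^ (m + 1) / ?w * r ^ n" for n
      using mono[of "m + 1" "n + Suc m"] by (simp add: power_add mult_ac)
    show "summable (\<lambda>n. \<bar>x (n + Suc m)\<bar>)" using s by (subst summable_iff_shift)
    show "summable (\<lambda>n. a * r ^ (m + 1) / ?w * r ^ n)"
      using r by (intro summable_mult summable_geometric) auto
  qed
  also have "\<dots> = a * r ^ (m + 1) / ?w * (1 / (1 - r))"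
    using r by (subst suminf_mult) (auto simp: suminf_geometric summable_geometric)
  also have "?w = real (m + 1) powr (1 + 1/2)"
    by (simp only: powr_add powr_half_sqrt[OF of_nat_0_le_iff]) simp
  finally show "\<bar>(\<Sum>n. x n) - (\<Sum>n\<le>m. x n)\<bar> \<le> a / (1 - r) / real (m + 1) powr (1 + 1/2) * r ^ (m + 1)"
    by (simp add: mult_ac)
qed

section \<open>Summing the corrections to a solution of the nonlinear equation\<close>

context majorized
begin

lemma continuous_on_adomian:
  assumes "\<And>p. p \<le> j \<Longrightarrow> continuous_on S (u p)"
  shows "continuous_on S (\<lambda>x. adomian N j (\<lambda>p. u p x))"
proof -
  have "continuous_on UNIV ((deriv ^^ k) N)" for k
    using N_DERIV by (intro continuous_at_imp_continuous_on ballI) (rule DERIV_isCont)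
  then have "continuous_on S (\<lambda>x. (deriv ^^ k) N (u 0 x))" for k
    by (rule continuous_on_compose2) (use assms in auto)
  then show ?thesis
    unfolding adomian_def using assms by (intro continuous_intros) auto
qed

text \<open>The first derivative is summed by uniform convergence. The integrated equation needs
  dominated convergence, because the terms with \<open>q\<close> are not uniformly bounded.\<close>

lemma ode_sol_series:
  fixes u du :: "nat \<Rightarrow> real \<Rightarrow> real" and lam Ub Db Lb Ab :: "nat \<Rightarrow> real"
  assumes ab: "a \<le> b"
    and sol0: "ode_sol a b (lam 0) (u 0) (du 0) (\<lambda>_. 0)"
    and solS: "\<And>j. ode_sol a b (lam 0) (u (Suc j)) (du (Suc j))
       (\<lambda>x. - (\<Sum>p\<le>j. lam (Suc j - p) * u p x) + q x * u j x + adomian N j (\<lambda>p. u p x))"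
    and q: "q absolutely_integrable_on {a..b}"
    and Ub: "\<And>j x. x \<in> {a..b} \<Longrightarrow> \<bar>u j x\<bar> \<le> Ub j" "summable Ub"
    and Db: "\<And>j x. x \<in> {a..b} \<Longrightarrow> \<bar>du j x\<bar> \<le> Db j" "summable Db"
    and Lb: "\<And>j. \<bar>lam j\<bar> \<le> Lb j" "summable Lb"
    and Ab: "\<And>j x. x \<in> {a..b} \<Longrightarrow> \<bar>adomian N j (\<lambda>p. u p x)\<bar> \<le> Ab j" "summable Ab"
  shows "ode_sol a b (\<Sum>j. lam j) (\<lambda>x. \<Sum>j. u j x) (\<lambda>x. \<Sum>j. du j x)
     (\<lambda>x. q x * (\<Sum>j. u j x) + N (\<Sum>j. u j x))"
proof -
  have sol: "ode_sol a b (lam 0) (u j) (du j) (\<lambda>x. case j of 0 \<Rightarrow> 0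
      | Suc i \<Rightarrow> - (\<Sum>p\<le>i. lam (Suc i - p) * u p x) + q x * u i x + adomian N i (\<lambda>p. u p x))" for j
    using sol0 solS by (cases j) auto
  have us: "summable (\<lambda>j. \<bar>u j x\<bar>)" if "x \<in> {a..b}" for x
    by (rule summable_comparison_test[OF _ Ub(2)]) (use Ub(1)[OF that] in auto)
  have dus: "summable (\<lambda>j. du j x)" if "x \<in> {a..b}" for x
    by (rule summable_comparison_test[OF _ Db(2)]) (use Db(1)[OF that] in auto)
  have ls: "summable (\<lambda>j. \<bar>lam j\<bar>)"
    by (rule summable_comparison_test[OF _ Lb(2)]) (use Lb(1) in auto)
  have D: "((\<lambda>x. \<Sum>j. u j x) has_real_derivative (\<Sum>j. du j x)) (at x within {a..b})" if x: "x \<in> {a..b}" for x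
  proof -
    have "\<exists>g. \<forall>x\<in>{a..b}. (\<lambda>n. u n x) sums g x \<and> (g has_real_derivative (\<Sum>j. du j x)) (at x within {a..b})"
    proof (rule has_field_derivative_series)
      show "(u n has_real_derivative du n x) (at x within {a..b})" if "x \<in> {a..b}" for n x
        using sol[of n] that by (simp add: ode_sol_def)
      show "uniform_limit {a..b} (\<lambda>n x. \<Sum>i<n. du i x) (\<lambda>x. \<Sum>j. du j x) sequentially"
        using Db by (intro Weierstrass_m_test) auto
      show "x \<in> {a..b}" by (rule x)
      show "summable (\<lambda>n. u n x)" by (rule summable_rabs_cancel[OF us[OF x]])
    qed auto
    then obtain g where g: "\<And>x. x \<in> {a..b} \<Longrightarrow> (\<lambda>n. u n x) sums g x"
      "\<And>x. x \<in> {a..b} \<Longrightarrow> (g has_real_derivative (\<Sum>j. du j x)) (at x within {a..b})" by blast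
    show ?thesis
      by (rule has_field_derivative_transform_within[OF g(2)[OF x] zero_less_one x])
         (rule sums_unique[OF g(1)])
  qed
  \<comment> \<open>Moving \<open>lam 0 * u j\<close> to the right-hand side completes the sum over
    \<open>p\<close> to a full Cauchy product coefficient, so the series of the \<open>h j\<close>
    produces the product of the eigenvalue and the eigenfunction.\<close>
  define h where "h j x = - (\<Sum>p\<le>j. u p x * lam (j - p)) +
     (case j of 0 \<Rightarrow> 0 | Suc i \<Rightarrow> q x * u i x + adomian N i (\<lambda>p. u p x))" for j x
  have hint: "(h j has_integral (du j x - du j a)) {a..x}" if x: "x \<in> {a..b}" for j x
  proof -
    have "h j = (\<lambda>t. (case j of 0 \<Rightarrow> 0
      | Suc i \<Rightarrow> - (\<Sum>p\<le>i. lam (Suc i - p) * u p t) + q t * u i t + adomian N i (\<lambda>p. u p t)) - lam 0 * u j t)"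
      by (rule ext) (simp add: h_def mult.commute split: nat.split)
    then show ?thesis using sol[of j] x by (simp add: ode_sol_def)
  qed
  define cb where "cb j = (\<Sum>p\<le>j. Ub p * Lb (j - p))" for j
  have nn: "0 \<le> Ub j" "0 \<le> Lb j" "0 \<le> Ab j" for j
    using Ub(1)[of a j] Lb(1)[of j] Ab(1)[of a j] ab by (auto intro: order.trans[OF abs_ge_zero])
  have cbs: "summable cb" unfolding cb_def
    using Cauchy_product_sums[of Ub Lb] Ub(2) Lb(2) nn by (simp add: sums_iff)
  define K where "K x = (\<Sum>j. cb j) + (\<bar>q x\<bar> * (\<Sum>j. Ub j) + (\<Sum>j. Ab j))" for x
  have part: "\<bar>\<Sum>j<n. h j x\<bar> \<le> K x" if x: "x \<in> {a..b}" for n x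
  proof -
    let ?T = "\<lambda>j. case j of 0 \<Rightarrow> 0 | Suc i \<Rightarrow> \<bar>q x\<bar> * Ub i + Ab i"
    have le: "\<bar>h j x\<bar> \<le> cb j + ?T j" for j
    proof -
      have "\<bar>\<Sum>p\<le>j. u p x * lam (j - p)\<bar> \<le> cb j"
        unfolding cb_def using Ub(1)[OF x] Lb(1)
        by (intro order.trans[OF sum_abs] sum_mono) (auto simp: abs_mult intro!: mult_mono nn)
      moreover have "\<bar>case j of 0 \<Rightarrow> 0 | Suc i \<Rightarrow> q x * u i x + adomian N i (\<lambda>p. u p x)\<bar> \<le> ?T j"
      proof (cases j)
        case (Suc i)
        have "\<bar>q x * u i x\<bar> \<le> \<bar>q x\<bar> * Ub i"
          unfolding abs_mult by (intro mult_left_mono Ub(1)[OF x]) auto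
        then show ?thesis using Suc Ab(1)[OF x, of i] by simp
      qed simp
      ultimately show ?thesis unfolding h_def by linarith
    qed
    have Ts: "summable ?T"
    proof (subst summable_Suc_iff[symmetric])
      show "summable (\<lambda>j. ?T (Suc j))" using Ub(2) Ab(2) by (simp add: summable_add summable_mult)
    qed
    have "\<bar>\<Sum>j<n. h j x\<bar> \<le> (\<Sum>j<n. cb j + ?T j)"
      by (intro order.trans[OF sum_abs] sum_mono le)
    also have "\<dots> \<le> (\<Sum>j. cb j + ?T j)"
      using nn by (intro sum_le_suminf summable_add cbs Ts)
        (auto simp: cb_def intro!: add_nonneg_nonneg sum_nonneg mult_nonneg_nonneg split: nat.split)
    also have "\<dots> = (\<Sum>j. cb j) + (\<Sum>j. ?T j)" by (rule suminf_add[OF cbs Ts, symmetric])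
    also have "(\<Sum>j. ?T j) = (\<Sum>j. ?T (Suc j))" using suminf_split_head[OF Ts] by simp
    also have "\<dots> = \<bar>q x\<bar> * (\<Sum>j. Ub j) + (\<Sum>j. Ab j)"
      using Ub(2) Ab(2) by (simp add: suminf_add[symmetric] suminf_mult summable_mult)
    finally show ?thesis by (simp add: K_def)
  qed
  have lim: "(\<lambda>n. \<Sum>j<n. h j x) \<longlonglongrightarrow> q x * (\<Sum>j. u j x) + N (\<Sum>j. u j x) - (\<Sum>j. lam j) * (\<Sum>j. u j x)"
    if x: "x \<in> {a..b}" for x
  proof -
    have "(\<lambda>j. \<Sum>p\<le>j. u p x * lam (j - p)) sums ((\<Sum>j. u j x) * (\<Sum>j. lam j))"
      by (rule Cauchy_product_sums) (use us[OF x] ls in auto)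
    moreover have "(\<lambda>j. case j of 0 \<Rightarrow> 0 | Suc i \<Rightarrow> q x * u i x + adomian N i (\<lambda>p. u p x)) sums
        (q x * (\<Sum>j. u j x) + N (\<Sum>j. u j x))"
    proof -
      have "(\<lambda>i. q x * u i x + adomian N i (\<lambda>p. u p x)) sums (q x * (\<Sum>j. u j x) + N (\<Sum>j. u j x))"
        by (intro sums_add sums_mult summable_sums[OF summable_rabs_cancel[OF us[OF x]]] adomian_sums us x)
      then show ?thesis
        using sums_Suc[of "\<lambda>j. case j of 0 \<Rightarrow> 0 | Suc i \<Rightarrow> q x * u i x + adomian N i (\<lambda>p. u p x)"] by simp
    qed
    ultimately have "(\<lambda>j. h j x) sums (- ((\<Sum>j. u j x) * (\<Sum>j. lam j)) + (q x * (\<Sum>j. u j x) + N (\<Sum>j. u j x)))"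
      unfolding h_def by (intro sums_add sums_minus)
    then show ?thesis by (simp add: sums_def algebra_simps)
  qed
  have "((\<lambda>t. q t * (\<Sum>j. u j t) + N (\<Sum>j. u j t) - (\<Sum>j. lam j) * (\<Sum>j. u j t)) has_integral
     ((\<Sum>j. du j x) - (\<Sum>j. du j a))) {a..x}" if x: "x \<in> {a..b}" for x
  proof (rule has_integral_dominated_convergence)
    show "((\<lambda>t. \<Sum>j<n. h j t) has_integral (\<Sum>j<n. du j x - du j a)) {a..x}" for n
      by (intro has_integral_sum hint x) auto
    have "(\<lambda>t. \<bar>q t\<bar>) integrable_on {a..b}" using q by (simp add: absolutely_integrable_on_def)
    then have "(\<lambda>t. \<bar>q t\<bar>) integrable_on {a..x}"
      by (rule integrable_on_subinterval) (use x in auto)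
    then show "K integrable_on {a..x}"
      unfolding K_def by (intro integrable_add integrable_on_mult_left integrable_const_ivl)
    show "\<forall>t\<in>{a..x}. norm (\<Sum>j<n. h j t) \<le> K t" for n using part x by auto
    show "\<forall>t\<in>{a..x}. (\<lambda>n. \<Sum>j<n. h j t) \<longlonglongrightarrow>
       q t * (\<Sum>j. u j t) + N (\<Sum>j. u j t) - (\<Sum>j. lam j) * (\<Sum>j. u j t)"
      using lim x by auto
    show "(\<lambda>n. \<Sum>j<n. du j x - du j a) \<longlonglongrightarrow> (\<Sum>j. du j x) - (\<Sum>j. du j a)"
      using sums_diff[OF summable_sums[OF dus[OF x]] summable_sums[OF dus[of a]]] ab by (simp add: sums_def)
  qed
  with D show ?thesis unfolding ode_sol_def by blast
qed

end

text \<open>With \<open>M\<^sub>j\<close> the \<open>L\<^sub>1\<close> norm of the part of \<open>F\<^sup>(\<^sup>j\<^sup>+\<^sup>1\<^sup>)\<close> not involving \<open>\<lambda>\<^sup>(\<^sup>j\<^sup>+\<^sup>1\<^sup>)\<close>, the linear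
  problem yields \<open>\<bar>\<lambda>\<^sup>(\<^sup>j\<^sup>+\<^sup>1\<^sup>)\<bar> \<le> G M\<^sub>j\<close> and \<open>\<bar>u\<^sup>(\<^sup>j\<^sup>+\<^sup>1\<^sup>)\<bar> \<le> D M\<^sub>j\<close>; the last five assumptions are what
  is needed to propagate \<open>M\<^sub>j \<le> \<theta> \<kappa>\<^sup>j\<^sup>+\<^sup>1 vb\<^sub>j\<^sub>+\<^sub>1\<close> by induction.\<close>
locale fd_method = majorant_sequence N Nbar vb "integral {0..1} (\<lambda>x. \<bar>q x\<bar>)"
  for N Nbar :: "real \<Rightarrow> real" and vb :: "nat \<Rightarrow> real" and q :: "real \<Rightarrow> real" +
  fixes lam :: "nat \<Rightarrow> real" and u1 u2 :: "nat \<Rightarrow> real \<Rightarrow> real"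
    and \<omega> \<kappa> G \<theta> s1 s2 :: real and D :: real
  defines "D \<equiv> (G * ((s1 + s2) / 2) + 1) / \<omega>"
  assumes q_L1: "q absolutely_integrable_on {0..1}"
    and N_zero: "N 0 = 0"
    and R_pos: "0 < conv_radius vb" and rate: "\<kappa> * Rinv vb < 1"
    and FD: "FD_seq q N lam u1 u2"
    and lam0: "lam 0 = \<omega>\<^sup>2"
    and trial: "nl_eigensol (\<lambda>_. 0) (\<lambda>_. 0) (\<omega>\<^sup>2) (u1 0) (u2 0)"
    and s1: "\<And>x. x \<in> {0..1/2} \<Longrightarrow> \<bar>u1 0 x\<bar> \<le> s1" and s2: "\<And>x. x \<in> {1/2..1} \<Longrightarrow> \<bar>u2 0 x\<bar> \<le> s2"
    and G: "1 \<le> G * \<bar>integral {0..1/2} (\<lambda>t. sin (\<omega> * (1 - t)) * u1 0 t)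
                    + integral {1/2..1} (\<lambda>t. sin (\<omega> * (1 - t)) * u2 0 t)\<bar>"
    and pos: "0 < \<omega>" "0 < \<kappa>" "0 < \<theta>" "0 \<le> G"
    and GD: "G * D * \<theta> \<le> 1" and D\<kappa>: "D \<le> 11/3 * \<kappa>" and D\<theta>: "D * \<theta> \<le> 1"
    and s\<kappa>: "max s1 s2 \<le> 88/9 * \<theta> * \<kappa>" and s_le: "max s1 s2 \<le> 8/3"
begin

section \<open>Inductive bounds for the corrections\<close>

abbreviation "Qn \<equiv> integral {0..1} (\<lambda>x. \<bar>q x\<bar>)"

text \<open>Index 0 is exceptional because the trial function has its own size, unrelated to
  \<open>D * \<theta> * vb 0\<close>.\<close>

definition U :: "nat \<Rightarrow> real" where
  "U j = (if j = 0 then max s1 s2 else D * \<theta> * \<kappa> ^ j * vb j)"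

definition \<Lambda> :: "nat \<Rightarrow> real" where
  "\<Lambda> j = (if j = 0 then \<omega>\<^sup>2 else G * \<theta> * \<kappa> ^ j * vb j)"

text \<open>For \<open>j = 0\<close> the mean value theorem and \<open>N 0 = 0\<close> give a bound
  proportional to the trial function, matching the term \<open>deriv Nbar (vb 0) * vb 0\<close> in
  \<open>vb 1\<close>.\<close>

definition adomian_majorant :: "nat \<Rightarrow> real" where
  "adomian_majorant j = (if j = 0 then max s1 s2 * deriv Nbar (8/3) else D * \<theta> * \<kappa> ^ j * adomian Nbar j vb)"

lemma s_nonneg: "0 \<le> s1" "0 \<le> s2"
  using s1[of 0] s2[of 1] by auto

lemma D_nonneg: "0 \<le> D"
  unfolding D_def using s_nonneg pos by simp

lemma adomian_majorant_bound:
  assumes "\<And>p. p \<le> j \<Longrightarrow> \<bar>w p\<bar> \<le> U p"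
  shows "\<bar>adomian N j w\<bar> \<le> adomian_majorant j"
proof (cases "j = 0")
  case True
  have w: "\<bar>w 0\<bar> \<le> max s1 s2" using assms[of 0] by (simp add: U_def)
  have "norm (N (w 0) - N 0) \<le> deriv Nbar (8/3) * norm (w 0 - 0)"
  proof (rule field_differentiable_bound[of "{-(8/3)..8/3}" N "deriv N"])
    show "(N has_field_derivative deriv N z) (at z within {-(8/3)..8/3})" for z
      using N_DERIV[of 0 z] by (auto intro: has_field_derivative_at_within)
    show "norm (deriv N z) \<le> deriv Nbar (8/3)" if "z \<in> {-(8/3)..8/3}" for z
      using N_bound[of z "8/3" 1] that by auto
  qed (use w s_le in \<open>auto simp: convex_real_interval\<close>)
  also have "\<dots> \<le> deriv Nbar (8/3) * max s1 s2"
    using w Nbar_nonneg[of "8/3" 1] by (intro mult_left_mono) auto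
  finally show ?thesis
    using True N_zero by (simp add: adomian_eq adomian_majorant_def mult.commute)
next
  case False
  have "\<bar>adomian N j w\<bar> \<le> D * \<theta> * \<kappa> ^ j * adomian Nbar j vb"
  proof (rule adomian_scaled_bound)
    show "\<bar>w 0\<bar> \<le> vb 0" using assms[of 0] s_le by (simp add: U_def vb0)
    show "\<bar>w i\<bar> \<le> D * \<theta> * \<kappa> ^ i * vb i" if "1 \<le> i" "i \<le> j" for i
      using assms[of i] that by (simp add: U_def)
  qed (use D_nonneg D\<theta> pos vb_nonneg False in auto)
  then show ?thesis using False by (simp add: adomian_majorant_def)
qed

lemma q_sub:
  assumes "{a..b} \<subseteq> {0..1}"
  shows "q absolutely_integrable_on {a..b}" "(\<lambda>x. \<bar>q x\<bar>) integrable_on {a..b}"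
  using absolutely_integrable_on_subinterval[OF q_L1 assms] by (auto simp: absolutely_integrable_on_def)

text \<open>The sum starts at \<open>p = 1\<close>: the term \<open>p = 0\<close> contains the
  unknown \<open>lam (Suc j)\<close>, which solvability determines.\<close>

lemma forcing_bound:
  fixes u :: "nat \<Rightarrow> real \<Rightarrow> real"
  defines "f j x \<equiv> - (\<Sum>p=1..j. lam (Suc j - p) * u p x) + q x * u j x + adomian N j (\<lambda>p. u p x)"
  assumes ab: "a \<le> b" "{a..b} \<subseteq> {0..1}"
    and cont: "\<And>p. p \<le> j \<Longrightarrow> continuous_on {a..b} (u p)"
    and u: "\<And>p x. p \<le> j \<Longrightarrow> x \<in> {a..b} \<Longrightarrow> \<bar>u p x\<bar> \<le> U p"
    and lam: "\<And>i. 1 \<le> i \<Longrightarrow> i \<le> j \<Longrightarrow> \<bar>lam i\<bar> \<le> \<Lambda> i"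
  shows "f j absolutely_integrable_on {a..b}"
    and "integral {a..b} (\<lambda>x. \<bar>f j x\<bar>) \<le> (b - a) * ((\<Sum>p=1..j. \<Lambda> (Suc j - p) * U p) + adomian_majorant j)
           + U j * integral {a..b} (\<lambda>x. \<bar>q x\<bar>)"
proof -
  have "(\<lambda>x. - (\<Sum>p=1..j. lam (Suc j - p) * u p x) + adomian N j (\<lambda>p. u p x)) absolutely_integrable_on {a..b}"
    by (intro absolutely_integrable_continuous_real continuous_intros continuous_on_adomian cont) auto
  moreover have "(\<lambda>x. u j x * q x) absolutely_integrable_on {a..b}"
    by (intro absolutely_integrable_continuous_mult cont q_sub ab) auto
  ultimately have "(\<lambda>x. (- (\<Sum>p=1..j. lam (Suc j - p) * u p x) + adomian N j (\<lambda>p. u p x)) + u j x * q x)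
      absolutely_integrable_on {a..b}"
    by (rule set_integral_add(1))
  moreover have "f j = (\<lambda>x. (- (\<Sum>p=1..j. lam (Suc j - p) * u p x) + adomian N j (\<lambda>p. u p x)) + u j x * q x)"
    by (simp add: f_def fun_eq_iff mult.commute)
  ultimately show fa: "f j absolutely_integrable_on {a..b}" by simp
  let ?S = "(\<Sum>p=1..j. \<Lambda> (Suc j - p) * U p) + adomian_majorant j"
  show "integral {a..b} (\<lambda>x. \<bar>f j x\<bar>) \<le> (b - a) * ?S + U j * integral {a..b} (\<lambda>x. \<bar>q x\<bar>)"
  proof (rule has_integral_le)
    show "((\<lambda>x. \<bar>f j x\<bar>) has_integral integral {a..b} (\<lambda>x. \<bar>f j x\<bar>)) {a..b}"
      using fa by (intro integrable_integral) (simp add: absolutely_integrable_on_def)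
    show "((\<lambda>x. ?S + U j * \<bar>q x\<bar>) has_integral ((b - a) * ?S + U j * integral {a..b} (\<lambda>x. \<bar>q x\<bar>))) {a..b}"
      using has_integral_const_real[of ?S a b] ab
      by (intro has_integral_add has_integral_mult_right integrable_integral q_sub) auto
    fix x assume x: "x \<in> {a..b}"
    have "\<bar>\<Sum>p=1..j. lam (Suc j - p) * u p x\<bar> \<le> (\<Sum>p=1..j. \<Lambda> (Suc j - p) * U p)"
      by (intro order.trans[OF sum_abs] sum_mono)
         (auto simp: abs_mult intro!: mult_mono lam u x order.trans[OF abs_ge_zero lam])
    moreover have "\<bar>q x * u j x\<bar> \<le> U j * \<bar>q x\<bar>"
      using u[of j x] x by (simp add: abs_mult mult.commute mult_left_mono)
    moreover have "\<bar>adomian N j (\<lambda>p. u p x)\<bar> \<le> adomian_majorant j"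
      by (rule adomian_majorant_bound) (use u x in auto)
    ultimately show "\<bar>f j x\<bar> \<le> ?S + U j * \<bar>q x\<bar>" unfolding f_def by linarith
  qed
qed

text \<open>The locale constants mirror the recursion: \<open>11/3 = 1 + vb 0\<close> and
  \<open>88/9 = (1 + vb 0) * vb 0\<close>. The condition on \<open>G * D * \<theta>\<close> absorbs
  the convolution, \<open>D \<le> 11/3 * \<kappa>\<close> the terms with \<open>q\<close> and the
  Adomian polynomial, and the bound on \<open>max s1 s2\<close> settles
  \<open>j = 0\<close>.\<close>

lemma majorant_step:
  "(\<Sum>p=1..j. \<Lambda> (Suc j - p) * U p) + adomian_majorant j + U j * Qn \<le> \<theta> * \<kappa> ^ Suc j * vb (Suc j)"
proof (cases "j = 0")
  case True
  have "max s1 s2 * (Qn + deriv Nbar (8/3)) \<le> 88/9 * \<theta> * \<kappa> * (Qn + deriv Nbar (8/3))"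
    using Q Nbar_nonneg[of "8/3" 1] by (intro mult_right_mono s\<kappa>) auto
  then show ?thesis using True vb1[unfolded One_nat_def]
    by (simp add: adomian_majorant_def U_def vb0 algebra_simps)
next
  case False
  then have j: "1 \<le> j" by simp
  have "(\<Sum>p=1..j. \<Lambda> (Suc j - p) * U p) = (\<Sum>p=1..j. (G * D * \<theta>) * (\<theta> * \<kappa> ^ Suc j) * (vb (Suc j - p) * vb p))"
  proof (intro sum.cong refl)
    fix p assume p: "p \<in> {1..j}"
    then have "\<kappa> ^ Suc j = \<kappa> ^ (Suc j - p) * \<kappa> ^ p" by (simp flip: power_add)
    with p show "\<Lambda> (Suc j - p) * U p = (G * D * \<theta>) * (\<theta> * \<kappa> ^ Suc j) * (vb (Suc j - p) * vb p)"
      by (auto simp: \<Lambda>_def U_def)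
  qed
  also have "\<dots> \<le> (\<Sum>p=1..j. 1 * (\<theta> * \<kappa> ^ Suc j) * (vb (Suc j - p) * vb p))"
    using GD pos vb_nonneg by (intro sum_mono mult_right_mono mult_nonneg_nonneg) auto
  also have "\<dots> = \<theta> * \<kappa> ^ Suc j * (\<Sum>p=1..j. vb (Suc j - p) * vb p)"
    by (simp add: sum_distrib_left)
  finally have 1: "(\<Sum>p=1..j. \<Lambda> (Suc j - p) * U p) \<le> \<theta> * \<kappa> ^ Suc j * (\<Sum>p=1..j. vb (Suc j - p) * vb p)" .
  have "0 \<le> adomian Nbar j vb"
    unfolding adomian_def using Nbar_nonneg[of "vb 0"] vb_nonneg
    by (intro sum_nonneg mult_nonneg_nonneg prod_nonneg) (auto simp: vb0)
  then have "D * (\<theta> * \<kappa> ^ j * (adomian Nbar j vb + vb j * Qn))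
      \<le> 11/3 * \<kappa> * (\<theta> * \<kappa> ^ j * (adomian Nbar j vb + vb j * Qn))"
    using pos vb_nonneg Q by (intro mult_right_mono D\<kappa> mult_nonneg_nonneg add_nonneg_nonneg) auto
  then have 2: "adomian_majorant j + U j * Qn \<le> \<theta> * \<kappa> ^ Suc j * (11/3 * (Qn * vb j + adomian Nbar j vb))"
    using False by (simp add: adomian_majorant_def U_def algebra_simps)
  have "vb (Suc j) = (\<Sum>p=1..j. vb (Suc j - p) * vb p) + 11/3 * (Qn * vb j + adomian Nbar j vb)"
    using vbSuc j by (simp add: vb0)
  then have "\<theta> * \<kappa> ^ Suc j * vb (Suc j) = \<theta> * \<kappa> ^ Suc j * (\<Sum>p=1..j. vb (Suc j - p) * vb p)
      + \<theta> * \<kappa> ^ Suc j * (11/3 * (Qn * vb j + adomian Nbar j vb))"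
    by (simp only: distrib_left)
  with 1 2 show ?thesis by linarith
qed

definition within_majorant :: "nat \<Rightarrow> bool" where
  "within_majorant j \<longleftrightarrow> continuous_on {0..1/2} (u1 j) \<and> continuous_on {1/2..1} (u2 j)
     \<and> (\<forall>x\<in>{0..1/2}. \<bar>u1 j x\<bar> \<le> U j) \<and> (\<forall>x\<in>{1/2..1}. \<bar>u2 j x\<bar> \<le> U j) \<and> \<bar>lam j\<bar> \<le> \<Lambda> j"

lemma ode_sol_continuous: "ode_sol a b \<mu> u du g \<Longrightarrow> continuous_on {a..b} u"
  unfolding ode_sol_def by (rule DERIV_continuous_on) auto

lemma within_majorant_0: "within_majorant 0"
proof -
  have "continuous_on {0..1/2} (u1 0)" "continuous_on {1/2..1} (u2 0)"
    using trial unfolding nl_eigensol_def by (auto intro: ode_sol_continuous)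
  then show ?thesis
    using s1 s2 lam0 by (force simp: within_majorant_def U_def \<Lambda>_def)
qed

text \<open>The derivatives are named together with their bounds so that they can be chosen as
  sequences and summed.\<close>

definition correction_sol :: "nat \<Rightarrow> (real \<Rightarrow> real) \<Rightarrow> (real \<Rightarrow> real) \<Rightarrow> bool" where
  "correction_sol j d1 d2 \<longleftrightarrow>
       ode_sol 0 (1/2) (lam 0) (u1 (Suc j)) d1
         (\<lambda>x. - (\<Sum>p\<le>j. lam (Suc j - p) * u1 p x) + q x * u1 j x + adomian N j (\<lambda>p. u1 p x)) \<and>
       ode_sol (1/2) 1 (lam 0) (u2 (Suc j)) d2
         (\<lambda>x. - (\<Sum>p\<le>j. lam (Suc j - p) * u2 p x) + q x * u2 j x + adomian N j (\<lambda>p. u2 p x)) \<and>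
       u1 (Suc j) 0 = 0 \<and> u2 (Suc j) 1 = 0 \<and> d1 0 = 0 \<and>
       u2 (Suc j) (1/2) - u1 (Suc j) (1/2) = 0 \<and> d2 (1/2) - d1 (1/2) = 0 \<and>
       (\<forall>x\<in>{0..1/2}. \<bar>d1 x\<bar> \<le> \<omega> * U (Suc j)) \<and> (\<forall>x\<in>{1/2..1}. \<bar>d2 x\<bar> \<le> \<omega> * U (Suc j))"

lemma fd_step:
  assumes g: "\<And>p. p \<le> j \<Longrightarrow> within_majorant p"
  shows "within_majorant (Suc j)"
    and "\<exists>d1 d2. correction_sol j d1 d2"
proof -
  obtain d1 d2 where
    sol1: "ode_sol 0 (1/2) (lam 0) (u1 (Suc j)) d1
         (\<lambda>x. - (\<Sum>p\<le>j. lam (Suc j - p) * u1 p x) + q x * u1 j x + adomian N j (\<lambda>p. u1 p x))" and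
    sol2: "ode_sol (1/2) 1 (lam 0) (u2 (Suc j)) d2
         (\<lambda>x. - (\<Sum>p\<le>j. lam (Suc j - p) * u2 p x) + q x * u2 j x + adomian N j (\<lambda>p. u2 p x))" and
    bc: "u1 (Suc j) 0 = 0" "u2 (Suc j) 1 = 0" "d1 0 = 0"
       "u2 (Suc j) (1/2) - u1 (Suc j) (1/2) = 0" "d2 (1/2) - d1 (1/2) = 0"
    using FD[unfolded FD_seq_def, rule_format, of j] by blast
  define f where "f u x = - (\<Sum>p=1..j. lam (Suc j - p) * u p x) + q x * u j x + adomian N j (\<lambda>p. u p x)"
    for u :: "nat \<Rightarrow> real \<Rightarrow> real" and x
  have fe: "(\<lambda>x. - (\<Sum>p\<le>j. lam (Suc j - p) * u p x) + q x * u j x + adomian N j (\<lambda>p. u p x))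
      = (\<lambda>x. f u x - lam (Suc j) * u 0 x)" for u :: "nat \<Rightarrow> real \<Rightarrow> real"
    by (simp add: f_def atMost_atLeast0 sum.atLeast_Suc_atMost algebra_simps fun_eq_iff)
  let ?M = "\<theta> * \<kappa> ^ Suc j * vb (Suc j)"
  let ?S = "(\<Sum>p=1..j. \<Lambda> (Suc j - p) * U p) + adomian_majorant j"
  have F1: "f u1 absolutely_integrable_on {0..1/2}"
    "integral {0..1/2} (\<lambda>x. \<bar>f u1 x\<bar>) \<le> 1/2 * ?S + U j * integral {0..1/2} (\<lambda>x. \<bar>q x\<bar>)"
    using forcing_bound[of 0 "1/2" j u1] g unfolding f_def by (auto simp: within_majorant_def)
  have F2: "f u2 absolutely_integrable_on {1/2..1}"
    "integral {1/2..1} (\<lambda>x. \<bar>f u2 x\<bar>) \<le> 1/2 * ?S + U j * integral {1/2..1} (\<lambda>x. \<bar>q x\<bar>)"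
    using forcing_bound[of "1/2" 1 j u2] g unfolding f_def by (auto simp: within_majorant_def)
  have "integral {0..1/2} (\<lambda>x. \<bar>q x\<bar>) + integral {1/2..1} (\<lambda>x. \<bar>q x\<bar>) = Qn"
    by (rule Henstock_Kurzweil_Integration.integral_combine) (use q_sub[of 0 1] in auto)
  then have "U j * integral {0..1/2} (\<lambda>x. \<bar>q x\<bar>) + U j * integral {1/2..1} (\<lambda>x. \<bar>q x\<bar>) = U j * Qn"
    by (simp flip: distrib_left)
  then have M: "integral {0..1/2} (\<lambda>x. \<bar>f u1 x\<bar>) + integral {1/2..1} (\<lambda>x. \<bar>f u2 x\<bar>) \<le> ?M"
  proof -
    have "x + y \<le> m" if "x \<le> 1/2 * S + a" "y \<le> 1/2 * S + b" "a + b = c" "S + c \<le> m" for x y S a b c m :: real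
      using that by linarith
    then show ?thesis using F1(2) F2(2) majorant_step[of j] \<open>_ = U j * Qn\<close> by blast
  qed
  have c0: "continuous_on {0..1/2} (u1 0)" "continuous_on {1/2..1} (u2 0)"
    using within_majorant_0 by (auto simp: within_majorant_def)
  note cb = correction_bound[OF pos(1) sol1[unfolded fe lam0] sol2[unfolded fe lam0] bc(1-3)
      bc(4)[unfolded right_minus_eq] bc(5)[unfolded right_minus_eq] F1(1) F2(1) c0 s1 s2 M pos(4) G]
  have U: "(G * ((s1 + s2) / 2) + 1) * ?M / \<omega> = U (Suc j)" "(G * ((s1 + s2) / 2) + 1) * ?M = \<omega> * U (Suc j)"
    using pos(1) by (auto simp: U_def D_def)
  have "\<bar>lam (Suc j)\<bar> \<le> \<Lambda> (Suc j)" using cb(1) by (simp add: \<Lambda>_def mult.assoc)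
  then show "within_majorant (Suc j)"
    using pos(1) cb(2,4) sol1 sol2 unfolding U by (auto simp: within_majorant_def intro: ode_sol_continuous)
  show "\<exists>d1 d2. correction_sol j d1 d2"
    unfolding correction_sol_def using sol1 sol2 bc cb(3,5) unfolding U by blast
qed

lemma within_majorant_all: "within_majorant j"
proof (induction j rule: less_induct)
  case (less j)
  then show ?case using within_majorant_0 fd_step(1)[of "j - 1"] by (cases j) (auto simp: less_Suc_eq_le)
qed


lemma Rinv_nonneg: "0 \<le> Rinv vb"
  unfolding Rinv_def by (intro real_of_ereal_pos) (use R_pos in \<open>simp add: ereal_inverse_nonneg_iff less_imp_le\<close>)

lemma scaled_majorant:
  obtains C where "0 \<le> C" "\<And>n. 1 \<le> n \<Longrightarrow> \<kappa> ^ n * vb n \<le> C * (\<kappa> * Rinv vb) ^ n / (real n * sqrt (real n))"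
proof -
  obtain C where C: "0 \<le> C" "\<And>n. 1 \<le> n \<Longrightarrow> vb n \<le> C * Rinv vb ^ n / (real n * sqrt (real n))"
    using vb_growth[OF R_pos] by blast
  have "\<kappa> ^ n * vb n \<le> C * (\<kappa> * Rinv vb) ^ n / (real n * sqrt (real n))" if "1 \<le> n" for n
    using mult_left_mono[OF C(2)[OF that], of "\<kappa> ^ n"] pos by (simp add: power_mult_distrib mult_ac)
  with C(1) show ?thesis using that by blast
qed

text \<open>The majorants become geometric bounds with an extra factor of order
  \<open>n^(-3/2)\<close>, so all series converge absolutely. Boundary and jump values come from the
  trial eigenpair alone, since the corrections satisfy homogeneous conditions.\<close>

lemma fd_convergence:
  defines "r \<equiv> \<kappa> * Rinv vb"
  shows "\<exists>L U1 U2. lam sums L \<and>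
         (\<forall>x\<in>{0..1/2}. (\<lambda>j. u1 j x) sums U1 x) \<and>
         (\<forall>x\<in>{1/2..1}. (\<lambda>j. u2 j x) sums U2 x) \<and>
         nl_eigensol q N L U1 U2 \<and>
         (\<exists>K>0. \<forall>m.
            (\<forall>x\<in>{0..1/2}. \<bar>U1 x - (\<Sum>j\<le>m. u1 j x)\<bar> \<le> K / (1 - r) / real (m + 1) powr (1 + 1/2) * r ^ (m + 1)) \<and>
            (\<forall>x\<in>{1/2..1}. \<bar>U2 x - (\<Sum>j\<le>m. u2 j x)\<bar> \<le> K / (1 - r) / real (m + 1) powr (1 + 1/2) * r ^ (m + 1)) \<and>
            \<bar>L - (\<Sum>j\<le>m. lam j)\<bar> \<le> K / (1 - r) / real (m + 1) powr (1 + 1/2) * Rinv vb * r ^ m)"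
proof -
  have r: "0 \<le> r" "r < 1" using pos Rinv_nonneg rate by (auto simp: r_def)
  obtain C where C: "0 \<le> C" "\<And>n. 1 \<le> n \<Longrightarrow> \<kappa> ^ n * vb n \<le> C * r ^ n / (real n * sqrt (real n))"
    using scaled_majorant unfolding r_def by blast
  have maj: "c * \<kappa> ^ n * vb n \<le> (c * C) * r ^ n / (real n * sqrt (real n))" if "0 \<le> c" "1 \<le> n" for c n
    using mult_left_mono[OF C(2)[OF that(2)] that(1)] by (simp add: mult_ac)
  have DT: "0 \<le> D * \<theta>" and GT: "0 \<le> G * \<theta>" using D_nonneg pos by auto
  have U_tail: "\<bar>y\<bar> \<le> (D * \<theta> * C) * r ^ n / (real n * sqrt (real n))" if "1 \<le> n" "\<bar>y\<bar> \<le> U n" for y n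
    using maj[OF DT that(1)] that by (simp add: U_def)
  have L_tail: "\<bar>y\<bar> \<le> (G * \<theta> * C) * r ^ n / (real n * sqrt (real n))" if "1 \<le> n" "\<bar>y\<bar> \<le> \<Lambda> n" for y n
    using maj[OF GT that(1)] that by (simp add: \<Lambda>_def)
  have g: "\<And>j x. x \<in> {0..1/2} \<Longrightarrow> \<bar>u1 j x\<bar> \<le> U j" "\<And>j x. x \<in> {1/2..1} \<Longrightarrow> \<bar>u2 j x\<bar> \<le> U j" "\<And>j. \<bar>lam j\<bar> \<le> \<Lambda> j"
    using within_majorant_all by (auto simp: within_majorant_def)
  have DC: "0 \<le> D * \<theta> * C" and GC: "0 \<le> G * \<theta> * C" using DT GT C(1) by auto
  have tb1: "summable (\<lambda>j. \<bar>u1 j x\<bar>)"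
    "\<bar>(\<Sum>j. u1 j x) - (\<Sum>j\<le>m. u1 j x)\<bar> \<le> D * \<theta> * C / (1 - r) / real (m + 1) powr (1 + 1/2) * r ^ (m + 1)"
    if "x \<in> {0..1/2}" for x m
  proof -
    have t: "\<bar>u1 n x\<bar> \<le> (D * \<theta> * C) * r ^ n / (real n * sqrt (real n))" if "1 \<le> n" for n
      using U_tail[of n "u1 n x"] g(1)[OF \<open>x \<in> _\<close>] that by simp
    show "summable (\<lambda>j. \<bar>u1 j x\<bar>)" by (rule tail_bound(1)[OF t DC r])
    show "\<bar>(\<Sum>j. u1 j x) - (\<Sum>j\<le>m. u1 j x)\<bar> \<le> D * \<theta> * C / (1 - r) / real (m + 1) powr (1 + 1/2) * r ^ (m + 1)"
      using tail_bound(2)[OF t DC r, of m] by simp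
  qed
  have tb2: "summable (\<lambda>j. \<bar>u2 j x\<bar>)"
    "\<bar>(\<Sum>j. u2 j x) - (\<Sum>j\<le>m. u2 j x)\<bar> \<le> D * \<theta> * C / (1 - r) / real (m + 1) powr (1 + 1/2) * r ^ (m + 1)"
    if "x \<in> {1/2..1}" for x m
  proof -
    have t: "\<bar>u2 n x\<bar> \<le> (D * \<theta> * C) * r ^ n / (real n * sqrt (real n))" if "1 \<le> n" for n
      using U_tail[of n "u2 n x"] g(2)[OF \<open>x \<in> _\<close>] that by simp
    show "summable (\<lambda>j. \<bar>u2 j x\<bar>)" by (rule tail_bound(1)[OF t DC r])
    show "\<bar>(\<Sum>j. u2 j x) - (\<Sum>j\<le>m. u2 j x)\<bar> \<le> D * \<theta> * C / (1 - r) / real (m + 1) powr (1 + 1/2) * r ^ (m + 1)"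
      using tail_bound(2)[OF t DC r, of m] by simp
  qed
  have "\<bar>lam n\<bar> \<le> (G * \<theta> * C) * r ^ n / (real n * sqrt (real n))" if "1 \<le> n" for n
    using L_tail[of n "lam n"] g(3)[of n] that by simp
  note tbl = tail_bound[OF this GC r]
  have U0: "0 \<le> U j" "0 \<le> \<Lambda> j" for j using g(1)[of 0 j] g(3)[of j] by (auto intro: order.trans[OF abs_ge_zero])
  have "summable (\<lambda>n. \<bar>U n\<bar>)"
    by (rule tail_bound(1)[OF _ DC r]) (rule U_tail, use U0 in auto)
  then have Us: "summable U" by (rule summable_rabs_cancel)
  have "summable (\<lambda>n. \<bar>\<Lambda> n\<bar>)"
    by (rule tail_bound(1)[OF _ GC r]) (rule L_tail, use U0 in auto)
  then have Ls: "summable \<Lambda>" by (rule summable_rabs_cancel)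
  \<comment> \<open>The Adomian part is one of the nonnegative summands in
    \<open>majorant_step\<close>, hence below the next majorant coefficient.\<close>
  have acap_le: "adomian_majorant j \<le> \<theta> * \<kappa> * (\<kappa> ^ j * vb (Suc j))" for j
  proof -
    have "0 \<le> (\<Sum>p=1..j. \<Lambda> (Suc j - p) * U p) + U j * Qn"
      using U0 Q by (intro add_nonneg_nonneg sum_nonneg mult_nonneg_nonneg) auto
    then show ?thesis using majorant_step[of j] by (simp add: mult_ac)
  qed
  have acap_nonneg: "0 \<le> adomian_majorant j" for j
    using adomian_majorant_bound[of j "\<lambda>_. 0"] U0 by (auto intro: order.trans[OF abs_ge_zero])
  have As: "summable adomian_majorant"
  proof (rule summable_comparison_test)
    have "summable (\<lambda>n. \<bar>\<kappa> ^ n * vb n\<bar>)"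
      by (rule tail_bound(1)[OF _ C(1) r]) (use C(2) pos vb_nonneg in \<open>simp add: abs_of_nonneg\<close>)
    then have "summable (\<lambda>n. \<theta> * \<bar>\<kappa> ^ Suc n * vb (Suc n)\<bar>)"
      by (intro summable_mult) (subst summable_Suc_iff)
    then show "summable (\<lambda>n. \<theta> * (\<kappa> ^ Suc n * vb (Suc n)))"
      using pos vb_nonneg by (simp add: abs_of_nonneg)
    show "\<exists>M. \<forall>n\<ge>M. norm (adomian_majorant n) \<le> \<theta> * (\<kappa> ^ Suc n * vb (Suc n))"
      using acap_le acap_nonneg by (auto simp: abs_of_nonneg mult_ac)
  qed
  obtain e1 e2 where e: "ode_sol 0 (1/2) (lam 0) (u1 0) e1 (\<lambda>_. 0)" "ode_sol (1/2) 1 (lam 0) (u2 0) e2 (\<lambda>_. 0)"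
     "u1 0 0 = 0" "u2 0 1 = 0" "e1 0 = 1" "u2 0 (1/2) - u1 0 (1/2) = 0" "e2 (1/2) - e1 (1/2) = 1"
    using trial unfolding nl_eigensol_def lam0 by auto
  have "\<forall>j. \<exists>d1 d2. correction_sol j d1 d2"
    using fd_step(2)[OF within_majorant_all] by blast
  then obtain c1 c2 where cc: "\<And>j. correction_sol j (c1 j) (c2 j)"
    by metis
  have c: "\<And>j. ode_sol 0 (1/2) (lam 0) (u1 (Suc j)) (c1 j)
         (\<lambda>x. - (\<Sum>p\<le>j. lam (Suc j - p) * u1 p x) + q x * u1 j x + adomian N j (\<lambda>p. u1 p x))"
       "\<And>j. ode_sol (1/2) 1 (lam 0) (u2 (Suc j)) (c2 j)
         (\<lambda>x. - (\<Sum>p\<le>j. lam (Suc j - p) * u2 p x) + q x * u2 j x + adomian N j (\<lambda>p. u2 p x))"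
       "\<And>j. u1 (Suc j) 0 = 0" "\<And>j. u2 (Suc j) 1 = 0" "\<And>j. c1 j 0 = 0"
       "\<And>j. u2 (Suc j) (1/2) - u1 (Suc j) (1/2) = 0" "\<And>j. c2 j (1/2) - c1 j (1/2) = 0"
       "\<And>j x. x \<in> {0..1/2} \<Longrightarrow> \<bar>c1 j x\<bar> \<le> \<omega> * U (Suc j)"
       "\<And>j x. x \<in> {1/2..1} \<Longrightarrow> \<bar>c2 j x\<bar> \<le> \<omega> * U (Suc j)"
    using cc unfolding correction_sol_def by blast+
  define d1 d2 where "d1 = case_nat e1 c1" and "d2 = case_nat e2 c2"
  have ebound: "\<exists>E. \<forall>x\<in>{a..b}. \<bar>e x\<bar> \<le> E" if "ode_sol a b \<mu> u e (\<lambda>_. 0)" for a b \<mu> u and e :: "real \<Rightarrow> real"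
  proof -
    have i: "((\<lambda>t. 0 - \<mu> * u t) has_integral (e x - e a)) {a..x}" if "x \<in> {a..b}" for x
      using that \<open>ode_sol a b \<mu> u e (\<lambda>_. 0)\<close> by (simp add: ode_sol_def)
    have "(\<lambda>t. 0 - \<mu> * u t) integrable_on {a..b}"
      using ode_sol_continuous[OF that] by (intro integrable_continuous_real continuous_intros)
    then have "continuous_on {a..b} (\<lambda>x. e a + integral {a..x} (\<lambda>t. 0 - \<mu> * u t))"
      by (intro continuous_intros indefinite_integral_continuous_1)
    then have "continuous_on {a..b} e"
      by (rule continuous_on_eq) (use integral_unique[OF i] in simp)
    then have "bounded (e ` {a..b})"
      by (intro compact_imp_bounded compact_continuous_image) auto
    then show ?thesis unfolding bounded_iff by auto
  qed
  obtain E1 where E1: "\<And>x. x \<in> {0..1/2} \<Longrightarrow> \<bar>e1 x\<bar> \<le> E1" using ebound[OF e(1)] by blast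
  obtain E2 where E2: "\<And>x. x \<in> {1/2..1} \<Longrightarrow> \<bar>e2 x\<bar> \<le> E2" using ebound[OF e(2)] by blast
  \<comment> \<open>The bound \<open>\<omega> * U\<close> covers only the corrections; the
    derivatives of the trial function are bounded by compactness.\<close>
  define Db where "Db = case_nat (max E1 E2) (\<lambda>j. \<omega> * U (Suc j))"
  have Dbs: "summable Db"
  proof (subst summable_Suc_iff[symmetric])
    show "summable (\<lambda>j. Db (Suc j))"
      unfolding Db_def using Us by (simp add: summable_mult summable_Suc_iff)
  qed
  have d1b: "\<bar>d1 j x\<bar> \<le> Db j" if "x \<in> {0..1/2}" for j x
    using E1[OF that] c(8)[OF that] by (auto simp: d1_def Db_def le_max_iff_disj split: nat.split)
  have d2b: "\<bar>d2 j x\<bar> \<le> Db j" if "x \<in> {1/2..1}" for j x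
    using E2[OF that] c(9)[OF that] by (auto simp: d2_def Db_def le_max_iff_disj split: nat.split)
  define L U1 U2 where "L = (\<Sum>j. lam j)" and "U1 x = (\<Sum>j. u1 j x)" and "U2 x = (\<Sum>j. u2 j x)" for x
  define V1 V2 where "V1 x = (\<Sum>j. d1 j x)" and "V2 x = (\<Sum>j. d2 j x)" for x
  have o1: "ode_sol 0 (1/2) L U1 V1 (\<lambda>x. q x * U1 x + N (U1 x))"
    unfolding L_def U1_def[abs_def] V1_def[abs_def]
  proof (rule ode_sol_series[where Ub = U and Db = Db and Lb = \<Lambda> and Ab = adomian_majorant])
    show "\<bar>adomian N j (\<lambda>p. u1 p x)\<bar> \<le> adomian_majorant j" if "x \<in> {0..1/2}" for j x
      by (rule adomian_majorant_bound) (rule g(1)[OF that])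
  qed (use e(1) c(1) q_sub(1)[of 0 "1/2"] g(1,3) d1b Us Ls Dbs As in \<open>auto simp: d1_def\<close>)
  have o2: "ode_sol (1/2) 1 L U2 V2 (\<lambda>x. q x * U2 x + N (U2 x))"
    unfolding L_def U2_def[abs_def] V2_def[abs_def]
  proof (rule ode_sol_series[where Ub = U and Db = Db and Lb = \<Lambda> and Ab = adomian_majorant])
    show "\<bar>adomian N j (\<lambda>p. u2 p x)\<bar> \<le> adomian_majorant j" if "x \<in> {1/2..1}" for j x
      by (rule adomian_majorant_bound) (rule g(2)[OF that])
  qed (use e(2) c(2) q_sub(1)[of "1/2" 1] g(2,3) d2b Us Ls Dbs As in \<open>auto simp: d2_def\<close>)
  have ss: "(\<Sum>j. f j) = f 0" if "\<And>j. f (Suc j) = 0" for f :: "nat \<Rightarrow> real"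
  proof -
    have "f sums f 0" using sums_Suc[of f 0] that by simp
    then show ?thesis by (rule sums_unique[symmetric])
  qed
  have sd1: "summable (\<lambda>j. d1 j (1/2))" and sd2: "summable (\<lambda>j. d2 j (1/2))"
    using d1b[of "1/2"] d2b[of "1/2"] by (auto intro!: summable_comparison_test[OF _ Dbs])
  have su1: "summable (\<lambda>j. u1 j x)" if "x \<in> {0..1/2}" for x
    by (rule summable_rabs_cancel) (rule tb1(1)[OF that])
  have su2: "summable (\<lambda>j. u2 j x)" if "x \<in> {1/2..1}" for x
    by (rule summable_rabs_cancel) (rule tb2(1)[OF that])
  have "V1 0 = 1" unfolding V1_def using ss[of "\<lambda>j. d1 j 0"] c(5) e(5) by (simp add: d1_def)
  moreover have "U1 0 = 0" unfolding U1_def using ss[of "\<lambda>j. u1 j 0"] c(3) e(3) by simp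
  moreover have "U2 1 = 0" unfolding U2_def using ss[of "\<lambda>j. u2 j 1"] c(4) e(4) by simp
  moreover have "V2 (1/2) - V1 (1/2) = 1"
    unfolding V1_def V2_def suminf_diff[OF sd2 sd1]
    using ss[of "\<lambda>j. d2 j (1/2) - d1 j (1/2)"] c(7) e(7) by (simp add: d1_def d2_def)
  moreover have "U2 (1/2) - U1 (1/2) = 0"
    unfolding U1_def U2_def suminf_diff[OF su2[of "1/2", simplified] su1[of "1/2", simplified]]
    using ss[of "\<lambda>j. u2 j (1/2) - u1 j (1/2)"] c(6) e(6) by simp
  ultimately have nl: "nl_eigensol q N L U1 U2"
    unfolding nl_eigensol_def using o1 o2 by blast
  \<comment> \<open>The term with \<open>\<kappa>\<close> serves the eigenvalue estimate, where
    \<open>r^(m+1) = \<kappa> * Rinv vb * r^m\<close>.\<close>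
  define K where "K = D * \<theta> * C + G * \<theta> * C * \<kappa> + 1"
  have K: "0 < K" "D * \<theta> * C \<le> K" "G * \<theta> * C * \<kappa> \<le> K"
    using DC GC mult_nonneg_nonneg[OF GC less_imp_le[OF pos(2)]] by (simp_all add: K_def)
  have up: "A / (1 - r) / real (m + 1) powr (1 + 1/2) * y \<le> K / (1 - r) / real (m + 1) powr (1 + 1/2) * y"
    if "A \<le> K" "0 \<le> y" for A y m
    using that r by (intro mult_right_mono divide_right_mono) auto
  have b1: "\<bar>U1 x - (\<Sum>j\<le>m. u1 j x)\<bar> \<le> K / (1 - r) / real (m + 1) powr (1 + 1/2) * r ^ (m + 1)"
    if "x \<in> {0..1/2}" for x m
    unfolding U1_def by (rule order.trans[OF tb1(2)[OF that] up[OF K(2)]]) (use r in auto)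
  have b2: "\<bar>U2 x - (\<Sum>j\<le>m. u2 j x)\<bar> \<le> K / (1 - r) / real (m + 1) powr (1 + 1/2) * r ^ (m + 1)"
    if "x \<in> {1/2..1}" for x m
    unfolding U2_def by (rule order.trans[OF tb2(2)[OF that] up[OF K(2)]]) (use r in auto)
  have bl: "\<bar>L - (\<Sum>j\<le>m. lam j)\<bar> \<le> K / (1 - r) / real (m + 1) powr (1 + 1/2) * Rinv vb * r ^ m" for m
  proof -
    have "\<bar>L - (\<Sum>j\<le>m. lam j)\<bar> \<le> G * \<theta> * C / (1 - r) / real (m + 1) powr (1 + 1/2) * r ^ (m + 1)"
      unfolding L_def by (rule tbl(2))
    also have "\<dots> = G * \<theta> * C * \<kappa> / (1 - r) / real (m + 1) powr (1 + 1/2) * (Rinv vb * r ^ m)"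
      by (simp add: r_def)
    also have "\<dots> \<le> K / (1 - r) / real (m + 1) powr (1 + 1/2) * (Rinv vb * r ^ m)"
      by (rule up[OF K(3)]) (use r Rinv_nonneg in auto)
    finally show ?thesis by (simp add: mult.assoc)
  qed
  have sl: "lam sums L" unfolding L_def
    by (rule summable_sums[OF summable_rabs_cancel]) (rule tbl(1))
  show ?thesis
  proof (intro exI conjI ballI)
    show "lam sums L" by (rule sl)
    show "(\<lambda>j. u1 j x) sums U1 x" if "x \<in> {0..1/2}" for x
      unfolding U1_def by (rule summable_sums[OF su1[OF that]])
    show "(\<lambda>j. u2 j x) sums U2 x" if "x \<in> {1/2..1}" for x
      unfolding U2_def by (rule summable_sums[OF su2[OF that]])
    show "nl_eigensol q N L U1 U2" by (rule nl)
    show "0 < K" by (rule K(1))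
    show "\<forall>m.
            (\<forall>x\<in>{0..1/2}. \<bar>U1 x - (\<Sum>j\<le>m. u1 j x)\<bar> \<le> K / (1 - r) / real (m + 1) powr (1 + 1/2) * r ^ (m + 1)) \<and>
            (\<forall>x\<in>{1/2..1}. \<bar>U2 x - (\<Sum>j\<le>m. u2 j x)\<bar> \<le> K / (1 - r) / real (m + 1) powr (1 + 1/2) * r ^ (m + 1)) \<and>
            \<bar>L - (\<Sum>j\<le>m. lam j)\<bar> \<le> K / (1 - r) / real (m + 1) powr (1 + 1/2) * Rinv vb * r ^ m"
      using b1 b2 bl by blast
  qed
qed

end

section \<open>The two families of trial eigenpairs\<close>

lemma sin_ode_sol:
  assumes "a \<le> b"
  shows "ode_sol a b (k\<^sup>2) (\<lambda>x. A * sin (k * x + c)) (\<lambda>x. A * k * cos (k * x + c)) (\<lambda>_. 0)"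
  unfolding ode_sol_def
proof (intro conjI ballI)
  fix x assume x: "x \<in> {a..b}"
  show "((\<lambda>x. A * sin (k * x + c)) has_real_derivative A * k * cos (k * x + c)) (at x within {a..b})"
    by (auto intro!: derivative_eq_intros)
  have "((\<lambda>t. 0 - k\<^sup>2 * (A * sin (k * t + c))) has_integral (A * k * cos (k * x + c) - A * k * cos (k * a + c))) {a..x}"
  proof (rule fundamental_theorem_of_calculus)
    show "((\<lambda>x. A * k * cos (k * x + c)) has_vector_derivative 0 - k\<^sup>2 * (A * sin (k * t + c))) (at t within {a..x})" for t
      unfolding has_real_derivative_iff_has_vector_derivative[symmetric]
      by (auto intro!: derivative_eq_intros simp: power2_eq_square)
  qed (use x in auto)
  then show "((\<lambda>t. 0 - k\<^sup>2 * (A * sin (k * t + c))) has_integral (A * k * cos (k * x + c) - A * k * cos (k * a + c))) {a..x}" .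
qed

lemma integral_eq_antiderivative:
  fixes F f :: "real \<Rightarrow> real"
  assumes "a \<le> b" and "\<And>t. t \<in> {a..b} \<Longrightarrow> (F has_real_derivative f t) (at t)"
  shows "integral {a..b} f = F b - F a"
  by (intro integral_unique fundamental_theorem_of_calculus assms(1))
     (auto simp: has_real_derivative_iff_has_vector_derivative[symmetric] intro!: has_field_derivative_at_within assms(2))

text \<open>The jump of the derivative at 1/2 is \<open>- 2 cos (\<omega> / 2)\<close>, which
  explains the hypothesis on the cosine. In the pairing the sine terms of the two halves cancel,
  leaving \<open>(1 - cos \<omega>) / (4 \<omega>)\<close> with
  \<open>cos \<omega> = - 1/2\<close>.\<close>

lemma trial_reflected:
  assumes \<omega>: "0 < \<omega>" and c: "cos (\<omega> / 2) = - (1/2)"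
  shows "nl_eigensol (\<lambda>_. 0) (\<lambda>_. 0) (\<omega>\<^sup>2) (\<lambda>x. sin (\<omega> * x) / \<omega>) (\<lambda>x. sin (\<omega> * (1 - x)) / \<omega>)"
    and "integral {0..1/2} (\<lambda>t. sin (\<omega> * (1 - t)) * (sin (\<omega> * t) / \<omega>))
       + integral {1/2..1} (\<lambda>t. sin (\<omega> * (1 - t)) * (sin (\<omega> * (1 - t)) / \<omega>)) = 3 / (8 * \<omega>)"
proof -
  have "ode_sol 0 (1/2) (\<omega>\<^sup>2) (\<lambda>x. 1/\<omega> * sin (\<omega> * x + 0)) (\<lambda>x. 1/\<omega> * \<omega> * cos (\<omega> * x + 0)) (\<lambda>_. 0)"
    by (rule sin_ode_sol) simp
  moreover have "ode_sol (1/2) 1 ((-\<omega>)\<^sup>2) (\<lambda>x. 1/\<omega> * sin (-\<omega> * x + \<omega>)) (\<lambda>x. 1/\<omega> * (-\<omega>) * cos (-\<omega> * x + \<omega>)) (\<lambda>_. 0)"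
    by (rule sin_ode_sol) simp
  moreover have "(\<lambda>x. 1/\<omega> * sin (-\<omega> * x + \<omega>)) = (\<lambda>x. sin (\<omega> * (1 - x)) / \<omega>)"
    by (simp add: algebra_simps)
  ultimately show "nl_eigensol (\<lambda>_. 0) (\<lambda>_. 0) (\<omega>\<^sup>2) (\<lambda>x. sin (\<omega> * x) / \<omega>) (\<lambda>x. sin (\<omega> * (1 - x)) / \<omega>)"
    unfolding nl_eigensol_def using \<omega> c
    by (intro exI[of _ "\<lambda>x. 1/\<omega> * \<omega> * cos (\<omega> * x + 0)"] exI[of _ "\<lambda>x. 1/\<omega> * (-\<omega>) * cos (-\<omega> * x + \<omega>)"]) simp
  have "cos \<omega> = 2 * (cos (\<omega> / 2))\<^sup>2 - 1" using cos_double_cos[of "\<omega> / 2"] by simp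
  then have cw: "cos \<omega> = - (1/2)" by (simp add: c power2_eq_square)
  have "integral {0..1/2} (\<lambda>t. sin (\<omega> * (1 - t)) * (sin (\<omega> * t) / \<omega>))
     = (\<lambda>t. (- sin (\<omega> * (1 - 2 * t)) / (2 * \<omega>) - t * cos \<omega>) / (2 * \<omega>)) (1/2)
     - (\<lambda>t. (- sin (\<omega> * (1 - 2 * t)) / (2 * \<omega>) - t * cos \<omega>) / (2 * \<omega>)) 0"
  proof (rule integral_eq_antiderivative)
    fix t
    have e: "cos (\<omega> * (1 - 2 * t)) - cos \<omega> = 2 * (sin (\<omega> * (1 - t)) * sin (\<omega> * t))"
      using cos_diff[of "\<omega> * (1 - t)" "\<omega> * t"] cos_add[of "\<omega> * (1 - t)" "\<omega> * t"]
      by (simp add: algebra_simps)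
    have "((\<lambda>t. (- sin (\<omega> * (1 - 2 * t)) / (2 * \<omega>) - t * cos \<omega>) / (2 * \<omega>)) has_real_derivative
        (cos (\<omega> * (1 - 2 * t)) - cos \<omega>) / (2 * \<omega>)) (at t)"
      using \<omega> by (auto intro!: derivative_eq_intros) (simp add: field_simps)
    then show "((\<lambda>t. (- sin (\<omega> * (1 - 2 * t)) / (2 * \<omega>) - t * cos \<omega>) / (2 * \<omega>)) has_real_derivative
        sin (\<omega> * (1 - t)) * (sin (\<omega> * t) / \<omega>)) (at t)"
      unfolding e by simp
  qed simp
  moreover have "integral {1/2..1} (\<lambda>t. sin (\<omega> * (1 - t)) * (sin (\<omega> * (1 - t)) / \<omega>))
     = (\<lambda>t. (t + sin (2 * \<omega> * (1 - t)) / (2 * \<omega>)) / (2 * \<omega>)) 1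
     - (\<lambda>t. (t + sin (2 * \<omega> * (1 - t)) / (2 * \<omega>)) / (2 * \<omega>)) (1/2)"
  proof (rule integral_eq_antiderivative)
    fix t
    have e: "1 - cos (2 * \<omega> * (1 - t)) = 2 * (sin (\<omega> * (1 - t)) * sin (\<omega> * (1 - t)))"
      using cos_double_sin[of "\<omega> * (1 - t)"] by (simp add: power2_eq_square mult.assoc)
    have "((\<lambda>t. (t + sin (2 * \<omega> * (1 - t)) / (2 * \<omega>)) / (2 * \<omega>)) has_real_derivative
        (1 - cos (2 * \<omega> * (1 - t))) / (2 * \<omega>)) (at t)"
      using \<omega> by (auto intro!: derivative_eq_intros) (simp add: field_simps)
    then show "((\<lambda>t. (t + sin (2 * \<omega> * (1 - t)) / (2 * \<omega>)) / (2 * \<omega>)) has_real_derivative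
        sin (\<omega> * (1 - t)) * (sin (\<omega> * (1 - t)) / \<omega>)) (at t)"
      unfolding e by simp
  qed simp
  ultimately show "integral {0..1/2} (\<lambda>t. sin (\<omega> * (1 - t)) * (sin (\<omega> * t) / \<omega>))
       + integral {1/2..1} (\<lambda>t. sin (\<omega> * (1 - t)) * (sin (\<omega> * (1 - t)) / \<omega>)) = 3 / (8 * \<omega>)"
    using \<omega> by (simp add: cw) (simp add: field_simps)
qed

text \<open>Here \<open>e\<close> is 2 for even and 0 for odd \<open>n\<close>, so
  \<open>(e - 1) (-1)^n = 1\<close> is the required jump. As
  \<open>sin (\<omega> (1 - t)) = - sin (\<omega> t)\<close>, each half contributes a squared sine
  with integral 1/4.\<close>

lemma trial_periodic:
  fixes n :: nat
  assumes n: "1 \<le> n" and \<omega>_def: "\<omega> = 2 * pi * real n" and e_def: "e = (-1) ^ n + (1::real)"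
  shows "nl_eigensol (\<lambda>_. 0) (\<lambda>_. 0) (\<omega>\<^sup>2) (\<lambda>x. sin (\<omega> * x) / \<omega>) (\<lambda>x. e / \<omega> * sin (\<omega> * x))"
    and "integral {0..1/2} (\<lambda>t. sin (\<omega> * (1 - t)) * (sin (\<omega> * t) / \<omega>))
       + integral {1/2..1} (\<lambda>t. sin (\<omega> * (1 - t)) * (e / \<omega> * sin (\<omega> * t))) = - (1 + e) / (4 * \<omega>)"
proof -
  have \<omega>: "0 < \<omega>" using n by (simp add: \<omega>_def)
  have ch: "cos (\<omega> / 2) = (-1) ^ n" and sh: "sin (\<omega> / 2) = 0"
    by (simp_all add: \<omega>_def cos_npi2 sin_npi2)
  have c1: "cos \<omega> = 1" and s1: "sin \<omega> = 0" and s2: "sin (2 * \<omega>) = 0"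
    using cos_2npi[of n] sin_2npi[of n] sin_2npi[of "2 * n"] by (simp_all add: \<omega>_def mult_ac)
  have "ode_sol 0 (1/2) (\<omega>\<^sup>2) (\<lambda>x. 1/\<omega> * sin (\<omega> * x + 0)) (\<lambda>x. 1/\<omega> * \<omega> * cos (\<omega> * x + 0)) (\<lambda>_. 0)"
    by (rule sin_ode_sol) simp
  moreover have "ode_sol (1/2) 1 (\<omega>\<^sup>2) (\<lambda>x. e/\<omega> * sin (\<omega> * x + 0)) (\<lambda>x. e/\<omega> * \<omega> * cos (\<omega> * x + 0)) (\<lambda>_. 0)"
    by (rule sin_ode_sol) simp
  moreover have "e * (-1) ^ n - (-1) ^ n = (1::real)" by (cases "even n") (auto simp: e_def)
  ultimately show "nl_eigensol (\<lambda>_. 0) (\<lambda>_. 0) (\<omega>\<^sup>2) (\<lambda>x. sin (\<omega> * x) / \<omega>) (\<lambda>x. e / \<omega> * sin (\<omega> * x))"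
    unfolding nl_eigensol_def using \<omega> ch sh s1
    by (intro exI[of _ "\<lambda>x. 1/\<omega> * \<omega> * cos (\<omega> * x + 0)"] exI[of _ "\<lambda>x. e/\<omega> * \<omega> * cos (\<omega> * x + 0)"]) simp
  have sr: "sin (\<omega> * (1 - t)) = - sin (\<omega> * t)" for t
    using sin_diff[of \<omega> "\<omega> * t"] by (simp add: c1 s1 right_diff_distrib)
  have I: "integral {a..b} (\<lambda>t. sin (\<omega> * (1 - t)) * (A * sin (\<omega> * t)))
      = (\<lambda>t. - A * (t / 2 - sin (2 * \<omega> * t) / (4 * \<omega>))) b - (\<lambda>t. - A * (t / 2 - sin (2 * \<omega> * t) / (4 * \<omega>))) a"
    if "a \<le> b" for a b A
  proof (rule integral_eq_antiderivative[OF that])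
    fix t
    have e: "sin (\<omega> * (1 - t)) * (A * sin (\<omega> * t)) = - A * (1/2 - cos (2 * \<omega> * t) / 2)"
      using cos_double_sin[of "\<omega> * t"] by (simp add: sr power2_eq_square mult.assoc diff_divide_distrib)
    show "((\<lambda>t. - A * (t / 2 - sin (2 * \<omega> * t) / (4 * \<omega>))) has_real_derivative
        sin (\<omega> * (1 - t)) * (A * sin (\<omega> * t))) (at t)"
      unfolding e using \<omega> by (auto intro!: derivative_eq_intros)
  qed
  show "integral {0..1/2} (\<lambda>t. sin (\<omega> * (1 - t)) * (sin (\<omega> * t) / \<omega>))
       + integral {1/2..1} (\<lambda>t. sin (\<omega> * (1 - t)) * (e / \<omega> * sin (\<omega> * t))) = - (1 + e) / (4 * \<omega>)"
    using I[of 0 "1/2" "1/\<omega>"] I[of "1/2" 1 "e/\<omega>"] \<omega> by (simp add: s1 s2) (simp add: field_simps)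
qed

theorem theorem2:
  fixes q :: "real \<Rightarrow> real" and a :: "nat \<Rightarrow> real" and N Nbar :: "real \<Rightarrow> real"
    and vb :: "nat \<Rightarrow> real"
  assumes q_L1: "q absolutely_integrable_on {0..1}"
    and N_series: "\<forall>u. (\<lambda>i. a (Suc i) * u ^ Suc i) sums N u"
    and Nbar_smooth: "\<forall>k x. (deriv ^^ k) Nbar differentiable (at x)"
    and N_maj: "\<forall>u k. \<bar>(deriv ^^ k) N u\<bar> \<le> (deriv ^^ k) Nbar \<bar>u\<bar>"
    and vb0: "vb 0 = 8/3"
    and vb1: "vb 1 = (1 + vb 0) * (integral {0..1} (\<lambda>x. \<bar>q x\<bar>) * vb 0 + deriv Nbar (vb 0) * vb 0)"
    and vbSuc: "\<forall>j\<ge>1. vb (Suc j) = (\<Sum>p=1..j. vb (Suc j - p) * vb p)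
                 + (1 + vb 0) * (integral {0..1} (\<lambda>x. \<bar>q x\<bar>) * vb j + adomian Nbar j vb)"
    and R_pos: "0 < conv_radius vb"
  shows
  "(\<forall>(n::nat) (s::real) lam u1 u2.
      s \<in> {1, -1} \<and>
      lam 0 = 4 * pi\<^sup>2 * (s * 2/3 + 2 * real n)\<^sup>2 \<and>
      u1 0 = (\<lambda>x. sin (sqrt (lam 0) * x) / sqrt (lam 0)) \<and>
      u2 0 = (\<lambda>x. sin (sqrt (lam 0) * (1 - x)) / sqrt (lam 0)) \<and>
      FD_seq q N lam u1 u2 \<and>
      (2 + sqrt 3) / (sqrt 3 * sqrt (lam 0)) * Rinv vb < 1
    \<longrightarrow>
      (let r = (2 + sqrt 3) / (sqrt 3 * sqrt (lam 0)) * Rinv vb in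
       \<exists>L U1 U2. lam sums L \<and>
         (\<forall>x\<in>{0..1/2}. (\<lambda>j. u1 j x) sums U1 x) \<and>
         (\<forall>x\<in>{1/2..1}. (\<lambda>j. u2 j x) sums U2 x) \<and>
         nl_eigensol q N L U1 U2 \<and>
         (\<exists>c>0. \<exists>\<epsilon>>0. \<forall>m::nat. let C = c / (1 - r) in
            (\<forall>x\<in>{0..1/2}. \<bar>U1 x - (\<Sum>j\<le>m. u1 j x)\<bar>
                 \<le> 3 * C / (8 * real (m + 1) powr (1 + \<epsilon>) * sqrt (lam 0)) * r ^ (m + 1)) \<and>
            (\<forall>x\<in>{1/2..1}. \<bar>U2 x - (\<Sum>j\<le>m. u2 j x)\<bar>
                 \<le> 3 * C / (8 * real (m + 1) powr (1 + \<epsilon>) * sqrt (lam 0)) * r ^ (m + 1)) \<and>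
            \<bar>L - (\<Sum>j\<le>m. lam j)\<bar> \<le> C / real (m + 1) powr (1 + \<epsilon>) * Rinv vb * r ^ m)))
   \<and>
   (\<forall>(n::nat) lam u1 u2.
      1 \<le> n \<and>
      lam 0 = 4 * pi\<^sup>2 * real n ^ 2 \<and>
      u1 0 = (\<lambda>x. sin (2 * pi * real n * x) / (2 * pi * real n)) \<and>
      u2 0 = (\<lambda>x. ((-1) ^ n + 1) / (2 * pi * real n) * sin (2 * pi * real n * x)) \<and>
      FD_seq q N lam u1 u2 \<and>
      1 / (pi * real n) * Rinv vb < 1
    \<longrightarrow>
      (let r = 1 / (pi * real n) * Rinv vb in
       \<exists>L U1 U2. lam sums L \<and>
         (\<forall>x\<in>{0..1/2}. (\<lambda>j. u1 j x) sums U1 x) \<and>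
         (\<forall>x\<in>{1/2..1}. (\<lambda>j. u2 j x) sums U2 x) \<and>
         nl_eigensol q N L U1 U2 \<and>
         (\<exists>c>0. \<exists>\<epsilon>>0. \<forall>m::nat. let C = c / (1 - r);
              B = (if even n then 3 * C else C) / (8 * pi * real n * real (m + 1) powr (1 + \<epsilon>)) * r ^ (m + 1) in
            (\<forall>x\<in>{0..1/2}. \<bar>U1 x - (\<Sum>j\<le>m. u1 j x)\<bar> \<le> B) \<and>
            (\<forall>x\<in>{1/2..1}. \<bar>U2 x - (\<Sum>j\<le>m. u2 j x)\<bar> \<le> B) \<and>
            \<bar>L - (\<Sum>j\<le>m. lam j)\<bar> \<le> C / real (m + 1) powr (1 + \<epsilon>) * Rinv vb * r ^ m)))"
proof -
  have N_smooth: "\<forall>k x. (deriv ^^ k) N differentiable (at x)"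
  proof (rule entire_series_smooth)
    show "\<forall>u. (\<lambda>i. (if i = 0 then 0 else a i) * u ^ i) sums N u"
      using N_series sums_Suc[of "\<lambda>i. (if i = 0 then 0 else a i) * _ ^ i"] by simp
  qed
  have N0: "N 0 = 0"
    using N_series[rule_format, of 0] sums_unique2[OF _ sums_zero] by simp
  have maj: "majorant_sequence N Nbar vb (integral {0..1} (\<lambda>x. \<bar>q x\<bar>))"
  proof unfold_locales
    show "0 \<le> integral {0..1} (\<lambda>x. \<bar>q x\<bar>)"
      using q_L1 by (intro integral_nonneg) (auto simp: absolutely_integrable_on_def)
  qed (use N_smooth Nbar_smooth N_maj vb0 vb1 vbSuc in auto)
  have bound: "K / (1 - r) / P * y \<le> d * (c / (1 - r)) / P * y"
    if "K \<le> d * c" "r < 1" "0 \<le> P" "0 \<le> y" for K r P y d c :: real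
  proof -
    have "K / (1 - r) / P * y \<le> d * c / (1 - r) / P * y"
      using that by (intro mult_right_mono divide_right_mono) auto
    then show ?thesis by simp
  qed
  have A: "let r = (2 + sqrt 3) / (sqrt 3 * sqrt (lam 0)) * Rinv vb in
       \<exists>L U1 U2. lam sums L \<and>
         (\<forall>x\<in>{0..1/2}. (\<lambda>j. u1 j x) sums U1 x) \<and>
         (\<forall>x\<in>{1/2..1}. (\<lambda>j. u2 j x) sums U2 x) \<and>
         nl_eigensol q N L U1 U2 \<and>
         (\<exists>c>0. \<exists>\<epsilon>>0. \<forall>m::nat. let C = c / (1 - r) in
            (\<forall>x\<in>{0..1/2}. \<bar>U1 x - (\<Sum>j\<le>m. u1 j x)\<bar>
                 \<le> 3 * C / (8 * real (m + 1) powr (1 + \<epsilon>) * sqrt (lam 0)) * r ^ (m + 1)) \<and>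
            (\<forall>x\<in>{1/2..1}. \<bar>U2 x - (\<Sum>j\<le>m. u2 j x)\<bar>
                 \<le> 3 * C / (8 * real (m + 1) powr (1 + \<epsilon>) * sqrt (lam 0)) * r ^ (m + 1)) \<and>
            \<bar>L - (\<Sum>j\<le>m. lam j)\<bar> \<le> C / real (m + 1) powr (1 + \<epsilon>) * Rinv vb * r ^ m)"
    if s: "s \<in> {1, -1}" and lam0: "lam 0 = 4 * pi\<^sup>2 * (s * 2/3 + 2 * real n)\<^sup>2"
      and u10: "u1 0 = (\<lambda>x. sin (sqrt (lam 0) * x) / sqrt (lam 0))"
      and u20: "u2 0 = (\<lambda>x. sin (sqrt (lam 0) * (1 - x)) / sqrt (lam 0))"
      and FD: "FD_seq q N lam u1 u2"
      and rate: "(2 + sqrt 3) / (sqrt 3 * sqrt (lam 0)) * Rinv vb < 1"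
    for n :: nat and s :: real and lam u1 u2
  proof -
    define \<omega> where "\<omega> = sqrt (lam 0)"
    define \<kappa> where "\<kappa> = (2 + sqrt 3) / (sqrt 3 * \<omega>)"
    define y where "y = s * 2/3 + 2 * real n"
    have \<omega>y: "\<omega> = 2 * pi * \<bar>y\<bar>"
      by (simp add: \<omega>_def lam0 y_def real_sqrt_mult real_sqrt_abs)
    \<comment> \<open>Only \<open>n = 0\<close> with \<open>s = -1\<close> makes \<open>y\<close>
      negative. The resulting bound on \<open>\<omega>\<close> ensures that the trial function stays
      below \<open>vb 0 = 8/3\<close>.\<close>
    have "2/3 \<le> \<bar>y\<bar>" using s by (cases n) (auto simp: y_def)
    then have "2 * pi * (2/3) \<le> \<omega>" unfolding \<omega>y by (intro mult_left_mono) auto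
    then have \<omega>4: "4 \<le> \<omega>" using pi_gt3 by simp
    then have \<omega>0: "0 < \<omega>" by simp
    have "cos (\<omega> / 2) = cos (pi * y)" by (cases "0 \<le> y") (simp_all add: \<omega>y)
    also have "pi * y = s * (2 * pi / 3) + 2 * real n * pi" by (simp add: y_def algebra_simps)
    also have "cos \<dots> = cos (s * (2 * pi / 3))"
      by (simp add: cos_add)
    also have "\<dots> = - (1/2)" using s cos_120 by auto
    finally have c: "cos (\<omega> / 2) = - (1/2)" .
    note tr = trial_reflected[OF \<omega>0 c]
    \<comment> \<open>The conditions that bound \<open>\<kappa>\<close> from below reduce to this
      inequality; the factor \<open>(2 + sqrt 3) / sqrt 3\<close> exceeds 1.\<close>
    have \<kappa>1: "1 / \<omega> \<le> \<kappa>"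
    proof -
      have "1 / \<omega> = sqrt 3 / (sqrt 3 * \<omega>)" by simp
      also have "\<dots> \<le> \<kappa>" unfolding \<kappa>_def using \<omega>0 by (intro divide_right_mono) auto
      finally show ?thesis .
    qed
    have \<kappa>0: "0 < \<kappa>" using \<omega>0 by (auto simp: \<kappa>_def intro!: divide_pos_pos add_pos_pos)
    have D: "(8/3 * \<omega> * ((1/\<omega> + 1/\<omega>) / 2) + 1) / \<omega> = 11/3 * (1/\<omega>)" using \<omega>0 by simp
    \<comment> \<open>\<open>G\<close> is the reciprocal of the pairing
      \<open>3 / (8 \<omega>)\<close>, and the sup bounds are \<open>1 / \<omega>\<close>, which
      gives \<open>D = 11 / (3 \<omega>)\<close>. The value \<open>\<theta> = 9/88\<close> solves
      \<open>G * D * \<theta> = 1\<close>.\<close>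
    have "fd_method N Nbar vb q lam u1 u2 \<omega> \<kappa> (8/3 * \<omega>) (9/88) (1/\<omega>) (1/\<omega>)"
      unfolding fd_method_def fd_method_axioms_def D
    proof (intro conjI maj allI impI q_L1 N0 R_pos FD)
      show "\<kappa> * Rinv vb < 1" using rate by (simp add: \<kappa>_def \<omega>_def)
      show "lam 0 = \<omega>\<^sup>2" by (simp add: \<omega>_def lam0)
      show "nl_eigensol (\<lambda>_. 0) (\<lambda>_. 0) (\<omega>\<^sup>2) (u1 0) (u2 0)"
        using tr(1) by (simp add: u10 u20 \<omega>_def)
      show "1 \<le> 8/3 * \<omega> * \<bar>integral {0..1/2} (\<lambda>t. sin (\<omega> * (1 - t)) * u1 0 t)
          + integral {1/2..1} (\<lambda>t. sin (\<omega> * (1 - t)) * u2 0 t)\<bar>"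
        unfolding u10 u20 \<omega>_def[symmetric] tr(2) using \<omega>0 by simp
      show "0 < \<kappa>" by (rule \<kappa>0)
      show "11/3 * (1/\<omega>) \<le> 11/3 * \<kappa>" using \<kappa>1 by simp
      show "max (1/\<omega>) (1/\<omega>) \<le> 88/9 * (9/88) * \<kappa>" using \<kappa>1 by simp
      show "max (1/\<omega>) (1/\<omega>) \<le> 8/3" "11/3 * (1/\<omega>) * (9/88) \<le> 1"
        using \<omega>4 by (auto simp: divide_simps)
    qed (use \<omega>0 in \<open>auto simp: u10 u20 \<omega>_def[symmetric] divide_right_mono\<close>)
    note conv = fd_method.fd_convergence[OF this]
    have r: "\<kappa> * Rinv vb = (2 + sqrt 3) / (sqrt 3 * sqrt (lam 0)) * Rinv vb"
      by (simp add: \<kappa>_def \<omega>_def)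
    obtain L U1 U2 K where K: "lam sums L" "\<forall>x\<in>{0..1/2}. (\<lambda>j. u1 j x) sums U1 x"
        "\<forall>x\<in>{1/2..1}. (\<lambda>j. u2 j x) sums U2 x" "nl_eigensol q N L U1 U2" "0 < K"
      and est: "\<And>m x. x \<in> {0..1/2} \<Longrightarrow> \<bar>U1 x - (\<Sum>j\<le>m. u1 j x)\<bar>
          \<le> K / (1 - \<kappa> * Rinv vb) / real (m + 1) powr (1 + 1/2) * (\<kappa> * Rinv vb) ^ (m + 1)"
        "\<And>m x. x \<in> {1/2..1} \<Longrightarrow> \<bar>U2 x - (\<Sum>j\<le>m. u2 j x)\<bar>
          \<le> K / (1 - \<kappa> * Rinv vb) / real (m + 1) powr (1 + 1/2) * (\<kappa> * Rinv vb) ^ (m + 1)"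
        "\<And>m. \<bar>L - (\<Sum>j\<le>m. lam j)\<bar>
          \<le> K / (1 - \<kappa> * Rinv vb) / real (m + 1) powr (1 + 1/2) * Rinv vb * (\<kappa> * Rinv vb) ^ m"
      using conv by blast
    have Rn: "0 \<le> Rinv vb" by (rule fd_method.Rinv_nonneg) fact
    \<comment> \<open>The summand \<open>8/3 * \<omega>\<close> compensates the prefactor
      \<open>3 / (8 \<omega>)\<close> of the eigenfunction bound; the summand 1 serves the
      eigenvalue bound.\<close>
    define c where "c = K * (8/3 * \<omega> + 1)"
    have r0: "0 \<le> \<kappa> * Rinv vb" "\<kappa> * Rinv vb < 1"
      using Rn \<kappa>0 rate unfolding r[symmetric] by simp_all
    have ca: "K \<le> 3 / (8 * \<omega>) * c" and cb: "K \<le> 1 * c"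
      using K(5) \<omega>0 by (auto simp: c_def field_simps)
    show ?thesis
      unfolding Let_def r[symmetric] unfolding \<omega>_def[symmetric]
    proof (rule exI[of _ L], rule exI[of _ U1], rule exI[of _ U2], intro conjI K(1-4),
        rule exI[of _ c], rule conjI[rotated], rule exI[of _ "1/2"], rule conjI[rotated], intro allI conjI ballI)
      fix m :: nat
      let ?P = "real (m + 1) powr (1 + 1/2)"
      let ?B = "3 * (c / (1 - \<kappa> * Rinv vb)) / (8 * ?P * \<omega>) * (\<kappa> * Rinv vb) ^ (m + 1)"
      have B: "?B = 3 / (8 * \<omega>) * (c / (1 - \<kappa> * Rinv vb)) / ?P * (\<kappa> * Rinv vb) ^ (m + 1)"
        by (simp add: mult_ac)
      show "\<bar>U1 x - (\<Sum>j\<le>m. u1 j x)\<bar> \<le> ?B" if "x \<in> {0..1/2}" for x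
        unfolding B by (rule order.trans[OF est(1)[OF that] bound[OF ca r0(2)]]) (use r0(1) in auto)
      show "\<bar>U2 x - (\<Sum>j\<le>m. u2 j x)\<bar> \<le> ?B" if "x \<in> {1/2..1}" for x
        unfolding B by (rule order.trans[OF est(2)[OF that] bound[OF ca r0(2)]]) (use r0(1) in auto)
      show "\<bar>L - (\<Sum>j\<le>m. lam j)\<bar> \<le> c / (1 - \<kappa> * Rinv vb) / ?P * Rinv vb * (\<kappa> * Rinv vb) ^ m"
        using order.trans[OF est(3)[of m, unfolded mult.assoc] bound[OF cb r0(2), of ?P "Rinv vb * (\<kappa> * Rinv vb) ^ m"]] r0(1) Rn
        by (simp add: mult.assoc)
    qed (use K \<omega>0 in \<open>auto simp: c_def\<close>)
  qed
  have B: "let r = 1 / (pi * real n) * Rinv vb in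
       \<exists>L U1 U2. lam sums L \<and>
         (\<forall>x\<in>{0..1/2}. (\<lambda>j. u1 j x) sums U1 x) \<and>
         (\<forall>x\<in>{1/2..1}. (\<lambda>j. u2 j x) sums U2 x) \<and>
         nl_eigensol q N L U1 U2 \<and>
         (\<exists>c>0. \<exists>\<epsilon>>0. \<forall>m::nat. let C = c / (1 - r);
              B = (if even n then 3 * C else C) / (8 * pi * real n * real (m + 1) powr (1 + \<epsilon>)) * r ^ (m + 1) in
            (\<forall>x\<in>{0..1/2}. \<bar>U1 x - (\<Sum>j\<le>m. u1 j x)\<bar> \<le> B) \<and>
            (\<forall>x\<in>{1/2..1}. \<bar>U2 x - (\<Sum>j\<le>m. u2 j x)\<bar> \<le> B) \<and>
            \<bar>L - (\<Sum>j\<le>m. lam j)\<bar> \<le> C / real (m + 1) powr (1 + \<epsilon>) * Rinv vb * r ^ m)"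
    if n: "1 \<le> n" and lam0: "lam 0 = 4 * pi\<^sup>2 * real n ^ 2"
      and u10: "u1 0 = (\<lambda>x. sin (2 * pi * real n * x) / (2 * pi * real n))"
      and u20: "u2 0 = (\<lambda>x. ((-1) ^ n + 1) / (2 * pi * real n) * sin (2 * pi * real n * x))"
      and FD: "FD_seq q N lam u1 u2" and rate: "1 / (pi * real n) * Rinv vb < 1"
    for n :: nat and lam u1 u2
  proof -
    define \<omega> where "\<omega> = 2 * pi * real n"
    define \<kappa> where "\<kappa> = 1 / (pi * real n)"
    define e :: real where "e = (-1) ^ n + 1"
    have e: "e = 0 \<or> e = 2" by (cases "even n") (auto simp: e_def)
    then have e0: "0 \<le> e" by auto
    have "2 * pi * 1 \<le> \<omega>" unfolding \<omega>_def using n by (intro mult_left_mono) auto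
    then have \<omega>4: "4 \<le> \<omega>" using pi_gt3 by simp
    then have \<omega>0: "0 < \<omega>" by simp
    have \<kappa>2: "\<kappa> = 2 * (1 / \<omega>)" by (simp add: \<kappa>_def \<omega>_def)
    note tr = trial_periodic[OF n \<omega>_def e_def]
    have D: "(4 * \<omega> / (1 + e) * ((1/\<omega> + e/\<omega>) / 2) + 1) / \<omega> = 3 * (1/\<omega>)"
      using \<omega>0 e by (auto simp: field_simps)
    \<comment> \<open>The pairing has size \<open>(1 + e) / (4 \<omega>)\<close>, which gives
      \<open>G\<close> and \<open>D = 3 / \<omega>\<close>; \<open>\<theta>\<close> again solves
      \<open>G * D * \<theta> = 1\<close>. With \<open>\<kappa> = 2 / \<omega>\<close> the other
      inequalities are checked for \<open>e = 0\<close> and \<open>e = 2\<close>.\<close>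
    have "fd_method N Nbar vb q lam u1 u2 \<omega> \<kappa> (4 * \<omega> / (1 + e)) ((1 + e) / 12) (1/\<omega>) (e/\<omega>)"
      unfolding fd_method_def fd_method_axioms_def D
    proof (intro conjI maj allI impI q_L1 N0 R_pos FD)
      show "\<kappa> * Rinv vb < 1" using rate by (simp add: \<kappa>_def)
      show "lam 0 = \<omega>\<^sup>2" by (simp add: \<omega>_def lam0 power_mult_distrib)
      show "nl_eigensol (\<lambda>_. 0) (\<lambda>_. 0) (\<omega>\<^sup>2) (u1 0) (u2 0)"
        using tr(1) by (simp only: u10 u20 \<omega>_def e_def)
      show "1 \<le> 4 * \<omega> / (1 + e) * \<bar>integral {0..1/2} (\<lambda>t. sin (\<omega> * (1 - t)) * u1 0 t)
          + integral {1/2..1} (\<lambda>t. sin (\<omega> * (1 - t)) * u2 0 t)\<bar>"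
        unfolding u10 u20 \<omega>_def[symmetric] e_def[symmetric] tr(2) using \<omega>0 e by auto
      show "\<bar>u1 0 x\<bar> \<le> 1/\<omega>" for x
        using \<omega>0 by (simp add: u10 \<omega>_def[symmetric] divide_right_mono)
      show "\<bar>u2 0 x\<bar> \<le> e/\<omega>" for x
        unfolding u20 \<omega>_def[symmetric] e_def[symmetric] using \<omega>0 e0
        by (simp add: abs_mult mult_left_le divide_right_mono)
      show "4 * \<omega> / (1 + e) * (3 * (1/\<omega>)) * ((1 + e) / 12) \<le> 1" using \<omega>0 e by auto
      show "3 * (1/\<omega>) \<le> 11/3 * \<kappa>" "0 < \<kappa>" using \<omega>0 by (auto simp: \<kappa>2 divide_simps)
      show "3 * (1/\<omega>) * ((1 + e) / 12) \<le> 1" using \<omega>4 e by (auto simp: divide_simps)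
      show "max (1/\<omega>) (e/\<omega>) \<le> 88/9 * ((1 + e) / 12) * \<kappa>" "max (1/\<omega>) (e/\<omega>) \<le> 8/3"
        using \<omega>4 e by (auto simp: \<kappa>2 divide_simps)
    qed (use \<omega>0 e0 in auto)
    note fd = this
    obtain L U1 U2 K where K: "lam sums L" "\<forall>x\<in>{0..1/2}. (\<lambda>j. u1 j x) sums U1 x"
        "\<forall>x\<in>{1/2..1}. (\<lambda>j. u2 j x) sums U2 x" "nl_eigensol q N L U1 U2" "0 < K"
      and est: "\<And>m x. x \<in> {0..1/2} \<Longrightarrow> \<bar>U1 x - (\<Sum>j\<le>m. u1 j x)\<bar>
          \<le> K / (1 - \<kappa> * Rinv vb) / real (m + 1) powr (1 + 1/2) * (\<kappa> * Rinv vb) ^ (m + 1)"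
        "\<And>m x. x \<in> {1/2..1} \<Longrightarrow> \<bar>U2 x - (\<Sum>j\<le>m. u2 j x)\<bar>
          \<le> K / (1 - \<kappa> * Rinv vb) / real (m + 1) powr (1 + 1/2) * (\<kappa> * Rinv vb) ^ (m + 1)"
        "\<And>m. \<bar>L - (\<Sum>j\<le>m. lam j)\<bar>
          \<le> K / (1 - \<kappa> * Rinv vb) / real (m + 1) powr (1 + 1/2) * Rinv vb * (\<kappa> * Rinv vb) ^ m"
      using fd_method.fd_convergence[OF fd] by blast
    have Rn: "0 \<le> Rinv vb" by (rule fd_method.Rinv_nonneg[OF fd])
    \<comment> \<open>Chosen for the smaller prefactor \<open>1 / (8 pi n)\<close> of odd
      \<open>n\<close>; the factor 3 for even \<open>n\<close> only adds slack.\<close>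
    define c where "c = K * (8 * pi * real n + 1)"
    define g :: real where "g = (if even n then 3 else 1)"
    have pn: "0 < pi * real n" using n by simp
    have r0: "0 \<le> \<kappa> * Rinv vb" "\<kappa> * Rinv vb < 1" using Rn pn rate by (auto simp: \<kappa>_def)
    have cb: "K \<le> 1 * c" using K(5) pn by (simp add: c_def)
    have ca: "K \<le> g / (8 * pi * real n) * c"
    proof -
      have "K \<le> 1 / (8 * pi * real n) * c"
        using K(5) n by (simp add: c_def field_simps)
      also have "\<dots> \<le> g / (8 * pi * real n) * c"
        using K(5) n by (intro mult_right_mono divide_right_mono) (auto simp: c_def g_def)
      finally show ?thesis .
    qed
    show ?thesis
      unfolding Let_def \<kappa>_def[symmetric]
    proof (rule exI[of _ L], rule exI[of _ U1], rule exI[of _ U2], intro conjI K(1-4),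
        rule exI[of _ c], rule conjI[rotated], rule exI[of _ "1/2"], rule conjI[rotated], intro allI conjI ballI)
      fix m :: nat
      let ?P = "real (m + 1) powr (1 + 1/2)"
      let ?B = "(if even n then 3 * (c / (1 - \<kappa> * Rinv vb)) else c / (1 - \<kappa> * Rinv vb)) / (8 * pi * real n * ?P) * (\<kappa> * Rinv vb) ^ (m + 1)"
      have B: "?B = g / (8 * pi * real n) * (c / (1 - \<kappa> * Rinv vb)) / ?P * (\<kappa> * Rinv vb) ^ (m + 1)"
        by (simp add: g_def mult_ac)
      show "\<bar>U1 x - (\<Sum>j\<le>m. u1 j x)\<bar> \<le> ?B" if "x \<in> {0..1/2}" for x
        unfolding B by (rule order.trans[OF est(1)[OF that] bound[OF ca r0(2)]]) (use r0(1) in auto)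
      show "\<bar>U2 x - (\<Sum>j\<le>m. u2 j x)\<bar> \<le> ?B" if "x \<in> {1/2..1}" for x
        unfolding B by (rule order.trans[OF est(2)[OF that] bound[OF ca r0(2)]]) (use r0(1) in auto)
      show "\<bar>L - (\<Sum>j\<le>m. lam j)\<bar> \<le> c / (1 - \<kappa> * Rinv vb) / ?P * Rinv vb * (\<kappa> * Rinv vb) ^ m"
        using order.trans[OF est(3)[of m, unfolded mult.assoc] bound[OF cb r0(2), of ?P "Rinv vb * (\<kappa> * Rinv vb) ^ m"]] r0(1) Rn
        by (simp add: mult.assoc)
    qed (use K pn in \<open>auto simp: c_def intro!: mult_pos_pos add_pos_pos\<close>)
  qed
  show ?thesis
    by (intro conjI allI impI; elim conjE) (rule A B; assumption)+
qed

end
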